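(* Let $c\in(0,\infty]$ be the limit of $a(z)$ as $z\to\infty$. Irrespective of whether $c<\infty$ or $c=\infty$, the following hold. (i) With $B$ a standard Brownian motion, $$\bigl(W_k^+(t),\,t\ge0\bigr)\stackrel{d}{=}\Bigl(B\Bigl(\int_{[0,\infty)\times(\mathbb{R}^d)^{k-1}}h_t^+(0,\mathbf{y})\,\mu_k(d\rho\,d\mathbf{y})\Bigr),\,t\ge0\Bigr),$$ and the same holds for $W_k^-$ with $h_t^+$ replaced by $h_t^-$. (ii) For $\ell=1,\dots,k$ and every $T>0$, the process $(W_\ell(t),\,0\le t\le T)$ has a modification whose sample paths are Hölder continuous of any order in $[0,1/2)$.
   Context: Fix integers $d\ge1$, $k\ge2$ and a connected graph $\Gamma$ with $k$ vertices and $j$ edges. $a(z)=1/\psi'(z)$, $z>0$, where $\psi:[0,\infty)\to\mathbb{R}$ is of class $C^2$ with $\psi'(z)>0$, $\psi(z)\to\infty$, $(1/\psi')'(z)\to0$ as $z\to\infty$; it enters only through its limit $c\in(0,\infty]$. Convention: $c^{-1}=0$ if $c=\infty$. $e_1=(1,0,\dots,0)\in\mathbb{R}^d$, $s_{d-1}$ is the surface area of the unit sphere in $\mathbb{R}^d$. For a finite set $\mathcal{X}\subset\mathbb{R}^d$ and $t\ge0$, $G(\mathcal{X},t)$ is the undirected graph with vertex set $\mathcal{X}$ and an edge between distinct $x,y\in\mathcal{X}$ iff $\|x-y\|\le t$ (Euclidean norm); $\cong$ denotes graph isomorphism. For $x_1,\dots,x_k\in\mathbb{R}^d$: $h_t(x_1,\dots,x_k)=\mathbf{1}\{G(\{x_1,\dots,x_k\},t)\cong\Gamma\}$;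 $h_t^-(x_1,\dots,x_k)=1$ if $G(\{x_1,\dots,x_k\},t)$ is a connected graph on $k$ vertices with more than $j$ edges, and $0$ otherwise; $h_t^+=h_t+h_t^-$. Let $D_\ell=\dfrac{s_{d-1}}{\ell!\,((k-\ell)!)^2}$, $\ell=1,\dots,k$. For $\ell=2,\dots,k$ define the measure on $[0,\infty)\times(\mathbb{R}^d)^{\ell-1}$ $$\mu_\ell(d\rho\,d\mathbf{y})=D_\ell\,e^{-\ell\rho-c^{-1}\sum_{i=1}^{\ell-1}\langle e_1,y_i\rangle}\,\mathbf{1}\{\rho+c^{-1}\langle e_1,y_i\rangle\ge0,\ i=1,\dots,\ell-1\}\,d\rho\,d\mathbf{y},$$ and $\mu_1(d\rho)=D_1e^{-\rho}\,d\rho$ on $[0,\infty)$. Let $H_1,\dots,H_k$ be independent, $H_\ell$ a Gaussian $\mu_\ell$-noise (centered Gaussian random measure with $H_\ell(A)\sim\mathcal{N}(0,\mu_\ell(A))$ when $\mu_\ell(A)<\infty$, independent on disjoint sets). For $t\ge0$ define, for $2\le\ell\le k-1$, $$W_\ell(t)=\int_{[0,\infty)\times(\mathbb{R}^d)^{\ell-1}}\int_{(\mathbb{R}^d)^{k-\ell}}e^{-\sum_{i=1}^{k-\ell}(\rho+c^{-1}\langle e_1,z_i\rangle)}\,\mathbf{1}\{\rho+c^{-1}\langle e_1,z_i\rangle\ge0,\ i=1,\dots,k-\ell\}\,h_t(0,\mathbf{y},\mathbf{z})\,d\mathbf{z}\,H_\ell(d\rho\,d\mathbf{y}),$$ $$W_1(t)=\int_0^\infty\int_{(\mathbb{R}^d)^{k-1}}e^{-\sum_{i=1}^{k-1}(\rho+c^{-1}\langle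 e_1,z_i\rangle)}\,\mathbf{1}\{\rho+c^{-1}\langle e_1,z_i\rangle\ge0,\ i=1,\dots,k-1\}\,h_t(0,\mathbf{z})\,d\mathbf{z}\,H_1(d\rho),$$ $$W_k(t)=\int_{[0,\infty)\times(\mathbb{R}^d)^{k-1}}h_t(0,\mathbf{y})\,H_k(d\rho\,d\mathbf{y}).$$ $W_\ell^\pm$ is defined by the same formula as $W_\ell$ (same noise $H_\ell$) with $h_t$ replaced by $h_t^\pm$; so $W_\ell=W_\ell^+-W_\ell^-$. $\stackrel{d}{=}$ denotes equality of finite-dimensional distributions. *)

theory Defs
  imports "HOL-Probability.Probability"
begin

section \<open>Graphs\<close>

datatype 'v ugraph = UGraph (verts: "'v set") (edges: "'v set set")

definition simple_graph :: "'v ugraph \<Rightarrow> bool" where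
  "simple_graph G \<longleftrightarrow> finite (verts G) \<and>
     edges G \<subseteq> {{x, y} |x y. x \<in> verts G \<and> y \<in> verts G \<and> x \<noteq> y}"

definition connected_graph :: "'v ugraph \<Rightarrow> bool" where
  "connected_graph G \<longleftrightarrow> verts G \<noteq> {} \<and>
     (\<forall>x\<in>verts G. \<forall>y\<in>verts G. (x, y) \<in> {(u, v). {u, v} \<in> edges G}\<^sup>*)"

definition graph_iso :: "'v ugraph \<Rightarrow> 'w ugraph \<Rightarrow> bool" where
  "graph_iso G G' \<longleftrightarrow> (\<exists>f. bij_betw f (verts G) (verts G') \<and>
     (\<forall>x\<in>verts G. \<forall>y\<in>verts G. {x, y} \<in> edges G \<longleftrightarrow> {f x, f y} \<in> edges G'))"

definition geom_graph :: "'a::metric_space set \<Rightarrow> real \<Rightarrow> 'a ugraph" where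
  "geom_graph X t =
     UGraph X {{x, y} |x y. x \<in> X \<and> y \<in> X \<and> x \<noteq> y \<and> dist x y \<le> t}"

text \<open>The \<open>k\<close> arguments of the indicator functions are passed as a list of points.  Coinciding
  points give a graph with fewer vertices, for which all indicators below vanish.\<close>

definition h_ind :: "'v ugraph \<Rightarrow> real \<Rightarrow> 'a::metric_space list \<Rightarrow> real" where
  "h_ind \<Gamma> t xs = of_bool (graph_iso (geom_graph (set xs) t) \<Gamma>)"

definition h_minus :: "'v ugraph \<Rightarrow> real \<Rightarrow> 'a::metric_space list \<Rightarrow> real" where
  "h_minus \<Gamma> t xs = of_bool (connected_graph (geom_graph (set xs) t) \<and>
     card (set xs) = card (verts \<Gamma>) \<and> card (edges (geom_graph (set xs) t)) > card (edges \<Gamma>))"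

definition h_plus :: "'v ugraph \<Rightarrow> real \<Rightarrow> 'a::metric_space list \<Rightarrow> real" where
  "h_plus \<Gamma> t xs = h_ind \<Gamma> t xs + h_minus \<Gamma> t xs"


section \<open>Gaussian noise and its stochastic integral\<close>

text \<open>The law \<open>N(0, v)\<close>.  The density only makes sense for positive variance; \<open>N(0, 0)\<close> is the
  point mass at \<open>0\<close>.\<close>

definition centered_normal :: "real \<Rightarrow> real measure" where
  "centered_normal v =
     (if v = 0 then return borel 0 else density lborel (normal_density 0 (sqrt v)))"

definition fin_sets :: "'b measure \<Rightarrow> 'b set set" where
  "fin_sets \<mu> = {A \<in> sets \<mu>. emeasure \<mu> A < \<infinity>}"

text \<open>Centered Gaussian, independently scattered, almost surely \<open>\<sigma>\<close>-additive random measure with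
  control measure \<open>\<mu>\<close>.  Quantifying over infinite sequences of disjoint sets includes finite
  families (pad with the empty set).\<close>

definition gaussian_noise :: "'w measure \<Rightarrow> 'b measure \<Rightarrow> ('b set \<Rightarrow> 'w \<Rightarrow> real) \<Rightarrow> bool" where
  "gaussian_noise M \<mu> H \<longleftrightarrow>
     (\<forall>A\<in>fin_sets \<mu>. H A \<in> borel_measurable M \<and>
        distr M borel (H A) = centered_normal (measure \<mu> A)) \<and>
     (\<forall>A::nat \<Rightarrow> 'b set. range A \<subseteq> fin_sets \<mu> \<and> disjoint_family A \<longrightarrow>
        prob_space.indep_vars M (\<lambda>_. borel) (\<lambda>i. H (A i)) UNIV) \<and>
     (\<forall>A::nat \<Rightarrow> 'b set. range A \<subseteq> sets \<mu> \<and> disjoint_family A \<and>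
        emeasure \<mu> (\<Union>i. A i) < \<infinity> \<longrightarrow>
        (AE w in M. (\<lambda>i. H (A i) w) sums H (\<Union>i. A i) w))"

definition noise_events ::
    "'w measure \<Rightarrow> 'b measure \<Rightarrow> ('b set \<Rightarrow> 'w \<Rightarrow> real) \<Rightarrow> 'w set set" where
  "noise_events M \<mu> H = sigma_sets (space M)
     {H A -` B \<inter> space M |A B. A \<in> fin_sets \<mu> \<and> B \<in> sets borel}"

definition simple_noise_integral ::
    "'b measure \<Rightarrow> ('b set \<Rightarrow> 'w \<Rightarrow> real) \<Rightarrow> ('b \<Rightarrow> real) \<Rightarrow> 'w \<Rightarrow> real" where
  "simple_noise_integral \<mu> H s w = (\<Sum>v\<in>s ` space \<mu>. v * H {x \<in> space \<mu>. s x = v} w)"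

text \<open>\<open>X\<close> is a version of the integral of \<open>f\<close> against the noise: the integral of simple functions
  with support of finite measure, extended by the isometry from \<open>L\<^sup>2(\<mu>)\<close> to \<open>L\<^sup>2\<close> of the probability space.\<close>

definition has_noise_integral ::
    "'w measure \<Rightarrow> 'b measure \<Rightarrow> ('b set \<Rightarrow> 'w \<Rightarrow> real) \<Rightarrow> ('b \<Rightarrow> real) \<Rightarrow> ('w \<Rightarrow> real) \<Rightarrow> bool" where
  "has_noise_integral M \<mu> H f X \<longleftrightarrow>
     f \<in> borel_measurable \<mu> \<and> X \<in> borel_measurable M \<and>
     (\<exists>s::nat \<Rightarrow> 'b \<Rightarrow> real.
        (\<forall>n. simple_function \<mu> (s n) \<and> emeasure \<mu> {x \<in> space \<mu>. s n x \<noteq> 0} < \<infinity>) \<and>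
        (\<lambda>n. \<integral>\<^sup>+x. ennreal ((s n x - f x)\<^sup>2) \<partial>\<mu>) \<longlonglongrightarrow> 0 \<and>
        (\<lambda>n. \<integral>\<^sup>+w. ennreal ((simple_noise_integral \<mu> H (s n) w - X w)\<^sup>2) \<partial>M) \<longlonglongrightarrow> 0)"

text \<open>The integral is determined only almost surely; \<open>SOME\<close> fixes a version.  For \<open>f\<close> outside
  \<open>L\<^sup>2(\<mu>)\<close> the value is unspecified.\<close>

definition noise_integral ::
    "'w measure \<Rightarrow> 'b measure \<Rightarrow> ('b set \<Rightarrow> 'w \<Rightarrow> real) \<Rightarrow> ('b \<Rightarrow> real) \<Rightarrow> 'w \<Rightarrow> real" where
  "noise_integral M \<mu> H f = (SOME X. has_noise_integral M \<mu> H f X)"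


section \<open>The limiting processes\<close>

text \<open>The surface area of the unit sphere in \<open>d\<close>-space is \<open>d\<close> times the volume of the unit ball,
  i.e. \<open>2 \<pi>\<^bsup>d/2\<^esup> / \<Gamma>(d/2)\<close>.\<close>

definition sphere_area :: "'d::finite itself \<Rightarrow> real" where
  "sphere_area _ = real CARD('d) * measure lborel (ball (0::real^'d) 1)"

definition D_const :: "'d::finite itself \<Rightarrow> nat \<Rightarrow> nat \<Rightarrow> real" where
  "D_const d k l = sphere_area d / (fact l * (fact (k - l))\<^sup>2)"

text \<open>A point \<open>(y\<^sub>1, \<dots>, y\<^sub>m)\<close> of \<open>(\<real>\<^sup>d)\<^sup>m\<close> is an extensional function on \<open>{1..m}\<close>.  For \<open>m = 0\<close>
  this is a one-point space of mass \<open>1\<close>, so that the cases \<open>l = 1\<close> of \<open>mu\<close> and \<open>l = 1\<close>, \<open>l = k\<close>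
  of the integrand below need no separate treatment (see \<open>mu_1\<close> and \<open>W_integrand_top\<close>).
  Throughout, \<open>e\<close> is the first unit vector and \<open>r\<close> stands for \<open>c\<^bsup>-1\<^esup>\<close>.\<close>

definition mu :: "real^'d \<Rightarrow> real \<Rightarrow> nat \<Rightarrow> nat \<Rightarrow> (real \<times> (nat \<Rightarrow> real^'d::finite)) measure" where
  "mu e r k l = density
     (restrict_space lborel {0..} \<Otimes>\<^sub>M Pi\<^sub>M {1..l-1} (\<lambda>_. lborel))
     (\<lambda>(\<rho>, y). ennreal (D_const TYPE('d) k l * exp (- real l * \<rho> - r * (\<Sum>i=1..l-1. e \<bullet> y i)) *
        of_bool (\<forall>i\<in>{1..l-1}. 0 \<le> \<rho> + r * (e \<bullet> y i))))"

definition W_integrand ::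
    "real^'d \<Rightarrow> real \<Rightarrow> nat \<Rightarrow> (real \<Rightarrow> (real^'d::finite) list \<Rightarrow> real) \<Rightarrow> nat \<Rightarrow> real
      \<Rightarrow> real \<times> (nat \<Rightarrow> real^'d) \<Rightarrow> real" where
  "W_integrand e r k h l t = (\<lambda>(\<rho>, y).
     \<integral>z. exp (- (\<Sum>i=1..k-l. \<rho> + r * (e \<bullet> z i))) *
          of_bool (\<forall>i\<in>{1..k-l}. 0 \<le> \<rho> + r * (e \<bullet> z i)) *
          h t (0 # map y [1..<l] @ map z [1..<k-l+1])
       \<partial>(Pi\<^sub>M {1..k-l} (\<lambda>_. lborel)))"

text \<open>\<open>h\<close> is one of the three families of indicator functions above, and \<open>H l\<close> is the \<open>l\<close>-th noise.\<close>

definition W_process ::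
    "'w measure \<Rightarrow> (nat \<Rightarrow> (real \<times> (nat \<Rightarrow> real^'d)) set \<Rightarrow> 'w \<Rightarrow> real) \<Rightarrow> real^'d \<Rightarrow> real \<Rightarrow> nat
      \<Rightarrow> (real \<Rightarrow> (real^'d::finite) list \<Rightarrow> real) \<Rightarrow> nat \<Rightarrow> real \<Rightarrow> 'w \<Rightarrow> real" where
  "W_process M H e r k h l t = noise_integral M (mu e r k l) (H l) (W_integrand e r k h l t)"

lemma mu_1:
  fixes e :: "real^'d::finite"
  shows "mu e r k 1 = density (restrict_space lborel {0..} \<Otimes>\<^sub>M Pi\<^sub>M {} (\<lambda>_. lborel))
    (\<lambda>(\<rho>, y). ennreal (D_const TYPE('d) k 1 * exp (- \<rho>)))"
  by (simp add: mu_def)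

lemma W_integrand_top:
  "W_integrand e r k h k t (\<rho>, y) = h t (0 # map y [1..<k])"
  by (simp add: W_integrand_def PiM_empty)


section \<open>Stochastic processes\<close>

definition std_brownian_motion :: "'w measure \<Rightarrow> (real \<Rightarrow> 'w \<Rightarrow> real) \<Rightarrow> bool" where
  "std_brownian_motion M B \<longleftrightarrow> prob_space M \<and>
     (\<forall>t\<ge>0. B t \<in> borel_measurable M) \<and>
     (AE w in M. B 0 w = 0) \<and>
     (\<forall>s t. 0 \<le> s \<and> s \<le> t \<longrightarrow>
        distr M borel (\<lambda>w. B t w - B s w) = centered_normal (t - s)) \<and>
     (\<forall>\<tau>::nat \<Rightarrow> real. 0 \<le> \<tau> 0 \<and> mono \<tau> \<longrightarrow>
        prob_space.indep_vars M (\<lambda>_. borel) (\<lambda>i w. B (\<tau> (Suc i)) w - B (\<tau> i) w) UNIV) \<and>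
     (AE w in M. continuous_on {0..} (\<lambda>t. B t w))"

text \<open>Measurability is included because \<^const>\<open>distr\<close> is meaningless for non-measurable maps.\<close>

definition same_fdds ::
    "'t set \<Rightarrow> 'w measure \<Rightarrow> ('t \<Rightarrow> 'w \<Rightarrow> real) \<Rightarrow> 'v measure \<Rightarrow> ('t \<Rightarrow> 'v \<Rightarrow> real) \<Rightarrow> bool" where
  "same_fdds T M X N Y \<longleftrightarrow>
     (\<forall>t\<in>T. X t \<in> borel_measurable M \<and> Y t \<in> borel_measurable N) \<and>
     (\<forall>J. finite J \<and> J \<subseteq> T \<longrightarrow>
        distr M (Pi\<^sub>M J (\<lambda>_. borel)) (\<lambda>w. \<lambda>t\<in>J. X t w) =
        distr N (Pi\<^sub>M J (\<lambda>_. borel)) (\<lambda>w. \<lambda>t\<in>J. Y t w))"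

definition modification_on ::
    "'t set \<Rightarrow> 'w measure \<Rightarrow> ('t \<Rightarrow> 'w \<Rightarrow> real) \<Rightarrow> ('t \<Rightarrow> 'w \<Rightarrow> real) \<Rightarrow> bool" where
  "modification_on T M X Y \<longleftrightarrow>
     (\<forall>t\<in>T. Y t \<in> borel_measurable M \<and> (AE w in M. Y t w = X t w))"

definition hoelder_on :: "real set \<Rightarrow> real \<Rightarrow> (real \<Rightarrow> real) \<Rightarrow> bool" where
  "hoelder_on T \<gamma> f \<longleftrightarrow> (\<exists>C. \<forall>s\<in>T. \<forall>t\<in>T. \<bar>f t - f s\<bar> \<le> C * \<bar>t - s\<bar> powr \<gamma>)"

end

theory Submission
  imports Defs
begin

text \<open>
  The integral of a fixed function against the noise is an isometry from \<open>L\<^sup>2(\<mu>)\<close> into the centred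
  Gaussian variables, so everything about \<open>W\<close> is decided by the deterministic curve \<open>t \<mapsto> f\<^sub>t\<close> of its
  integrands (\<open>W_integrand\<close>) in \<open>L\<^sup>2(\<mu>)\<close>.

  (i) For \<open>l = k\<close> there is nothing to integrate out and \<open>f\<^sub>t\<close> is the indicator of a region \<open>A\<^sub>t\<close>, for
  \<open>h\<^sup>-\<close> the one where the graph is connected with more than \<open>j\<close> edges, for \<open>h\<^sup>+\<close> the one where it is
  isomorphic to \<open>\<Gamma>\<close> or connected with more than \<open>j\<close> edges.  A growing threshold only adds edges, so
  both properties persist (\<open>denser_mono\<close>, \<open>iso_or_denser_mono\<close>) and the regions increase.  Almost
  surely the process is the noise of \<open>A\<^sub>t\<close>, and its increments are the noise of disjoint sets: they are
  independent and centred normal with variance \<open>\<mu>(A\<^sub>t) - \<mu>(A\<^sub>s)\<close>, exactly as for Brownian motion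
  run at the times \<open>\<mu>(A\<^sub>t)\<close>.  In \<open>distr_noise_increasing\<close> and \<open>distr_brownian_times\<close> both
  finite-dimensional laws appear as the image of one product measure under partial sums.

  (ii) The indicators \<open>h\<^sub>s\<close> and \<open>h\<^sub>t\<close> can differ only if two of the points have a distance in \<open>(s, t]\<close>, and
  connectedness confines all points to a fixed ball as long as \<open>t \<le> T\<close>.  A spherical shell with
  radii \<open>s\<close> and \<open>t\<close> has volume \<open>O(t - s)\<close>, hence \<open>\<parallel>f\<^sub>t - f\<^sub>s\<parallel>\<^sup>2 \<le> C (t - s)\<close> (\<open>f_increment_L2\<close>).  For a
  Gaussian variable the second moment controls all others, so the \<open>2p\<close>-th moment of \<open>W\<^sub>t - W\<^sub>s\<close> is at
  most \<open>c\<^sub>p \<bar>t - s\<bar>\<^sup>p\<close> for every \<open>p\<close>, and Kolmogorov's criterion (\<open>kolmogorov_modification\<close>) with \<open>p\<close>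
  tending to infinity gives all orders below \<open>1/2\<close>.
\<close>

section \<open>Centred normal laws\<close>

text \<open>Writing the law as the image of the standard normal law under a scaling removes the distinction between
  zero and positive variance: the scaling by \<open>0\<close> gives the point mass.\<close>

lemma centered_normal_eq_scaled:
  assumes "0 \<le> v"
  shows "centered_normal v = distr std_normal_distribution borel (\<lambda>x. sqrt v * x)"
proof (cases "v = 0")
  case True
  interpret prob_space std_normal_distribution by (rule prob_space_normal_density) simp
  show ?thesis using True by (simp add: centered_normal_def)
next
  case False
  interpret prob_space std_normal_distribution by (rule prob_space_normal_density) simp
  have "distributed std_normal_distribution lborel (\<lambda>x. x) std_normal_density"
    unfolding distributed_def by (auto simp: distr_id2 intro!: measure_eqI)
  then have "distributed std_normal_distribution lborel (\<lambda>x. 0 + sqrt v * x)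
      (normal_density (0 + sqrt v * 0) (\<bar>sqrt v\<bar> * 1))"
    using False assms by (intro normal_density_affine) auto
  then show ?thesis
    using False assms by (simp add: distributed_def centered_normal_def cong: distr_cong)
qed

lemma real_distribution_centered_normal:
  assumes "0 \<le> v"
  shows "real_distribution (centered_normal v)"
proof -
  interpret prob_space std_normal_distribution by (rule prob_space_normal_density) simp
  show ?thesis
    unfolding centered_normal_eq_scaled[OF assms] by (rule real_distribution_distr) simp
qed

lemma char_centered_normal:
  assumes "0 \<le> v"
  shows "char (centered_normal v) t = complex_of_real (exp (- (v * t\<^sup>2) / 2))"
proof -
  have "char (centered_normal v) t = char std_normal_distribution (sqrt v * t)"
    unfolding centered_normal_eq_scaled[OF assms] char_def
    by (subst integral_distr) (auto simp: mult_ac)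
  also have "\<dots> = complex_of_real (exp (- (v * t\<^sup>2) / 2))"
    using assms by (simp add: char_std_normal_distribution power_mult_distrib)
  finally show ?thesis .
qed

text \<open>The double factorial \<open>(2p - 1)!!\<close>, the \<open>2p\<close>-th moment of the standard normal law.\<close>

definition normal_moment :: "nat \<Rightarrow> real" where
  "normal_moment p = fact (2 * p) / (2 ^ p * fact p)"

lemma normal_moment_nonneg: "0 \<le> normal_moment p"
  by (simp add: normal_moment_def)

lemma nn_integral_power_centered_normal:
  assumes "0 \<le> v"
  shows "(\<integral>\<^sup>+x. ennreal (x ^ (2 * p)) \<partial>centered_normal v) = ennreal (normal_moment p * v ^ p)"
proof -
  have *: "has_bochner_integral lborel (\<lambda>x. std_normal_density x * x ^ (2 * p)) (normal_moment p)"
    unfolding normal_moment_def by (rule std_normal_moment_even)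
  have sv: "sqrt v ^ (p * 2) = v ^ p"
    using assms by (simp add: mult.commute[of p] power_mult)
  have nn: "0 \<le> x ^ (2 * p)" for x :: real
    by (simp add: zero_le_even_power)
  have "(\<integral>\<^sup>+x. ennreal (x ^ (2 * p)) \<partial>centered_normal v)
      = (\<integral>\<^sup>+x. ennreal ((sqrt v * x) ^ (2 * p)) \<partial>std_normal_distribution)"
    unfolding centered_normal_eq_scaled[OF assms] by (subst nn_integral_distr) auto
  also have "\<dots> = (\<integral>\<^sup>+x. ennreal (std_normal_density x) * ennreal ((sqrt v * x) ^ (2 * p)) \<partial>lborel)"
    by (subst nn_integral_density) auto
  also have "\<dots> = (\<integral>\<^sup>+x. ennreal (v ^ p) * ennreal (std_normal_density x * x ^ (2 * p)) \<partial>lborel)"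
    using assms by (intro nn_integral_cong)
      (simp add: ennreal_mult'[symmetric] power_mult_distrib sv nn mult_ac)
  also have "\<dots> = ennreal (v ^ p) * ennreal (normal_moment p)"
    using * by (subst nn_integral_cmult)
      (auto simp: nn_integral_eq_integral has_bochner_integral_iff nn)
  finally show ?thesis
    using assms by (simp add: ennreal_mult normal_moment_nonneg mult_ac)
qed

lemma normal_moment_1: "normal_moment 1 = 1"
  by (simp add: normal_moment_def fact_numeral)

text \<open>The characteristic function of the sum is the product of those of the summands, and
  it identifies the law.  This route covers summands of variance \<open>0\<close>, for which there is no density.\<close>

lemma (in prob_space) distr_sum_indep_centered_normal:
  fixes X :: "'i \<Rightarrow> 'a \<Rightarrow> real"
  assumes "indep_vars (\<lambda>_. borel) X I" "finite I"
    and v: "\<And>i. i \<in> I \<Longrightarrow> 0 \<le> v i"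
    and X: "\<And>i. i \<in> I \<Longrightarrow> distr M borel (X i) = centered_normal (v i)"
  shows "distr M borel (\<lambda>w. \<Sum>i\<in>I. c i * X i w) = centered_normal (\<Sum>i\<in>I. (c i)\<^sup>2 * v i)"
proof (rule Levy_uniqueness)
  have rv: "random_variable borel (X i)" if "i \<in> I" for i
    using assms(1) that by (simp add: indep_vars_def)
  have ind: "indep_vars (\<lambda>_. borel) (\<lambda>i w. c i * X i w) I"
    by (rule indep_vars_compose2[OF assms(1), where Y="\<lambda>i x. c i * x"]) simp
  show "real_distribution (distr M borel (\<lambda>w. \<Sum>i\<in>I. c i * X i w))"
    using rv by (intro real_distribution_distr) auto
  have nn: "0 \<le> (\<Sum>i\<in>I. (c i)\<^sup>2 * v i)" using v by (auto intro!: sum_nonneg)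
  then show "real_distribution (centered_normal (\<Sum>i\<in>I. (c i)\<^sup>2 * v i))"
    by (rule real_distribution_centered_normal)
  show "char (distr M borel (\<lambda>w. \<Sum>i\<in>I. c i * X i w)) = char (centered_normal (\<Sum>i\<in>I. (c i)\<^sup>2 * v i))"
  proof
    fix t
    have "char (distr M borel (\<lambda>w. c i * X i w)) t = complex_of_real (exp (- ((c i)\<^sup>2 * v i * t\<^sup>2) / 2))"
      if "i \<in> I" for i
    proof -
      have "char (distr M borel (\<lambda>w. c i * X i w)) t = char (distr M borel (X i)) (c i * t)"
        unfolding char_def using rv[OF that] by (subst (1 2) integral_distr) (auto simp: mult_ac)
      then show ?thesis
        using X[OF that] v[OF that] by (simp add: char_centered_normal power_mult_distrib mult_ac)
    qed
    then have "char (distr M borel (\<lambda>w. \<Sum>i\<in>I. c i * X i w)) t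
        = (\<Prod>i\<in>I. complex_of_real (exp (- ((c i)\<^sup>2 * v i * t\<^sup>2) / 2)))"
      by (simp add: char_distr_sum[OF ind])
    also have "\<dots> = complex_of_real (exp (\<Sum>i\<in>I. - ((c i)\<^sup>2 * v i * t\<^sup>2) / 2))"
      using assms(2) by (simp add: exp_sum)
    also have "(\<Sum>i\<in>I. - ((c i)\<^sup>2 * v i * t\<^sup>2) / 2) = - ((\<Sum>i\<in>I. (c i)\<^sup>2 * v i) * t\<^sup>2) / 2"
      by (simp add: sum_distrib_right sum_divide_distrib sum_negf)
    finally show "char (distr M borel (\<lambda>w. \<Sum>i\<in>I. c i * X i w)) t
        = char (centered_normal (\<Sum>i\<in>I. (c i)\<^sup>2 * v i)) t"
      using nn by (simp add: char_centered_normal)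
  qed
qed

section \<open>Limits of integrals\<close>

text \<open>By monotone convergence the sum has a finite integral, hence is finite almost everywhere.
  This replaces Borel--Cantelli arguments and passages to almost surely convergent subsequences.\<close>

lemma AE_summable_of_nn_integral_bound:
  fixes v :: "nat \<Rightarrow> 'a \<Rightarrow> real"
  assumes [measurable]: "\<And>n. v n \<in> borel_measurable M"
    and nn: "\<And>n x. 0 \<le> v n x"
    and bound: "\<And>n. (\<integral>\<^sup>+x. ennreal (v n x) \<partial>M) \<le> ennreal (b n)"
    and b: "\<And>n. 0 \<le> b n" "summable b"
  shows "AE x in M. summable (\<lambda>n. v n x)"
proof -
  have "(\<integral>\<^sup>+x. (\<Sum>n. ennreal (v n x)) \<partial>M) = (\<Sum>n. \<integral>\<^sup>+x. ennreal (v n x) \<partial>M)"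
    by (rule nn_integral_suminf) simp
  also have "\<dots> \<le> (\<Sum>n. ennreal (b n))"
    by (intro suminf_le bound) auto
  also have "\<dots> = ennreal (\<Sum>n. b n)"
    using b by (rule suminf_ennreal2)
  finally have "(\<integral>\<^sup>+x. (\<Sum>n. ennreal (v n x)) \<partial>M) \<noteq> \<infinity>"
    by (auto simp: top_unique)
  then have "AE x in M. (\<Sum>n. ennreal (v n x)) \<noteq> \<infinity>"
    by (intro nn_integral_PInf_AE) auto
  then show ?thesis
    by eventually_elim (auto intro: summable_suminf_not_top nn)
qed

text \<open>Fatou's lemma, in the form in which uniform moment bounds pass to almost sure limits.\<close>

lemma nn_integral_le_of_AE_tendsto:
  fixes u :: "nat \<Rightarrow> 'a \<Rightarrow> ennreal"
  assumes [measurable]: "\<And>n. u n \<in> borel_measurable M"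
    and lim: "AE x in M. (\<lambda>n. u n x) \<longlonglongrightarrow> g x"
    and bound: "\<And>n. (\<integral>\<^sup>+x. u n x \<partial>M) \<le> C"
  shows "(\<integral>\<^sup>+x. g x \<partial>M) \<le> C"
proof -
  have "(\<integral>\<^sup>+x. g x \<partial>M) = (\<integral>\<^sup>+x. liminf (\<lambda>n. u n x) \<partial>M)"
    using lim by (intro nn_integral_cong_AE) (auto elim!: eventually_mono simp: lim_imp_Liminf)
  also have "\<dots> \<le> liminf (\<lambda>n. \<integral>\<^sup>+x. u n x \<partial>M)"
    by (rule nn_integral_liminf) simp
  also have "\<dots> \<le> C"
    by (rule order_trans[OF Liminf_le_Limsup Limsup_bounded]) (auto simp: bound)
  finally show ?thesis .
qed

lemma nn_integral_square_add_le:
  fixes f g :: "'a \<Rightarrow> real"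
  assumes [measurable]: "f \<in> borel_measurable M" "g \<in> borel_measurable M"
  shows "(\<integral>\<^sup>+x. ennreal ((f x + g x)\<^sup>2) \<partial>M)
    \<le> 2 * (\<integral>\<^sup>+x. ennreal ((f x)\<^sup>2) \<partial>M) + 2 * (\<integral>\<^sup>+x. ennreal ((g x)\<^sup>2) \<partial>M)"
proof -
  have "ennreal ((a + b)\<^sup>2) \<le> 2 * ennreal (a\<^sup>2) + 2 * ennreal (b\<^sup>2)" for a b :: real
  proof -
    have "(a + b)\<^sup>2 \<le> 2 * a\<^sup>2 + 2 * b\<^sup>2"
      using sum_squares_bound[of a b] by (simp add: power2_sum)
    then have "ennreal ((a + b)\<^sup>2) \<le> ennreal (2 * a\<^sup>2 + 2 * b\<^sup>2)"
      by (rule ennreal_leI)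
    also have "\<dots> = 2 * ennreal (a\<^sup>2) + 2 * ennreal (b\<^sup>2)"
      by (simp add: ennreal_mult)
    finally show ?thesis .
  qed
  then have "(\<integral>\<^sup>+x. ennreal ((f x + g x)\<^sup>2) \<partial>M)
      \<le> (\<integral>\<^sup>+x. 2 * ennreal ((f x)\<^sup>2) + 2 * ennreal ((g x)\<^sup>2) \<partial>M)"
    by (intro nn_integral_mono)
  then show ?thesis
    by (simp add: nn_integral_add nn_integral_cmult)
qed

lemma tendsto_zero_ennreal_sandwich:
  fixes a b c :: "nat \<Rightarrow> ennreal"
  assumes "a \<longlonglongrightarrow> 0" "b \<longlonglongrightarrow> 0" "\<And>n. c n \<le> 2 * a n + 2 * b n"
  shows "c \<longlonglongrightarrow> 0"
proof -
  have "(\<lambda>n. 2 * a n + 2 * b n) \<longlonglongrightarrow> 2 * 0 + 2 * 0"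
    by (intro tendsto_add ennreal_tendsto_cmult assms(1,2)) auto
  then show ?thesis
    using tendsto_sandwich[where f="\<lambda>_. 0" and g=c and h="\<lambda>n. 2 * a n + 2 * b n" and net=sequentially and c=0]
      assms(3) by simp
qed

lemma tendsto_zero_ennreal_subseq:
  fixes a :: "nat \<Rightarrow> ennreal"
  assumes "a \<longlonglongrightarrow> 0" "\<And>n. 0 < b n"
  obtains r where "\<And>n. a (r n) \<le> ennreal (b n)"
proof -
  have "\<exists>m. a m \<le> ennreal (b n)" for n
    using order_tendstoD(2)[OF assms(1), of "ennreal (b n)"] assms(2)[of n]
    by (auto simp: eventually_sequentially intro: less_imp_le)
  then show ?thesis using that by metis
qed

section \<open>Simple functions with support of finite measure\<close>

definition fin_simple :: "'b measure \<Rightarrow> ('b \<Rightarrow> real) \<Rightarrow> bool" where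
  "fin_simple \<mu> s \<longleftrightarrow> simple_function \<mu> s \<and> emeasure \<mu> {x \<in> space \<mu>. s x \<noteq> 0} < \<infinity>"

lemma fin_sets_subset:
  assumes "B \<in> sets \<mu>" "B \<subseteq> A" "A \<in> fin_sets \<mu>"
  shows "B \<in> fin_sets \<mu>"
proof -
  have "emeasure \<mu> B \<le> emeasure \<mu> A"
    using assms by (auto simp: fin_sets_def intro: emeasure_mono)
  also have "\<dots> < \<infinity>" using assms by (simp add: fin_sets_def)
  finally show ?thesis using assms(1) by (simp add: fin_sets_def)
qed

lemma fin_sets_Un:
  assumes "A \<in> fin_sets \<mu>" "B \<in> fin_sets \<mu>"
  shows "A \<union> B \<in> fin_sets \<mu>"
proof -
  have "emeasure \<mu> (A \<union> B) \<le> emeasure \<mu> A + emeasure \<mu> B"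
    using assms by (intro emeasure_subadditive) (simp_all add: fin_sets_def)
  also have "\<dots> < \<infinity>"
    using assms by (simp add: fin_sets_def)
  finally show ?thesis using assms by (auto simp: fin_sets_def)
qed

lemma fin_sets_UN:
  assumes "finite J" "\<And>j. j \<in> J \<Longrightarrow> A j \<in> fin_sets \<mu>"
  shows "(\<Union>j\<in>J. A j) \<in> fin_sets \<mu>"
  using assms
proof (induction J rule: finite_induct)
  case empty
  then show ?case by (simp add: fin_sets_def)
next
  case (insert j J)
  then show ?case using fin_sets_Un[of "A j" \<mu> "\<Union>j\<in>J. A j"] by simp
qed

lemma fin_simple_support: "fin_simple \<mu> s \<Longrightarrow> {x \<in> space \<mu>. s x \<noteq> 0} \<in> fin_sets \<mu>"
  unfolding fin_simple_def fin_sets_def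
  using borel_measurable_simple_function[of \<mu> s] by auto

lemma fin_simple_level_set:
  assumes "fin_simple \<mu> s" "v \<noteq> 0"
  shows "{x \<in> space \<mu>. s x = v} \<in> fin_sets \<mu>"
  using assms borel_measurable_simple_function[of \<mu> s]
  by (intro fin_sets_subset[OF _ _ fin_simple_support[OF assms(1)]]) (auto simp: fin_simple_def)

lemma nn_integral_square_fin_simple:
  assumes "fin_simple \<mu> s"
  shows "(\<integral>\<^sup>+x. ennreal ((s x)\<^sup>2) \<partial>\<mu>)
    = ennreal (\<Sum>v\<in>s ` space \<mu> - {0}. v\<^sup>2 * measure \<mu> {x \<in> space \<mu>. s x = v})"
proof -
  let ?V = "s ` space \<mu> - {0}"
  have fin: "finite ?V" using assms by (auto simp: fin_simple_def simple_function_def)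
  have B: "{x \<in> space \<mu>. s x = v} \<in> sets \<mu>"
      "emeasure \<mu> {x \<in> space \<mu>. s x = v} = ennreal (measure \<mu> {x \<in> space \<mu>. s x = v})" if "v \<in> ?V" for v
    using fin_simple_level_set[OF assms, of v] that
    by (auto simp: fin_sets_def emeasure_eq_ennreal_measure)
  have "ennreal ((s x)\<^sup>2) = (\<Sum>v\<in>?V. ennreal (v\<^sup>2) * indicator {x \<in> space \<mu>. s x = v} x)"
    if "x \<in> space \<mu>" for x
  proof -
    have "(\<Sum>v\<in>?V. ennreal (v\<^sup>2) * indicator {x \<in> space \<mu>. s x = v} x)
        = (\<Sum>v\<in>?V. if v = s x then ennreal (v\<^sup>2) else 0)"
      using that by (intro sum.cong) (auto simp: indicator_def)
    also have "\<dots> = ennreal ((s x)\<^sup>2)"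
      using fin that by (subst sum.delta) auto
    finally show ?thesis by simp
  qed
  then have "(\<integral>\<^sup>+x. ennreal ((s x)\<^sup>2) \<partial>\<mu>)
      = (\<integral>\<^sup>+x. (\<Sum>v\<in>?V. ennreal (v\<^sup>2) * indicator {x \<in> space \<mu>. s x = v} x) \<partial>\<mu>)"
    by (intro nn_integral_cong)
  also have "\<dots> = (\<Sum>v\<in>?V. ennreal (v\<^sup>2) * emeasure \<mu> {x \<in> space \<mu>. s x = v})"
    using B(1) by (subst nn_integral_sum) (auto simp: nn_integral_cmult_indicator)
  also have "\<dots> = (\<Sum>v\<in>?V. ennreal (v\<^sup>2 * measure \<mu> {x \<in> space \<mu>. s x = v}))"
    by (intro sum.cong refl) (simp only: B(2), simp add: ennreal_mult)
  also have "\<dots> = ennreal (\<Sum>v\<in>?V. v\<^sup>2 * measure \<mu> {x \<in> space \<mu>. s x = v})"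
    by (rule sum_ennreal) simp
  finally show ?thesis .
qed

lemma fin_simple_diff:
  assumes "fin_simple \<mu> s" "fin_simple \<mu> s'"
  shows "fin_simple \<mu> (\<lambda>x. s x - s' x)"
proof -
  have *: "simple_function \<mu> (\<lambda>x. s x - s' x)"
    using assms by (auto simp: fin_simple_def)
  have [measurable]: "s \<in> borel_measurable \<mu>" "s' \<in> borel_measurable \<mu>"
    using assms by (auto simp: fin_simple_def intro: borel_measurable_simple_function)
  have "{x \<in> space \<mu>. s x - s' x \<noteq> 0} \<in> fin_sets \<mu>"
  proof (rule fin_sets_subset[OF _ _ fin_sets_Un[OF fin_simple_support[OF assms(1)] fin_simple_support[OF assms(2)]]])
    show "{x \<in> space \<mu>. s x - s' x \<noteq> 0} \<in> sets \<mu>" by measurable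
  qed auto
  with * show ?thesis by (simp add: fin_simple_def fin_sets_def)
qed

text \<open>The approximants of the Bochner theory satisfy \<open>\<bar>s\<^sub>i\<bar> \<le> 2 \<bar>f\<bar>\<close>, so dominated convergence applies with
  the majorant \<open>9 f\<^sup>2\<close>.  A simple function takes finitely many values, so off its zero set its square is bounded below
  by some \<open>d > 0\<close>, and Markov's inequality makes its support of finite measure.\<close>

lemma fin_simple_approx_L2:
  fixes f :: "'b \<Rightarrow> real"
  assumes [measurable]: "f \<in> borel_measurable \<mu>" and fin: "(\<integral>\<^sup>+x. ennreal ((f x)\<^sup>2) \<partial>\<mu>) < \<infinity>"
  obtains s where "\<And>n::nat. fin_simple \<mu> (s n)"
    "(\<lambda>n. \<integral>\<^sup>+x. ennreal ((s n x - f x)\<^sup>2) \<partial>\<mu>) \<longlonglongrightarrow> 0"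
proof -
  from borel_measurable_implies_sequence_metric[OF assms(1), of 0] obtain s where
    s: "\<And>i. simple_function \<mu> (s i)" and
    lim: "\<And>x. x \<in> space \<mu> \<Longrightarrow> (\<lambda>i. s i x) \<longlonglongrightarrow> f x" and
    bound: "\<And>i x. x \<in> space \<mu> \<Longrightarrow> \<bar>s i x\<bar> \<le> 2 * \<bar>f x\<bar>"
    by (simp add: dist_real_def) metis
  have [measurable]: "s i \<in> borel_measurable \<mu>" for i
    by (rule borel_measurable_simple_function[OF s])
  have "emeasure \<mu> {x \<in> space \<mu>. s i x \<noteq> 0} < \<infinity>" for i
  proof -
    \<comment> \<open>The element \<open>1\<close> only keeps the minimum defined when \<open>s i\<close> vanishes identically.\<close>
    let ?V = "insert 1 ((\<lambda>v. v\<^sup>2) ` (s i ` space \<mu> - {0}))"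
    define d where "d = Min ?V"
    have "finite ?V" using s by (auto simp: simple_function_def)
    then have "0 < d" "\<And>x. x \<in> space \<mu> \<Longrightarrow> s i x \<noteq> 0 \<Longrightarrow> d \<le> (s i x)\<^sup>2"
      by (auto simp: d_def Min_gr_iff intro!: Min_le)
    then have d: "0 < d" "\<And>x. x \<in> space \<mu> \<Longrightarrow> s i x \<noteq> 0 \<Longrightarrow> d \<le> 4 * (f x)\<^sup>2"
    proof -
      fix x assume x: "x \<in> space \<mu>" "s i x \<noteq> 0"
      have "(s i x)\<^sup>2 \<le> (2 * \<bar>f x\<bar>)\<^sup>2"
        using bound[OF x(1)] by (subst abs_le_square_iff[symmetric]) simp
      then show "d \<le> 4 * (f x)\<^sup>2"
        using \<open>\<And>x. x \<in> space \<mu> \<Longrightarrow> s i x \<noteq> 0 \<Longrightarrow> d \<le> (s i x)\<^sup>2\<close>[OF x]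
        by (simp add: power_mult_distrib)
    qed auto
    have "ennreal d * emeasure \<mu> {x \<in> space \<mu>. s i x \<noteq> 0}
        = (\<integral>\<^sup>+x. ennreal d * indicator {x \<in> space \<mu>. s i x \<noteq> 0} x \<partial>\<mu>)"
      by (rule nn_integral_cmult_indicator[symmetric]) measurable
    also have "\<dots> \<le> (\<integral>\<^sup>+x. 4 * ennreal ((f x)\<^sup>2) \<partial>\<mu>)"
    proof (rule nn_integral_mono)
      fix x assume "x \<in> space \<mu>"
      then show "ennreal d * indicator {x \<in> space \<mu>. s i x \<noteq> 0} x \<le> 4 * ennreal ((f x)\<^sup>2)"
        using ennreal_leI[OF d(2)[of x]] by (auto simp: ennreal_mult indicator_def)
    qed
    also have "\<dots> < \<infinity>"
      using fin by (simp add: nn_integral_cmult ennreal_mult_less_top)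
    finally show ?thesis
      using d(1) by (auto simp: ennreal_mult_less_top)
  qed
  then have "fin_simple \<mu> (s n)" for n using s by (simp add: fin_simple_def)
  moreover have "(\<lambda>n. \<integral>\<^sup>+x. ennreal ((s n x - f x)\<^sup>2) \<partial>\<mu>) \<longlonglongrightarrow> (\<integral>\<^sup>+x. 0 \<partial>\<mu>)"
  proof (rule nn_integral_dominated_convergence)
    show "(\<integral>\<^sup>+x. 9 * ennreal ((f x)\<^sup>2) \<partial>\<mu>) < \<infinity>"
      using fin by (simp add: nn_integral_cmult ennreal_mult_less_top)
    have "(s j x - f x)\<^sup>2 \<le> 9 * (f x)\<^sup>2" if "x \<in> space \<mu>" for j x
    proof -
      have "\<bar>s j x - f x\<bar> \<le> \<bar>3 * f x\<bar>" using bound[OF that, of j] by (auto simp: abs_mult)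
      then have "(s j x - f x)\<^sup>2 \<le> (3 * f x)\<^sup>2" by (simp only: abs_le_square_iff)
      then show ?thesis by (simp add: power_mult_distrib)
    qed
    then have "ennreal ((s j x - f x)\<^sup>2) \<le> ennreal (9 * (f x)\<^sup>2)" if "x \<in> space \<mu>" for j x
      using that by (intro ennreal_leI)
    then show "AE x in \<mu>. ennreal ((s j x - f x)\<^sup>2) \<le> 9 * ennreal ((f x)\<^sup>2)" for j
      by (auto intro!: AE_I2 simp: ennreal_mult)
    show "AE x in \<mu>. (\<lambda>n. ennreal ((s n x - f x)\<^sup>2)) \<longlonglongrightarrow> 0"
    proof (rule AE_I2)
      fix x assume "x \<in> space \<mu>"
      then have "(\<lambda>n. (s n x - f x)\<^sup>2) \<longlonglongrightarrow> (f x - f x)\<^sup>2"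
        by (intro tendsto_intros lim)
      from tendsto_ennrealI[OF this] show "(\<lambda>n. ennreal ((s n x - f x)\<^sup>2)) \<longlonglongrightarrow> 0" by simp
    qed
  qed auto
  ultimately show ?thesis by (intro that[of s]) simp_all
qed

section \<open>The integral against Gaussian noise\<close>

lemma has_noise_integral_cong:
  assumes "\<And>x. x \<in> space \<mu> \<Longrightarrow> f x = g x"
  shows "has_noise_integral M \<mu> H f X \<longleftrightarrow> has_noise_integral M \<mu> H g X"
proof -
  have "f \<in> borel_measurable \<mu> \<longleftrightarrow> g \<in> borel_measurable \<mu>"
    using assms by (rule measurable_cong)
  moreover have "(\<integral>\<^sup>+x. ennreal ((s x - f x)\<^sup>2) \<partial>\<mu>) = (\<integral>\<^sup>+x. ennreal ((s x - g x)\<^sup>2) \<partial>\<mu>)" for s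
    using assms by (intro nn_integral_cong) simp
  ultimately show ?thesis unfolding has_noise_integral_def by simp
qed

locale noise = prob_space M for M :: "'w measure" +
  fixes \<mu> :: "'b measure" and H :: "'b set \<Rightarrow> 'w \<Rightarrow> real"
  assumes noise: "gaussian_noise M \<mu> H"
begin

lemma noise_measurable: "A \<in> fin_sets \<mu> \<Longrightarrow> H A \<in> borel_measurable M"
  and noise_distr: "A \<in> fin_sets \<mu> \<Longrightarrow> distr M borel (H A) = centered_normal (measure \<mu> A)"
  using noise by (auto simp: gaussian_noise_def)

lemma noise_indep:
  "(\<And>i. A i \<in> fin_sets \<mu>) \<Longrightarrow> disjoint_family A \<Longrightarrow> indep_vars (\<lambda>_. borel) (\<lambda>i::nat. H (A i)) UNIV"
  using noise unfolding gaussian_noise_def by blast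

lemma noise_empty: "AE w in M. H {} w = 0"
proof -
  have e: "{} \<in> fin_sets \<mu>" by (simp add: fin_sets_def)
  have *: "distr M borel (H {}) = return borel 0"
    by (simp add: noise_distr[OF e] centered_normal_def)
  have "AE x in distr M borel (H {}). x = 0"
    unfolding * by (subst AE_return) auto
  then show ?thesis
    using noise_measurable[OF e] by (subst (asm) AE_distr_iff) auto
qed

lemma noise_Un:
  assumes "A \<in> fin_sets \<mu>" "B \<in> fin_sets \<mu>" "A \<inter> B = {}"
  shows "AE w in M. H (A \<union> B) w = H A w + H B w"
proof -
  have "disjoint_family (binaryset A B)"
    using assms(3) by (auto simp: disjoint_family_on_def binaryset_def)
  moreover have "range (binaryset A B) \<subseteq> sets \<mu>"
    using assms by (auto simp: range_binaryset_eq fin_sets_def)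
  moreover have "emeasure \<mu> (\<Union>i. binaryset A B i) < \<infinity>"
    using fin_sets_Un[OF assms(1,2)] by (simp add: UN_binaryset_eq fin_sets_def)
  ultimately have "AE w in M. (\<lambda>i. H (binaryset A B i) w) sums H (\<Union>i. binaryset A B i) w"
    using noise unfolding gaussian_noise_def by blast
  with noise_empty show ?thesis
  proof eventually_elim
    fix w assume "H {} w = 0" "(\<lambda>i. H (binaryset A B i) w) sums H (\<Union>i. binaryset A B i) w"
    with binaryset_sums[of "\<lambda>A. H A w" A B] show "H (A \<union> B) w = H A w + H B w"
      by (simp add: UN_binaryset_eq sums_unique2)
  qed
qed

lemma noise_UN:
  assumes "finite J" "disjoint_family_on B J" "\<And>j. j \<in> J \<Longrightarrow> B j \<in> fin_sets \<mu>"
  shows "AE w in M. H (\<Union>j\<in>J. B j) w = (\<Sum>j\<in>J. H (B j) w)"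
  using assms
proof (induction J rule: finite_induct)
  case empty
  then show ?case using noise_empty by simp
next
  case (insert j J)
  have "disjoint_family_on B J"
    using insert.prems(1) by (auto simp: disjoint_family_on_def)
  then have "AE w in M. H (\<Union>j\<in>J. B j) w = (\<Sum>j\<in>J. H (B j) w)"
    using insert by simp
  moreover have "AE w in M. H (B j \<union> (\<Union>j\<in>J. B j)) w = H (B j) w + H (\<Union>j\<in>J. B j) w"
    using insert by (intro noise_Un fin_sets_UN) (auto simp: disjoint_family_on_def)
  ultimately show ?case
    by eventually_elim (simp add: insert.hyps)
qed

text \<open>Independent scattering is given for sequences of disjoint sets; a finite family is enumerated and
  continued by empty sets, and independence is then carried back along the enumeration.\<close>

lemma noise_indep_finite:
  assumes J: "finite J" "disjoint_family_on B J" "\<And>j. j \<in> J \<Longrightarrow> B j \<in> fin_sets \<mu>"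
  shows "indep_vars (\<lambda>_. borel) (\<lambda>j. H (B j)) J"
proof -
  obtain f where f: "bij_betw f J {..<card J}"
    using ex_bij_betw_finite_nat[OF J(1)] by (auto simp: atLeast0LessThan)
  define g where "g = the_inv_into J f"
  define A where "A i = (if i < card J then B (g i) else {})" for i
  have g: "g i \<in> J" "f (g i) = i" if "i < card J" for i
    using f that unfolding g_def bij_betw_def
    by (auto intro!: the_inv_into_into f_the_inv_into_f)
  have gf: "g (f j) = j" if "j \<in> J" for j
    using f that unfolding g_def bij_betw_def by (auto intro: the_inv_into_f_f)
  have fJ: "f j < card J" if "j \<in> J" for j
    using f that by (auto simp: bij_betw_def)
  have "indep_vars (\<lambda>_. borel) (\<lambda>i. H (A i)) UNIV"
  proof (rule noise_indep)
    show "A i \<in> fin_sets \<mu>" for i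
      using J(3) g by (auto simp: A_def fin_sets_def)
    show "disjoint_family A"
      unfolding disjoint_family_on_def
    proof safe
      fix m n x assume mn: "m \<noteq> n" "x \<in> A m" "x \<in> A n"
      then have "m < card J" "n < card J" by (auto simp: A_def split: if_splits)
      moreover from this mn have "g m \<noteq> g n" using g(2) by metis
      ultimately have "B (g m) \<inter> B (g n) = {}"
        using J(2) g(1) by (auto simp: disjoint_family_on_def)
      with mn show "x \<in> {}" by (auto simp: A_def split: if_splits)
    qed
  qed
  then have ind: "indep_sets (\<lambda>i. {H (A i) -` S \<inter> space M |S. S \<in> sets borel}) UNIV"
    and rv: "\<And>i. random_variable borel (H (A i))"
    by (auto simp: indep_vars_def2)
  have Af: "A (f j) = B j" if "j \<in> J" for j
    using that by (simp add: A_def fJ gf)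
  show ?thesis
    unfolding indep_vars_def2
  proof (intro conjI ballI)
    show "random_variable borel (H (B j))" if "j \<in> J" for j
      using noise_measurable J(3) that by auto
    show "indep_sets (\<lambda>i. {H (B i) -` S \<inter> space M |S. S \<in> sets borel}) J"
    proof (rule indep_setsI)
      show "{H (B i) -` S \<inter> space M |S. S \<in> sets borel} \<subseteq> events" if "i \<in> J" for i
        using noise_measurable[OF J(3)[OF that]] by (auto intro: measurable_sets)
    next
      fix S K assume K: "K \<noteq> {}" "K \<subseteq> J" "finite K"
        "\<forall>j\<in>K. S j \<in> {H (B j) -` T \<inter> space M |T. T \<in> sets borel}"
      have inj: "inj_on f K" using f K(2) by (auto simp: bij_betw_def intro: inj_on_subset)
      have "prob (\<Inter>i\<in>f ` K. S (g i)) = (\<Prod>i\<in>f ` K. prob (S (g i)))"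
      proof (rule indep_setsD[OF ind])
        show "\<forall>i\<in>f ` K. S (g i) \<in> {H (A i) -` S \<inter> space M |S. S \<in> sets borel}"
          using K by (auto simp: gf Af subset_iff)
      qed (use K in auto)
      moreover have "(\<Inter>i\<in>f ` K. S (g i)) = (\<Inter>j\<in>K. S j)"
        using K by (auto simp: gf subset_iff)
      moreover have "(\<Prod>i\<in>f ` K. prob (S (g i))) = (\<Prod>j\<in>K. prob (S j))"
        using K by (subst prod.reindex[OF inj]) (auto simp: gf subset_iff intro!: prod.cong)
      ultimately show "prob (\<Inter>j\<in>K. S j) = (\<Prod>j\<in>K. prob (S j))" by simp
    qed
  qed
qed

lemma simple_noise_integral_nonzero:
  assumes "fin_simple \<mu> s"
  shows "simple_noise_integral \<mu> H s w = (\<Sum>v\<in>s ` space \<mu> - {0}. v * H {x \<in> space \<mu>. s x = v} w)"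
  unfolding simple_noise_integral_def
  using assms by (intro sum.mono_neutral_right) (auto simp: fin_simple_def simple_function_def)

lemma simple_noise_integral_measurable:
  assumes "fin_simple \<mu> s"
  shows "simple_noise_integral \<mu> H s \<in> borel_measurable M"
  unfolding simple_noise_integral_nonzero[OF assms, abs_def]
  using noise_measurable fin_simple_level_set[OF assms] by auto

lemma distr_simple_noise_integral:
  assumes "fin_simple \<mu> s"
  shows "distr M borel (simple_noise_integral \<mu> H s)
    = centered_normal (\<Sum>v\<in>s ` space \<mu> - {0}. v\<^sup>2 * measure \<mu> {x \<in> space \<mu>. s x = v})"
  unfolding simple_noise_integral_nonzero[OF assms, abs_def]
proof (rule distr_sum_indep_centered_normal)
  show "finite (s ` space \<mu> - {0})"
    using assms by (auto simp: fin_simple_def simple_function_def)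
  then show "indep_vars (\<lambda>_. borel) (\<lambda>v. H {x \<in> space \<mu>. s x = v}) (s ` space \<mu> - {0})"
    using fin_simple_level_set[OF assms]
    by (intro noise_indep_finite) (auto simp: disjoint_family_on_def)
qed (use fin_simple_level_set[OF assms] in \<open>auto intro!: noise_distr\<close>)

lemma simple_noise_integral_even_moment:
  assumes "fin_simple \<mu> s"
  shows "(\<integral>\<^sup>+w. ennreal (simple_noise_integral \<mu> H s w ^ (2 * p)) \<partial>M)
    = ennreal (normal_moment p) * (\<integral>\<^sup>+x. ennreal ((s x)\<^sup>2) \<partial>\<mu>) ^ p"
proof -
  let ?v = "\<Sum>v\<in>s ` space \<mu> - {0}. v\<^sup>2 * measure \<mu> {x \<in> space \<mu>. s x = v}"
  have v: "0 \<le> ?v" by (simp add: sum_nonneg)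
  have "(\<integral>\<^sup>+w. ennreal (simple_noise_integral \<mu> H s w ^ (2 * p)) \<partial>M)
      = (\<integral>\<^sup>+x. ennreal (x ^ (2 * p)) \<partial>centered_normal ?v)"
    unfolding distr_simple_noise_integral[OF assms, symmetric]
    using simple_noise_integral_measurable[OF assms] by (subst nn_integral_distr) auto
  also have "\<dots> = ennreal (normal_moment p) * ennreal ?v ^ p"
    using v by (simp add: nn_integral_power_centered_normal ennreal_mult normal_moment_nonneg ennreal_power)
  finally show ?thesis
    by (simp add: nn_integral_square_fin_simple[OF assms])
qed

text \<open>The simple integral sums over level sets, but additivity of the noise allows any finite
  disjoint family on which \<open>s\<close> is constant.  This freedom is what makes the integral linear: two simple functions share
  a common refinement.\<close>

lemma simple_noise_integral_eq_sum:
  assumes s: "fin_simple \<mu> s"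
    and J: "finite J" "disjoint_family_on B J" "\<And>j. j \<in> J \<Longrightarrow> B j \<in> fin_sets \<mu>"
    and sc: "\<And>j x. j \<in> J \<Longrightarrow> x \<in> B j \<Longrightarrow> s x = c j"
    and s0: "\<And>x. x \<in> space \<mu> \<Longrightarrow> x \<notin> (\<Union>j\<in>J. B j) \<Longrightarrow> s x = 0"
  shows "AE w in M. simple_noise_integral \<mu> H s w = (\<Sum>j\<in>J. c j * H (B j) w)"
proof -
  let ?L = "\<lambda>v. {x \<in> space \<mu>. s x = v}"
  have Bsp: "B j \<subseteq> space \<mu>" if "j \<in> J" for j
    using J(3)[OF that] sets.sets_into_space by (auto simp: fin_sets_def)
  have L: "?L v = (\<Union>j\<in>{j \<in> J. c j = v}. B j)" if "v \<noteq> 0" for v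
    using that s0 sc Bsp by fastforce
  have "AE w in M. \<forall>v\<in>c ` J. H (\<Union>j\<in>{j \<in> J. c j = v}. B j) w = (\<Sum>j\<in>{j \<in> J. c j = v}. H (B j) w)"
  proof (intro AE_finite_allI)
    show "AE w in M. H (\<Union>j\<in>{j \<in> J. c j = v}. B j) w = (\<Sum>j\<in>{j \<in> J. c j = v}. H (B j) w)" for v
      using J by (intro noise_UN) (auto simp: disjoint_family_on_def)
  qed (use J in auto)
  with noise_empty show ?thesis
  proof eventually_elim
    fix w assume 0: "H {} w = 0"
      and w: "\<forall>v\<in>c ` J. H (\<Union>j\<in>{j \<in> J. c j = v}. B j) w = (\<Sum>j\<in>{j \<in> J. c j = v}. H (B j) w)"
    have "(\<Sum>j\<in>J. c j * H (B j) w) = (\<Sum>v\<in>c ` J. \<Sum>j\<in>{j \<in> J. c j = v}. c j * H (B j) w)"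
      by (rule sum.image_gen[OF J(1)])
    also have "\<dots> = (\<Sum>v\<in>c ` J. v * H (?L v) w)"
    proof (intro sum.cong refl)
      fix v assume v: "v \<in> c ` J"
      have "(\<Sum>j\<in>{j \<in> J. c j = v}. c j * H (B j) w) = v * (\<Sum>j\<in>{j \<in> J. c j = v}. H (B j) w)"
        by (subst sum_distrib_left) (auto intro!: sum.cong)
      then show "(\<Sum>j\<in>{j \<in> J. c j = v}. c j * H (B j) w) = v * H (?L v) w"
        using L[of v] w v by (cases "v = 0") auto
    qed
    also have "\<dots> = (\<Sum>v\<in>s ` space \<mu> - {0}. v * H (?L v) w)"
    proof (rule sum.mono_neutral_right)
      show "s ` space \<mu> - {0} \<subseteq> c ` J"
        using s0 sc by fastforce
      show "\<forall>v\<in>c ` J - (s ` space \<mu> - {0}). v * H (?L v) w = 0"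
      proof
        fix v assume v: "v \<in> c ` J - (s ` space \<mu> - {0})"
        then have "v = 0 \<or> ?L v = {}" by blast
        then show "v * H (?L v) w = 0" using 0 by (auto simp del: Collect_empty_eq)
      qed
    qed (use J in auto)
    finally show "simple_noise_integral \<mu> H s w = (\<Sum>j\<in>J. c j * H (B j) w)"
      by (simp add: simple_noise_integral_nonzero[OF s])
  qed
qed

text \<open>The common refinement consists of the level sets of the pair \<open>(s, s')\<close>; the pair \<open>(0, 0)\<close> is left out
  because its level set may have infinite measure.\<close>

lemma simple_noise_integral_diff:
  assumes s: "fin_simple \<mu> s" and s': "fin_simple \<mu> s'"
  shows "AE w in M. simple_noise_integral \<mu> H s w - simple_noise_integral \<mu> H s' w
    = simple_noise_integral \<mu> H (\<lambda>x. s x - s' x) w"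
proof -
  define J where "J = (\<lambda>x. (s x, s' x)) ` space \<mu> - {(0, 0)}"
  define B where "B p = {x \<in> space \<mu>. s x = fst p \<and> s' x = snd p}" for p
  have [measurable]: "s \<in> borel_measurable \<mu>" "s' \<in> borel_measurable \<mu>"
    using s s' by (auto simp: fin_simple_def intro: borel_measurable_simple_function)
  have "J \<subseteq> s ` space \<mu> \<times> s' ` space \<mu>" by (auto simp: J_def)
  then have J: "finite J"
    using s s' by (auto simp: fin_simple_def simple_function_def intro: finite_subset)
  have disj: "disjoint_family_on B J"
    by (auto simp: disjoint_family_on_def B_def)
  have B: "B p \<in> fin_sets \<mu>" if "p \<in> J" for p
  proof (rule fin_sets_subset[OF _ _ fin_sets_Un[OF fin_simple_support[OF s] fin_simple_support[OF s']]])
    show "B p \<in> sets \<mu>" unfolding B_def by measurable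
    show "B p \<subseteq> {x \<in> space \<mu>. s x \<noteq> 0} \<union> {x \<in> space \<mu>. s' x \<noteq> 0}"
      using that by (auto simp: B_def J_def)
  qed
  have cover: "s x = 0 \<and> s' x = 0" if "x \<in> space \<mu>" "x \<notin> (\<Union>p\<in>J. B p)" for x
  proof (rule ccontr)
    assume "\<not> (s x = 0 \<and> s' x = 0)"
    then have "(s x, s' x) \<in> J" "x \<in> B (s x, s' x)"
      using that(1) by (auto simp: J_def B_def)
    with that(2) show False by blast
  qed
  have 1: "AE w in M. simple_noise_integral \<mu> H s w = (\<Sum>p\<in>J. fst p * H (B p) w)"
    using cover by (intro simple_noise_integral_eq_sum s J disj B) (auto simp: B_def)
  have 2: "AE w in M. simple_noise_integral \<mu> H s' w = (\<Sum>p\<in>J. snd p * H (B p) w)"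
    using cover by (intro simple_noise_integral_eq_sum s' J disj B) (auto simp: B_def)
  have 3: "AE w in M. simple_noise_integral \<mu> H (\<lambda>x. s x - s' x) w
      = (\<Sum>p\<in>J. (fst p - snd p) * H (B p) w)"
  proof (rule simple_noise_integral_eq_sum[OF fin_simple_diff[OF s s'] J disj B])
    show "s x - s' x = 0" if "x \<in> space \<mu>" "x \<notin> (\<Union>p\<in>J. B p)" for x
      using cover[OF that] by simp
  qed (auto simp: B_def)
  from 1 2 3 show ?thesis
    by eventually_elim (simp add: sum_subtractf left_diff_distrib)
qed

lemma simple_noise_integral_isometry:
  assumes "fin_simple \<mu> s" "fin_simple \<mu> s'"
  shows "(\<integral>\<^sup>+w. ennreal ((simple_noise_integral \<mu> H s w - simple_noise_integral \<mu> H s' w)\<^sup>2) \<partial>M)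
    = (\<integral>\<^sup>+x. ennreal ((s x - s' x)\<^sup>2) \<partial>\<mu>)"
proof -
  have "(\<integral>\<^sup>+w. ennreal ((simple_noise_integral \<mu> H s w - simple_noise_integral \<mu> H s' w)\<^sup>2) \<partial>M)
      = (\<integral>\<^sup>+w. ennreal (simple_noise_integral \<mu> H (\<lambda>x. s x - s' x) w ^ (2 * 1)) \<partial>M)"
    using simple_noise_integral_diff[OF assms] by (intro nn_integral_cong_AE) (auto elim!: eventually_mono)
  then show ?thesis
    unfolding simple_noise_integral_even_moment[OF fin_simple_diff[OF assms]]
    by (simp add: normal_moment_1[unfolded One_nat_def])
qed

text \<open>Approximants at squared distance \<open>4\<^sup>-\<^sup>n\<close> have, by isometry, integrals that are equally close in \<open>L\<^sup>2\<close>;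
  their increments are then almost surely summable, and the almost sure limit is the limit in \<open>L\<^sup>2\<close> by Fatou's lemma.\<close>

lemma has_noise_integral_exists:
  assumes f: "f \<in> borel_measurable \<mu>" and fin: "(\<integral>\<^sup>+x. ennreal ((f x)\<^sup>2) \<partial>\<mu>) < \<infinity>"
  shows "\<exists>X. has_noise_integral M \<mu> H f X"
proof -
  obtain s0 where s0: "\<And>n::nat. fin_simple \<mu> (s0 n)"
      "(\<lambda>n. \<integral>\<^sup>+x. ennreal ((s0 n x - f x)\<^sup>2) \<partial>\<mu>) \<longlonglongrightarrow> 0"
    using fin_simple_approx_L2[OF f fin] by blast
  obtain r where r: "\<And>n. (\<integral>\<^sup>+x. ennreal ((s0 (r n) x - f x)\<^sup>2) \<partial>\<mu>) \<le> ennreal ((1/4) ^ n)"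
    using tendsto_zero_ennreal_subseq[OF s0(2), of "\<lambda>n. (1/4) ^ n"] by auto
  define s where "s n = s0 (r n)" for n
  have s: "fin_simple \<mu> (s n)" and sf: "(\<integral>\<^sup>+x. ennreal ((s n x - f x)\<^sup>2) \<partial>\<mu>) \<le> ennreal ((1/4) ^ n)" for n
    using s0(1) r by (auto simp: s_def)
  have [measurable]: "s n \<in> borel_measurable \<mu>" "f \<in> borel_measurable \<mu>" for n
    using s[of n] f by (auto simp: fin_simple_def intro: borel_measurable_simple_function)
  define I where "I n = simple_noise_integral \<mu> H (s n)" for n
  have I[measurable]: "I n \<in> borel_measurable M" for n
    unfolding I_def by (rule simple_noise_integral_measurable[OF s])
  have dist: "(\<integral>\<^sup>+w. ennreal ((I m w - I n w)\<^sup>2) \<partial>M) \<le> ennreal (4 * (1/4) ^ n)" if "n \<le> m" for n m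
  proof -
    have "(\<integral>\<^sup>+w. ennreal ((I m w - I n w)\<^sup>2) \<partial>M) = (\<integral>\<^sup>+x. ennreal ((s m x - s n x)\<^sup>2) \<partial>\<mu>)"
      unfolding I_def by (rule simple_noise_integral_isometry[OF s s])
    also have "\<dots> = (\<integral>\<^sup>+x. ennreal (((s m x - f x) + - (s n x - f x))\<^sup>2) \<partial>\<mu>)" by simp
    also have "\<dots> \<le> 2 * (\<integral>\<^sup>+x. ennreal ((s m x - f x)\<^sup>2) \<partial>\<mu>) + 2 * (\<integral>\<^sup>+x. ennreal ((- (s n x - f x))\<^sup>2) \<partial>\<mu>)"
      by (rule nn_integral_square_add_le) measurable
    also have "\<dots> \<le> 2 * ennreal ((1/4) ^ m) + 2 * ennreal ((1/4) ^ n)"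
      unfolding power2_minus by (intro add_mono mult_left_mono sf) auto
    also have "\<dots> = ennreal (2 * (1/4) ^ m + 2 * (1/4) ^ n)"
      by (simp add: ennreal_mult)
    also have "\<dots> \<le> ennreal (4 * (1/4) ^ n)"
      using power_decreasing[OF that, of "1/4::real"] by (intro ennreal_leI) simp
    finally show ?thesis .
  qed
  \<comment> \<open>The weight \<open>2\<^sup>n\<close> still leaves a summable bound \<open>4 \<cdot> 2\<^sup>-\<^sup>n\<close>, and it turns
    square summability into summability through \<open>\<bar>d\<bar> \<le> 2\<^sup>-\<^sup>n + 2\<^sup>n d\<^sup>2\<close>.\<close>
  have "AE w in M. summable (\<lambda>n. 2 ^ n * (I (Suc n) w - I n w)\<^sup>2)"
  proof (rule AE_summable_of_nn_integral_bound)
    show "(\<integral>\<^sup>+w. ennreal (2 ^ n * (I (Suc n) w - I n w)\<^sup>2) \<partial>M) \<le> ennreal (4 * (1/2) ^ n)" for n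
    proof -
      have "(\<integral>\<^sup>+w. ennreal (2 ^ n * (I (Suc n) w - I n w)\<^sup>2) \<partial>M)
          = ennreal (2 ^ n) * (\<integral>\<^sup>+w. ennreal ((I (Suc n) w - I n w)\<^sup>2) \<partial>M)"
        by (simp add: ennreal_mult nn_integral_cmult)
      also have "\<dots> \<le> ennreal (2 ^ n) * ennreal (4 * (1/4) ^ n)"
        by (intro mult_left_mono dist) auto
      also have "\<dots> = ennreal (2 ^ n * (4 * (1/4) ^ n))"
        by (rule ennreal_mult[symmetric]) auto
      also have "2 ^ n * (4 * (1/4) ^ n) = 4 * (1/2::real) ^ n"
        by (simp add: power_mult_distrib[symmetric] mult.left_commute[of "2 ^ n"])
      finally show ?thesis .
    qed
    show "summable (\<lambda>n. 4 * (1/2::real) ^ n)" by (intro summable_mult summable_geometric) simp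
  qed auto
  then have conv: "AE w in M. convergent (\<lambda>n. I n w)"
  proof eventually_elim
    fix w assume sm: "summable (\<lambda>n. 2 ^ n * (I (Suc n) w - I n w)\<^sup>2)"
    have "summable (\<lambda>n. I (Suc n) w - I n w)"
    proof (rule summable_comparison_test')
      show "summable (\<lambda>n. (1/2) ^ n + 2 ^ n * (I (Suc n) w - I n w)\<^sup>2)"
        using sm by (intro summable_add summable_geometric) auto
      show "norm (I (Suc n) w - I n w) \<le> (1/2) ^ n + 2 ^ n * (I (Suc n) w - I n w)\<^sup>2" if "n \<ge> 0" for n
      proof -
        let ?d = "\<bar>I (Suc n) w - I n w\<bar>"
        \<comment> \<open>Expanding this square is the inequality between arithmetic and geometric mean.\<close>
        have "0 \<le> (1 - 2 ^ n * ?d)\<^sup>2" by simp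
        then have "2 * (2 ^ n * ?d) \<le> 1 + (2 ^ n)\<^sup>2 * ?d\<^sup>2"
          by (simp add: power2_diff power_mult_distrib)
        then have "2 ^ n * ?d \<le> 1 + (2 ^ n)\<^sup>2 * ?d\<^sup>2"
          using mult_nonneg_nonneg[OF zero_le_power[of "2::real" n] abs_ge_zero[of "I (Suc n) w - I n w"]]
          by linarith
        also have "\<dots> = 2 ^ n * ((1/2) ^ n + 2 ^ n * ?d\<^sup>2)"
          by (simp add: field_simps power2_eq_square)
        finally show ?thesis by simp
      qed
    qed
    then have "convergent (\<lambda>n. \<Sum>i<n. I (Suc i) w - I i w)"
      by (simp add: summable_iff_convergent)
    then have "convergent (\<lambda>n. I n w - I 0 w)"
      unfolding sum_lessThan_telescope[of "\<lambda>i. I i w"] .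
    from convergent_add[OF this convergent_const[of "I 0 w"]] show "convergent (\<lambda>n. I n w)" by simp
  qed
  define X where "X w = lim (\<lambda>n. I n w)" for w
  have [measurable]: "X \<in> borel_measurable M"
    unfolding X_def by (rule borel_measurable_lim_metric) measurable
  have X: "(\<integral>\<^sup>+w. ennreal ((I n w - X w)\<^sup>2) \<partial>M) \<le> ennreal (4 * (1/4) ^ n)" for n
  proof (rule nn_integral_le_of_AE_tendsto)
    show "AE w in M. (\<lambda>m. ennreal ((I (m + n) w - I n w)\<^sup>2)) \<longlonglongrightarrow> ennreal ((I n w - X w)\<^sup>2)"
      using conv
    proof eventually_elim
      fix w assume "convergent (\<lambda>n. I n w)"
      then have "(\<lambda>m. I m w) \<longlonglongrightarrow> X w" by (simp add: X_def convergent_LIMSEQ_iff)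
      then have "(\<lambda>m. I (m + n) w) \<longlonglongrightarrow> X w" by (rule LIMSEQ_ignore_initial_segment)
      then have "(\<lambda>m. ennreal ((I (m + n) w - I n w)\<^sup>2)) \<longlonglongrightarrow> ennreal ((X w - I n w)\<^sup>2)"
        by (intro tendsto_intros)
      then show "(\<lambda>m. ennreal ((I (m + n) w - I n w)\<^sup>2)) \<longlonglongrightarrow> ennreal ((I n w - X w)\<^sup>2)"
        by (simp add: power2_commute)
    qed
    show "(\<integral>\<^sup>+w. ennreal ((I (m + n) w - I n w)\<^sup>2) \<partial>M) \<le> ennreal (4 * (1/4) ^ n)" for m
      by (rule dist) simp
  qed simp
  have lim0: "a \<longlonglongrightarrow> 0" if "\<And>n. a n \<le> ennreal (c * (1/4) ^ n)" for a and c :: real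
  proof (rule tendsto_sandwich[OF _ _ tendsto_const])
    have "(\<lambda>n. c * (1/4) ^ n) \<longlonglongrightarrow> c * 0"
      by (intro tendsto_intros LIMSEQ_power_zero) simp
    from tendsto_ennrealI[OF this] show "(\<lambda>n. ennreal (c * (1/4) ^ n)) \<longlonglongrightarrow> 0" by simp
  qed (auto intro!: always_eventually that)
  have "has_noise_integral M \<mu> H f X"
    unfolding has_noise_integral_def
  proof (intro conjI exI[of _ s] allI)
    show "(\<lambda>n. \<integral>\<^sup>+x. ennreal ((s n x - f x)\<^sup>2) \<partial>\<mu>) \<longlonglongrightarrow> 0"
      using sf by (intro lim0[of _ 1]) simp
    show "(\<lambda>n. \<integral>\<^sup>+w. ennreal ((simple_noise_integral \<mu> H (s n) w - X w)\<^sup>2) \<partial>M) \<longlonglongrightarrow> 0"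
      using X unfolding I_def by (rule lim0)
  qed (use s in \<open>auto simp: fin_simple_def\<close>)
  then show ?thesis by blast
qed

lemma has_noise_integral_diff:
  assumes X: "has_noise_integral M \<mu> H f X" and Y: "has_noise_integral M \<mu> H g Y"
  shows "has_noise_integral M \<mu> H (\<lambda>x. f x - g x) (\<lambda>w. X w - Y w)"
proof -
  obtain s where s: "\<And>n::nat. fin_simple \<mu> (s n)"
      "(\<lambda>n. \<integral>\<^sup>+x. ennreal ((s n x - f x)\<^sup>2) \<partial>\<mu>) \<longlonglongrightarrow> 0"
      "(\<lambda>n. \<integral>\<^sup>+w. ennreal ((simple_noise_integral \<mu> H (s n) w - X w)\<^sup>2) \<partial>M) \<longlonglongrightarrow> 0"
    using X by (auto simp: has_noise_integral_def fin_simple_def)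
  obtain s' where s': "\<And>n::nat. fin_simple \<mu> (s' n)"
      "(\<lambda>n. \<integral>\<^sup>+x. ennreal ((s' n x - g x)\<^sup>2) \<partial>\<mu>) \<longlonglongrightarrow> 0"
      "(\<lambda>n. \<integral>\<^sup>+w. ennreal ((simple_noise_integral \<mu> H (s' n) w - Y w)\<^sup>2) \<partial>M) \<longlonglongrightarrow> 0"
    using Y by (auto simp: has_noise_integral_def fin_simple_def)
  have [measurable]: "f \<in> borel_measurable \<mu>" "g \<in> borel_measurable \<mu>"
      "X \<in> borel_measurable M" "Y \<in> borel_measurable M"
    using X Y by (auto simp: has_noise_integral_def)
  have [measurable]: "s n \<in> borel_measurable \<mu>" "s' n \<in> borel_measurable \<mu>" for n
    using s(1)[of n] s'(1)[of n] by (auto simp: fin_simple_def intro: borel_measurable_simple_function)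
  note [measurable] = simple_noise_integral_measurable[OF s(1)] simple_noise_integral_measurable[OF s'(1)]
  have "(\<lambda>n. \<integral>\<^sup>+x. ennreal ((s n x - s' n x - (f x - g x))\<^sup>2) \<partial>\<mu>) \<longlonglongrightarrow> 0"
  proof (rule tendsto_zero_ennreal_sandwich[OF s(2) s'(2)])
    show "(\<integral>\<^sup>+x. ennreal ((s n x - s' n x - (f x - g x))\<^sup>2) \<partial>\<mu>)
        \<le> 2 * (\<integral>\<^sup>+x. ennreal ((s n x - f x)\<^sup>2) \<partial>\<mu>) + 2 * (\<integral>\<^sup>+x. ennreal ((s' n x - g x)\<^sup>2) \<partial>\<mu>)" for n
      using nn_integral_square_add_le[of "\<lambda>x. s n x - f x" \<mu> "\<lambda>x. - (s' n x - g x)"]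
      by (simp add: algebra_simps power2_commute)
  qed
  moreover have "(\<lambda>n. \<integral>\<^sup>+w. ennreal ((simple_noise_integral \<mu> H (\<lambda>x. s n x - s' n x) w - (X w - Y w))\<^sup>2) \<partial>M) \<longlonglongrightarrow> 0"
  proof (rule tendsto_zero_ennreal_sandwich[OF s(3) s'(3)])
    fix n
    let ?I = "simple_noise_integral \<mu> H (s n)" and ?I' = "simple_noise_integral \<mu> H (s' n)"
    have "(\<integral>\<^sup>+w. ennreal ((simple_noise_integral \<mu> H (\<lambda>x. s n x - s' n x) w - (X w - Y w))\<^sup>2) \<partial>M)
        = (\<integral>\<^sup>+w. ennreal (((?I w - X w) + - (?I' w - Y w))\<^sup>2) \<partial>M)"
      using simple_noise_integral_diff[OF s(1)[of n] s'(1)[of n]]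
      by (intro nn_integral_cong_AE) (auto elim!: eventually_mono simp: algebra_simps)
    also have "\<dots> \<le> 2 * (\<integral>\<^sup>+w. ennreal ((?I w - X w)\<^sup>2) \<partial>M) + 2 * (\<integral>\<^sup>+w. ennreal ((- (?I' w - Y w))\<^sup>2) \<partial>M)"
      by (rule nn_integral_square_add_le) measurable
    finally show "(\<integral>\<^sup>+w. ennreal ((simple_noise_integral \<mu> H (\<lambda>x. s n x - s' n x) w - (X w - Y w))\<^sup>2) \<partial>M)
        \<le> 2 * (\<integral>\<^sup>+w. ennreal ((?I w - X w)\<^sup>2) \<partial>M) + 2 * (\<integral>\<^sup>+w. ennreal ((?I' w - Y w)\<^sup>2) \<partial>M)"
      unfolding power2_minus .
  qed
  ultimately show ?thesis
    using fin_simple_diff[OF s(1) s'(1)] unfolding has_noise_integral_def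
    by (intro conjI exI[of _ "\<lambda>n x. s n x - s' n x"] allI) (auto simp: fin_simple_def)
qed

text \<open>For simple functions the moment is that of a normal law, and Fatou's lemma transfers the bound.
  The approximants can be chosen at squared distance at most \<open>K\<close> from \<open>f\<close>, so their squared norm is at most
  \<open>2 K + 2 K = 4 K\<close>.  The constant is irrelevant for Kolmogorov's criterion, and since \<open>K\<close> may be any positive upper bound,
  the estimate also forces the integral of \<open>0\<close> to vanish.\<close>

lemma has_noise_integral_even_moment:
  assumes X: "has_noise_integral M \<mu> H f X"
    and K: "(\<integral>\<^sup>+x. ennreal ((f x)\<^sup>2) \<partial>\<mu>) \<le> ennreal K" "0 < K"
  shows "(\<integral>\<^sup>+w. ennreal (X w ^ (2 * p)) \<partial>M) \<le> ennreal (normal_moment p * (4 * K) ^ p)"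
proof -
  obtain s where s: "\<And>n::nat. fin_simple \<mu> (s n)"
      "(\<lambda>n. \<integral>\<^sup>+x. ennreal ((s n x - f x)\<^sup>2) \<partial>\<mu>) \<longlonglongrightarrow> 0"
      "(\<lambda>n. \<integral>\<^sup>+w. ennreal ((simple_noise_integral \<mu> H (s n) w - X w)\<^sup>2) \<partial>M) \<longlonglongrightarrow> 0"
    using X by (auto simp: has_noise_integral_def fin_simple_def)
  have [measurable]: "f \<in> borel_measurable \<mu>" "X \<in> borel_measurable M"
    using X by (auto simp: has_noise_integral_def)
  have [measurable]: "s n \<in> borel_measurable \<mu>" for n
    using s(1)[of n] by (auto simp: fin_simple_def intro: borel_measurable_simple_function)
  note [measurable] = simple_noise_integral_measurable[OF s(1)]
  have "(\<lambda>n. (\<integral>\<^sup>+x. ennreal ((s n x - f x)\<^sup>2) \<partial>\<mu>)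
      + (\<integral>\<^sup>+w. ennreal ((simple_noise_integral \<mu> H (s n) w - X w)\<^sup>2) \<partial>M)) \<longlonglongrightarrow> 0 + 0"
    by (intro tendsto_add s)
  then have "(\<lambda>n. (\<integral>\<^sup>+x. ennreal ((s n x - f x)\<^sup>2) \<partial>\<mu>)
      + (\<integral>\<^sup>+w. ennreal ((simple_noise_integral \<mu> H (s n) w - X w)\<^sup>2) \<partial>M)) \<longlonglongrightarrow> 0" by simp
  then obtain r where r: "\<And>n. (\<integral>\<^sup>+x. ennreal ((s (r n) x - f x)\<^sup>2) \<partial>\<mu>)
      + (\<integral>\<^sup>+w. ennreal ((simple_noise_integral \<mu> H (s (r n)) w - X w)\<^sup>2) \<partial>M) \<le> ennreal (K * (1/2) ^ n)"
    using tendsto_zero_ennreal_subseq[where b="\<lambda>n. K * (1/2) ^ n"] K(2) by force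
  have r1: "(\<integral>\<^sup>+x. ennreal ((s (r n) x - f x)\<^sup>2) \<partial>\<mu>) \<le> ennreal (K * (1/2) ^ n)"
    and r2: "(\<integral>\<^sup>+w. ennreal ((simple_noise_integral \<mu> H (s (r n)) w - X w)\<^sup>2) \<partial>M) \<le> ennreal (K * (1/2) ^ n)" for n
    using r[of n] by (auto intro: order_trans[rotated])
  have "AE w in M. summable (\<lambda>n. (simple_noise_integral \<mu> H (s (r n)) w - X w)\<^sup>2)"
    using r2 by (rule AE_summable_of_nn_integral_bound[rotated 2])
      (use K(2) in \<open>auto intro!: summable_mult summable_geometric\<close>)
  then have lim: "AE w in M. (\<lambda>n. ennreal (simple_noise_integral \<mu> H (s (r n)) w ^ (2 * p))) \<longlonglongrightarrow> ennreal (X w ^ (2 * p))"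
  proof eventually_elim
    fix w assume "summable (\<lambda>n. (simple_noise_integral \<mu> H (s (r n)) w - X w)\<^sup>2)"
    then have "(\<lambda>n. sqrt ((simple_noise_integral \<mu> H (s (r n)) w - X w)\<^sup>2)) \<longlonglongrightarrow> sqrt 0"
      by (intro tendsto_real_sqrt summable_LIMSEQ_zero)
    then have "(\<lambda>n. simple_noise_integral \<mu> H (s (r n)) w - X w) \<longlonglongrightarrow> 0"
      by (simp add: tendsto_rabs_zero_iff)
    then have "(\<lambda>n. simple_noise_integral \<mu> H (s (r n)) w) \<longlonglongrightarrow> X w"
      by (simp add: LIM_zero_iff)
    then show "(\<lambda>n. ennreal (simple_noise_integral \<mu> H (s (r n)) w ^ (2 * p))) \<longlonglongrightarrow> ennreal (X w ^ (2 * p))"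
      by (intro tendsto_intros)
  qed
  have nn: "0 \<le> 4 * K" using K(2) by simp
  show ?thesis
  proof (rule nn_integral_le_of_AE_tendsto[OF _ lim])
    fix n
    have "(\<integral>\<^sup>+x. ennreal ((s (r n) x)\<^sup>2) \<partial>\<mu>) = (\<integral>\<^sup>+x. ennreal (((s (r n) x - f x) + f x)\<^sup>2) \<partial>\<mu>)" by simp
    also have "\<dots> \<le> 2 * (\<integral>\<^sup>+x. ennreal ((s (r n) x - f x)\<^sup>2) \<partial>\<mu>) + 2 * (\<integral>\<^sup>+x. ennreal ((f x)\<^sup>2) \<partial>\<mu>)"
      by (rule nn_integral_square_add_le) measurable
    also have "\<dots> \<le> 2 * ennreal (K * (1/2) ^ n) + 2 * ennreal K"
      by (intro add_mono mult_left_mono r1 K(1)) auto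
    also have "\<dots> = ennreal (2 * (K * (1/2) ^ n) + 2 * K)"
      using K(2) by (simp add: ennreal_mult)
    also have "\<dots> \<le> ennreal (4 * K)"
      using K(2) power_le_one[of "1/2::real" n] mult_left_le[of "(1/2) ^ n" K] by (intro ennreal_leI) simp
    finally have "(\<integral>\<^sup>+x. ennreal ((s (r n) x)\<^sup>2) \<partial>\<mu>) ^ p \<le> ennreal (4 * K) ^ p"
      by (intro power_mono) auto
    then have "(\<integral>\<^sup>+w. ennreal (simple_noise_integral \<mu> H (s (r n)) w ^ (2 * p)) \<partial>M)
        \<le> ennreal (normal_moment p) * ennreal (4 * K) ^ p"
      unfolding simple_noise_integral_even_moment[OF s(1)] by (intro mult_left_mono) auto
    then show "(\<integral>\<^sup>+w. ennreal (simple_noise_integral \<mu> H (s (r n)) w ^ (2 * p)) \<partial>M)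
        \<le> ennreal (normal_moment p * (4 * K) ^ p)"
      unfolding ennreal_mult[OF normal_moment_nonneg zero_le_power[OF nn]] ennreal_power[OF nn, symmetric] .
  qed measurable
qed

lemma has_noise_integral_unique:
  assumes X: "has_noise_integral M \<mu> H f X" and Y: "has_noise_integral M \<mu> H f Y"
  shows "AE w in M. X w = Y w"
proof -
  have [measurable]: "X \<in> borel_measurable M" "Y \<in> borel_measurable M"
    using X Y by (auto simp: has_noise_integral_def)
  have "(\<integral>\<^sup>+w. ennreal ((X w - Y w)\<^sup>2) \<partial>M) \<le> 0"
  proof (rule ennreal_le_epsilon)
    fix e :: real assume "0 < e"
    then show "(\<integral>\<^sup>+w. ennreal ((X w - Y w)\<^sup>2) \<partial>M) \<le> 0 + ennreal e"
      using has_noise_integral_even_moment[OF has_noise_integral_diff[OF X Y], of "e / 4" 1] normal_moment_1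
      by simp
  qed
  then have "(\<integral>\<^sup>+w. ennreal ((X w - Y w)\<^sup>2) \<partial>M) = 0" by simp
  then have "AE w in M. ennreal ((X w - Y w)\<^sup>2) = 0"
    by (subst (asm) nn_integral_0_iff_AE) auto
  then show ?thesis by eventually_elim (simp add: ennreal_eq_0_iff)
qed

lemma has_noise_integral_noise_integral:
  assumes "f \<in> borel_measurable \<mu>" "(\<integral>\<^sup>+x. ennreal ((f x)\<^sup>2) \<partial>\<mu>) < \<infinity>"
  shows "has_noise_integral M \<mu> H f (noise_integral M \<mu> H f)"
  unfolding noise_integral_def using has_noise_integral_exists[OF assms] by (rule someI_ex)

lemma has_noise_integral_indicator:
  assumes A: "A \<in> fin_sets \<mu>"
  shows "has_noise_integral M \<mu> H (indicator A) (H A)"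
proof -
  have Am: "A \<in> sets \<mu>" "emeasure \<mu> A < \<infinity>" using A by (auto simp: fin_sets_def)
  then have *: "{x \<in> space \<mu>. indicator A x \<noteq> (0::real)} = A"
    using sets.sets_into_space by (auto simp: indicator_def)
  have s: "fin_simple \<mu> (indicator A)"
    using Am * by (auto simp: fin_simple_def)
  have "AE w in M. simple_noise_integral \<mu> H (indicator A) w = (\<Sum>j\<in>{()}. 1 * H A w)"
    using A by (intro simple_noise_integral_eq_sum s) (auto simp: disjoint_family_on_def indicator_def)
  then have "(\<integral>\<^sup>+w. ennreal ((simple_noise_integral \<mu> H (indicator A) w - H A w)\<^sup>2) \<partial>M) = (\<integral>\<^sup>+w. 0 \<partial>M)"
    by (intro nn_integral_cong_AE) (auto elim!: eventually_mono)
  then show ?thesis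
    using s Am noise_measurable[OF A] unfolding has_noise_integral_def
    by (intro conjI exI[of _ "\<lambda>_. indicator A"] allI) (auto simp: fin_simple_def)
qed

end

section \<open>Kolmogorov's continuity criterion\<close>

lemma floor_dyadic_Suc:
  fixes x :: real
  shows "\<lfloor>2 * x\<rfloor> = 2 * \<lfloor>x\<rfloor> \<or> \<lfloor>2 * x\<rfloor> = 2 * \<lfloor>x\<rfloor> + 1"
  by linarith

text \<open>The last point of the grid \<open>T \<int> / 2\<^sup>n\<close> not beyond \<open>t\<close>.  Following a path along these points as \<open>n\<close> grows defines
  the continuous version at every \<open>t\<close> directly as a limit, without an extension from the dyadic points.\<close>

definition dyadic_pt :: "real \<Rightarrow> nat \<Rightarrow> real \<Rightarrow> real" where
  "dyadic_pt T n t = T * of_int \<lfloor>2 ^ n * t / T\<rfloor> / 2 ^ n"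

lemma dyadic_pt_eq:
  assumes "0 < T" "0 \<le> t" "t \<le> T"
  obtains i where "i \<le> 2 ^ n" "dyadic_pt T n t = T * real i / 2 ^ n" "int i = \<lfloor>2 ^ n * t / T\<rfloor>"
proof -
  let ?i = "nat \<lfloor>2 ^ n * t / T\<rfloor>"
  have nn: "0 \<le> \<lfloor>2 ^ n * t / T\<rfloor>" using assms by simp
  have "2 ^ n * t / T \<le> 2 ^ n" using assms by (simp add: field_simps)
  then have "\<lfloor>2 ^ n * t / T\<rfloor> \<le> 2 ^ n" by (simp add: floor_le_iff)
  then have "?i \<le> 2 ^ n" by (simp add: nat_le_iff)
  moreover have "dyadic_pt T n t = T * real ?i / 2 ^ n"
    using nn by (simp add: dyadic_pt_def)
  ultimately show ?thesis using that[of ?i] nn by simp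
qed

lemma dyadic_pt_mem:
  assumes "0 < T" "t \<in> {0..T}"
  shows "dyadic_pt T n t \<in> {0..T}"
proof -
  obtain i where i: "i \<le> 2 ^ n" "dyadic_pt T n t = T * real i / 2 ^ n"
    using dyadic_pt_eq[of T t n] assms by auto
  have "real i \<le> 2 ^ n" using i(1) by (metis of_nat_le_iff of_nat_numeral of_nat_power)
  then show ?thesis unfolding i(2) using assms(1) by (auto simp: field_simps)
qed

lemma dyadic_pt_dist:
  assumes "0 < T"
  shows "\<bar>dyadic_pt T n t - t\<bar> \<le> T / 2 ^ n"
proof -
  have "\<bar>of_int \<lfloor>2 ^ n * t / T\<rfloor> - 2 ^ n * t / T\<bar> \<le> 1" by linarith
  then have "T / 2 ^ n * \<bar>of_int \<lfloor>2 ^ n * t / T\<rfloor> - 2 ^ n * t / T\<bar> \<le> T / 2 ^ n * 1"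
    using assms by (intro mult_left_mono) auto
  moreover have "dyadic_pt T n t - t = T / 2 ^ n * (of_int \<lfloor>2 ^ n * t / T\<rfloor> - 2 ^ n * t / T)"
    using assms by (simp add: dyadic_pt_def field_simps)
  ultimately show ?thesis
    using assms by (simp add: abs_mult)
qed

text \<open>Passing from level \<open>n\<close> to \<open>n + 1\<close>, the grid point below \<open>t\<close> stays or moves to the next point of the finer
  grid, so the values along it change by at most \<open>K q\<^sup>n\<close> with \<open>q = 2\<^bsup>-\<gamma>\<^esup> < 1\<close>: they converge geometrically, uniformly in \<open>t\<close>.
  If \<open>\<bar>t - s\<bar>\<close> is comparable to \<open>T / 2\<^sup>n\<close>, then the level-\<open>n\<close> grid points below \<open>s\<close> and \<open>t\<close> are equal or adjacent, and
  the three errors are all of order \<open>q\<^sup>n\<close>, that is, of order \<open>\<bar>t - s\<bar>\<^bsup>\<gamma>\<^esup>\<close>.\<close>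

lemma hoelder_of_dyadic_increments:
  fixes x :: "real \<Rightarrow> real"
  assumes T: "0 < T" and \<gamma>: "0 < \<gamma>" and K: "0 \<le> K"
    and incr: "\<And>n i. i < 2 ^ n \<Longrightarrow> \<bar>x (T * real (Suc i) / 2 ^ n) - x (T * real i / 2 ^ n)\<bar> \<le> K * (1/2) powr (\<gamma> * n)"
  shows "hoelder_on {0..T} \<gamma> (\<lambda>t. lim (\<lambda>n. x (dyadic_pt T n t)))"
proof -
  define q where "q = (1/2::real) powr \<gamma>"
  have q: "0 < q" "q < 1"
    using powr_less_mono2[OF \<gamma>, of "1/2" 1] by (simp_all add: q_def)
  have qn: "(1/2) powr (\<gamma> * real n) = q ^ n" for n
    using powr_powr[of "1/2" \<gamma> "real n"] powr_realpow[OF q(1), of n] by (simp add: q_def)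
  define \<phi> where "\<phi> n t = x (dyadic_pt T n t)" for n t
  have step: "\<bar>\<phi> (Suc n) t - \<phi> n t\<bar> \<le> K * q ^ n" if t: "t \<in> {0..T}" for n t
  proof -
    obtain i where i: "i \<le> 2 ^ n" "dyadic_pt T n t = T * real i / 2 ^ n" "int i = \<lfloor>2 ^ n * t / T\<rfloor>"
      using dyadic_pt_eq[of T t n] T t by auto
    obtain j where j: "j \<le> 2 ^ Suc n" "dyadic_pt T (Suc n) t = T * real j / 2 ^ Suc n" "int j = \<lfloor>2 ^ Suc n * t / T\<rfloor>"
      using dyadic_pt_eq[of T t "Suc n"] T t by auto
    have "int j = 2 * int i \<or> int j = 2 * int i + 1"
      using floor_dyadic_Suc[of "2 ^ n * t / T"] i(3) j(3) by (simp add: mult.assoc)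
    then consider "j = 2 * i" | "j = Suc (2 * i)" by linarith
    then show ?thesis
    proof cases
      case 1
      then have "dyadic_pt T (Suc n) t = dyadic_pt T n t"
        unfolding i(2) j(2) by simp
      then show ?thesis using K q by (simp add: \<phi>_def)
    next
      case 2
      then have "2 * i < 2 ^ Suc n" using j(1) by simp
      from incr[OF this] have "\<bar>\<phi> (Suc n) t - x (T * real (2 * i) / 2 ^ Suc n)\<bar> \<le> K * q ^ Suc n"
        unfolding \<phi>_def j(2) 2 qn .
      also have "T * real (2 * i) / 2 ^ Suc n = dyadic_pt T n t"
        unfolding i(2) by simp
      also have "K * q ^ Suc n \<le> K * q ^ n"
        using K q by (intro mult_left_mono power_decreasing) auto
      finally show ?thesis by (simp add: \<phi>_def)
    qed
  qed
  have conv: "convergent (\<lambda>n. \<phi> n t)" if t: "t \<in> {0..T}" for t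
  proof -
    have "summable (\<lambda>n. K * q ^ n)"
      by (intro summable_mult summable_geometric) (use q in simp)
    then have "summable (\<lambda>n. \<phi> (Suc n) t - \<phi> n t)"
      by (rule summable_comparison_test'[where N=0]) (simp add: step[OF t])
    then have "convergent (\<lambda>n. \<Sum>i<n. \<phi> (Suc i) t - \<phi> i t)"
      by (simp add: summable_iff_convergent)
    then have "convergent (\<lambda>n. \<phi> n t - \<phi> 0 t)"
      unfolding sum_lessThan_telescope[of "\<lambda>i. \<phi> i t"] .
    from convergent_add[OF this convergent_const[of "\<phi> 0 t"]] show ?thesis by simp
  qed
  define y where "y t = lim (\<lambda>n. \<phi> n t)" for t
  have y: "(\<lambda>n. \<phi> n t) \<longlonglongrightarrow> y t" if "t \<in> {0..T}" for t
    using conv[OF that] by (simp add: y_def convergent_LIMSEQ_iff)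
  have near: "\<bar>y t - \<phi> n t\<bar> \<le> K / (1 - q) * q ^ n" if t: "t \<in> {0..T}" for n t
  proof (rule LIMSEQ_le_const2)
    have "(\<lambda>m. \<phi> (m + n) t) \<longlonglongrightarrow> y t"
      using y[OF t] by (rule LIMSEQ_ignore_initial_segment)
    then show "(\<lambda>m. \<bar>\<phi> (m + n) t - \<phi> n t\<bar>) \<longlonglongrightarrow> \<bar>y t - \<phi> n t\<bar>"
      by (intro tendsto_intros)
    have "\<bar>\<phi> (m + n) t - \<phi> n t\<bar> \<le> K * q ^ n * (\<Sum>i<m. q ^ i)" for m
    proof (induction m)
      case (Suc m)
      have "\<bar>\<phi> (Suc m + n) t - \<phi> n t\<bar> \<le> \<bar>\<phi> (Suc (m + n)) t - \<phi> (m + n) t\<bar> + \<bar>\<phi> (m + n) t - \<phi> n t\<bar>"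
        by simp
      also have "\<dots> \<le> K * q ^ (m + n) + K * q ^ n * (\<Sum>i<m. q ^ i)"
        using step[OF t, of "m + n"] Suc by linarith
      finally show ?case by (simp add: algebra_simps power_add)
    qed simp
    moreover have "K * q ^ n * (\<Sum>i<m. q ^ i) \<le> K / (1 - q) * q ^ n" for m
    proof -
      have "(\<Sum>i<m. q ^ i) \<le> (\<Sum>i. q ^ i)"
        using q by (intro sum_le_suminf summable_geometric) auto
      then have "K * q ^ n * (\<Sum>i<m. q ^ i) \<le> K * q ^ n * (1 / (1 - q))"
        using q K by (intro mult_left_mono) (auto simp: suminf_geometric)
      then show ?thesis by simp
    qed
    ultimately show "\<exists>N. \<forall>m\<ge>N. \<bar>\<phi> (m + n) t - \<phi> n t\<bar> \<le> K / (1 - q) * q ^ n"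
      by (meson order_trans)
  qed
  define L where "L = K / (1 - q)"
  have L: "0 \<le> L" using K q by (simp add: L_def)
  have "hoelder_on {0..T} \<gamma> y"
    unfolding hoelder_on_def
  proof (intro exI ballI)
    fix s t assume st: "s \<in> {0..T}" "t \<in> {0..T}"
    show "\<bar>y t - y s\<bar> \<le> (2 * L + K) * (2 / T) powr \<gamma> * \<bar>t - s\<bar> powr \<gamma>"
    proof (cases "t = s")
      case False
      define d where "d = \<bar>t - s\<bar> / T"
      have d: "0 < d" "d \<le> 1" using False T st by (auto simp: d_def)
      obtain m where "(1/2) ^ m < d" using real_arch_pow_inv[OF d(1), of "1/2"] by auto
      moreover define N where "N = (LEAST m. (1/2) ^ m < d)"
      ultimately have N: "(1/2) ^ N < d" by (metis (mono_tags) LeastI)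
      then have "N \<noteq> 0" using d by (intro notI) simp
      then obtain n where n: "N = Suc n" by (cases N) auto
      have dn: "d \<le> (1/2) ^ n"
        using not_less_Least[of n "\<lambda>m. (1/2) ^ m < d"] n unfolding N_def[symmetric] by auto
      obtain i where i: "i \<le> 2 ^ n" "dyadic_pt T n s = T * real i / 2 ^ n" "int i = \<lfloor>2 ^ n * s / T\<rfloor>"
        using dyadic_pt_eq[of T s n] T st by auto
      obtain j where j: "j \<le> 2 ^ n" "dyadic_pt T n t = T * real j / 2 ^ n" "int j = \<lfloor>2 ^ n * t / T\<rfloor>"
        using dyadic_pt_eq[of T t n] T st by auto
      have "2 ^ n * d \<le> 1"
        using dn by (simp add: power_one_over field_simps)
      then have "\<bar>2 ^ n * t / T - 2 ^ n * s / T\<bar> \<le> 1"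
        using T by (simp add: d_def abs_mult right_diff_distrib[symmetric] diff_divide_distrib[symmetric])
      then have "\<bar>int i - int j\<bar> \<le> 1"
        unfolding i(3) j(3) by linarith
      then have "i = j \<or> i = Suc j \<or> j = Suc i" by linarith
      then have "\<bar>\<phi> n t - \<phi> n s\<bar> \<le> K * q ^ n"
      proof (elim disjE)
        assume "i = j"
        then show ?thesis using K q by (simp add: \<phi>_def i(2) j(2))
      next
        assume ij: "i = Suc j"
        with i(1) have "j < 2 ^ n" by simp
        from incr[OF this] show ?thesis
          unfolding \<phi>_def i(2) j(2) ij qn by (subst abs_minus_commute)
      next
        assume ij: "j = Suc i"
        with j(1) have "i < 2 ^ n" by simp
        from incr[OF this] show ?thesis
          unfolding \<phi>_def i(2) j(2) ij qn .
      qed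
      then have "\<bar>y t - y s\<bar> \<le> (2 * L + K) * q ^ n"
        using near[OF st(1), of n] near[OF st(2), of n] unfolding L_def[symmetric]
        by (simp add: algebra_simps)
      also have "q ^ n \<le> (2 * d) powr \<gamma>"
      proof -
        have "(1/2) ^ n \<le> 2 * d" using N n by simp
        then have "((1/2) ^ n) powr \<gamma> \<le> (2 * d) powr \<gamma>"
          using \<gamma> by (intro powr_mono2) auto
        moreover have "((1/2::real) ^ n) powr \<gamma> = q ^ n"
          by (simp add: qn[symmetric] powr_realpow[symmetric] powr_powr mult.commute)
        ultimately show ?thesis by simp
      qed
      also have "(2 * d) powr \<gamma> = (2 / T) powr \<gamma> * \<bar>t - s\<bar> powr \<gamma>"
        using T by (simp add: d_def powr_mult[symmetric])
      finally show ?thesis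
        using L K by (simp add: mult_left_mono mult.assoc)
    qed simp
  qed
  then show ?thesis
    by (simp add: y_def[abs_def] \<phi>_def)
qed

lemma hoelder_on_mono:
  assumes "hoelder_on {0..T} \<beta> f" "\<gamma> \<le> \<beta>" "0 < T"
  shows "hoelder_on {0..T} \<gamma> f"
proof -
  obtain C where C: "\<And>s t. s \<in> {0..T} \<Longrightarrow> t \<in> {0..T} \<Longrightarrow> \<bar>f t - f s\<bar> \<le> C * \<bar>t - s\<bar> powr \<beta>"
    using assms(1) unfolding hoelder_on_def by blast
  show ?thesis unfolding hoelder_on_def
  proof (intro exI ballI)
    fix s t assume st: "s \<in> {0..T}" "t \<in> {0..T}"
    have "\<bar>f t - f s\<bar> \<le> \<bar>C\<bar> * \<bar>t - s\<bar> powr \<beta>"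
      using C[OF st] mult_right_mono[OF abs_ge_self[of C], of "\<bar>t - s\<bar> powr \<beta>"] by simp
    also have "\<bar>t - s\<bar> powr \<beta> = \<bar>t - s\<bar> powr (\<beta> - \<gamma>) * \<bar>t - s\<bar> powr \<gamma>"
      by (simp add: powr_add[symmetric])
    also have "\<dots> \<le> T powr (\<beta> - \<gamma>) * \<bar>t - s\<bar> powr \<gamma>"
      using st assms by (intro mult_right_mono powr_mono2) auto
    finally show "\<bar>f t - f s\<bar> \<le> (\<bar>C\<bar> * T powr (\<beta> - \<gamma>)) * \<bar>t - s\<bar> powr \<gamma>"
      by (simp add: mult_left_mono mult.assoc)
  qed
qed

text \<open>The random variable \<open>S p n\<close> collects the \<open>2p\<close>-th powers of the increments over the level-\<open>n\<close> grid with weight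
  \<open>2\<^bsup>n(p-2)\<^esup>\<close>.  Its \<open>2\<^sup>n\<close> terms have expectation at most \<open>c\<^sub>p (T/2\<^sup>n)\<^sup>p\<close> before weighting, so the weight is chosen to
  leave a bound of order \<open>2\<^sup>-\<^sup>n\<close>.  The sum over \<open>n\<close> is then finite almost surely and bounds each single increment by a multiple
  of \<open>2\<^sup>-\<^sup>n\<close> to the power \<open>(p - 2)/(2p) = 1/2 - 1/p\<close>.  One null set serves all integers \<open>p\<close>, so a single version
  has all orders below \<open>1/2\<close>.\<close>

theorem (in prob_space) kolmogorov_modification:
  fixes X :: "real \<Rightarrow> 'a \<Rightarrow> real"
  assumes T: "0 < T"
    and X[measurable]: "\<And>t. t \<in> {0..T} \<Longrightarrow> X t \<in> borel_measurable M"
    and c: "\<And>p. 0 \<le> c p"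
    and moment: "\<And>p s t. s \<in> {0..T} \<Longrightarrow> t \<in> {0..T} \<Longrightarrow>
      (\<integral>\<^sup>+w. ennreal ((X t w - X s w) ^ (2 * p)) \<partial>M) \<le> ennreal (c p * \<bar>t - s\<bar> ^ p)"
  shows "\<exists>Y. modification_on {0..T} M X Y \<and> (\<forall>w\<in>space M. \<forall>\<gamma>\<in>{0..<1/2}. hoelder_on {0..T} \<gamma> (\<lambda>t. Y t w))"
proof -
  define D where "D n i w = X (T * real (Suc i) / 2 ^ n) w - X (T * real i / 2 ^ n) w" for n i w
  have grid: "T * real i / 2 ^ n \<in> {0..T}" if "i \<le> 2 ^ n" for i n
  proof -
    have "real i \<le> 2 ^ n" using that by (metis of_nat_le_iff of_nat_numeral of_nat_power)
    then show ?thesis using T by (auto simp: field_simps)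
  qed
  have D[measurable]: "D n i \<in> borel_measurable M" if "i < 2 ^ n" for n i
    unfolding D_def using X[OF grid[of i n]] X[OF grid[of "Suc i" n]] that by auto
  define S where "S p n w = (\<Sum>i<2^n. 2 ^ (n * (p - 2)) * D n i w ^ (2 * p))" for p n w
  have Sm[measurable]: "S p n \<in> borel_measurable M" for p n
    unfolding S_def by (intro borel_measurable_sum borel_measurable_times borel_measurable_power) auto
  have even: "0 \<le> x ^ (2 * p)" for x :: real and p by (simp add: zero_le_even_power)
  have "AE w in M. summable (\<lambda>n. S p n w)" if p: "2 \<le> p" for p
  proof (rule AE_summable_of_nn_integral_bound)
    fix n
    have "(\<integral>\<^sup>+w. ennreal (S p n w) \<partial>M) = (\<integral>\<^sup>+w. (\<Sum>i<2^n. ennreal (2 ^ (n * (p - 2))) * ennreal (D n i w ^ (2 * p))) \<partial>M)"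
      unfolding S_def by (intro nn_integral_cong) (subst sum_ennreal[symmetric], auto simp: even ennreal_mult)
    also have "\<dots> = (\<Sum>i<2^n. ennreal (2 ^ (n * (p - 2))) * (\<integral>\<^sup>+w. ennreal (D n i w ^ (2 * p)) \<partial>M))"
      by (subst nn_integral_sum) (auto simp: nn_integral_cmult intro!: sum.cong)
    also have "\<dots> \<le> (\<Sum>i<(2::nat)^n. ennreal (2 ^ (n * (p - 2))) * ennreal (c p * (T / 2 ^ n) ^ p))"
    proof (intro sum_mono mult_left_mono)
      fix i :: nat assume "i \<in> {..<2 ^ n}"
      then have "(\<integral>\<^sup>+w. ennreal (D n i w ^ (2 * p)) \<partial>M)
          \<le> ennreal (c p * \<bar>T * real (Suc i) / 2 ^ n - T * real i / 2 ^ n\<bar> ^ p)"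
        unfolding D_def by (intro moment grid) auto
      also have "\<bar>T * real (Suc i) / 2 ^ n - T * real i / 2 ^ n\<bar> = T / 2 ^ n"
        using T by (simp add: field_simps)
      finally show "(\<integral>\<^sup>+w. ennreal (D n i w ^ (2 * p)) \<partial>M) \<le> ennreal (c p * (T / 2 ^ n) ^ p)" .
    qed auto
    also have "\<dots> = ennreal (2 ^ n * (2 ^ (n * (p - 2)) * (c p * (T / 2 ^ n) ^ p)))"
      using c T by (simp add: ennreal_mult ennreal_of_nat_eq_real_of_nat)
    also have "2 ^ n * (2 ^ (n * (p - 2)) * (c p * (T / 2 ^ n) ^ p)) = c p * T ^ p * (1/2) ^ n"
    proof -
      have "n * p = n * (p - 2) + n * 2" using p by (metis add_mult_distrib2 le_add_diff_inverse2)
      then have "(2::real) ^ (n * p) = 2 ^ (n * (p - 2)) * (2 ^ n * 2 ^ n)"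
        by (simp add: power_add power_mult[symmetric] mult_2_right)
      then show ?thesis
        by (simp add: power_divide power_mult[symmetric] power_one_over field_simps)
    qed
    finally show "(\<integral>\<^sup>+w. ennreal (S p n w) \<partial>M) \<le> ennreal (c p * T ^ p * (1/2) ^ n)" .
  next
    show "0 \<le> S p n w" for n w unfolding S_def by (intro sum_nonneg mult_nonneg_nonneg even) auto
  qed (use c T in \<open>auto intro!: summable_mult summable_geometric\<close>)
  then have ae: "AE w in M. \<forall>p\<in>{2..}. summable (\<lambda>n. S p n w)"
    by (subst AE_ball_countable) auto
  obtain N where N: "\<And>w. w \<in> space M - N \<Longrightarrow> \<forall>p\<in>{2..}. summable (\<lambda>n. S p n w)" "N \<in> null_sets M"
    using AE_E3[OF ae] by blast
  define G where "G = space M - N"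
  have G: "summable (\<lambda>n. S p n w)" if "w \<in> G" "2 \<le> p" for w p
    using N(1)[of w] that by (simp add: G_def)
  have Gm[measurable]: "G \<in> sets M" using N(2) by (auto simp: G_def)
  have AEG: "AE w in M. w \<in> G"
    using AE_not_in[OF N(2)] AE_space by eventually_elim (simp add: G_def)
  define Y where "Y t w = (if w \<in> G then lim (\<lambda>n. X (dyadic_pt T n t) w) else 0)" for t w
  have incr: "\<exists>K\<ge>0. \<forall>n. \<forall>i<2^n. \<bar>D n i w\<bar> \<le> K * (1/2) powr ((1/2 - 1/real p) * real n)"
    if w: "w \<in> G" and p: "2 < p" for w p
  proof -
    have sm: "summable (\<lambda>n. S p n w)" using w p by (simp add: G)
    have S0: "0 \<le> S p n w" for n
      unfolding S_def by (intro sum_nonneg mult_nonneg_nonneg even) auto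
    define Q where "Q = (\<Sum>n. S p n w)"
    have Q0: "0 \<le> Q" unfolding Q_def using sm S0 by (intro suminf_nonneg)
    have "\<bar>D n i w\<bar> \<le> Q powr (1 / (2 * p)) * (1/2) powr ((1/2 - 1/real p) * real n)" if i: "i < 2 ^ n" for n i
    proof -
      have "2 ^ (n * (p - 2)) * D n i w ^ (2 * p) \<le> S p n w"
        unfolding S_def using i
        by (intro member_le_sum[of i _ "\<lambda>i. 2 ^ (n * (p - 2)) * D n i w ^ (2 * p)"]) (auto simp: even)
      also have "\<dots> \<le> Q"
        unfolding Q_def using sm S0 sum_le_suminf[of "\<lambda>n. S p n w" "{n}"] by auto
      finally have "\<bar>D n i w\<bar> ^ (2 * p) \<le> Q * (1/2) ^ (n * (p - 2))"
        by (simp add: power_one_over field_simps power_even_abs)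
      then have "(\<bar>D n i w\<bar> ^ (2 * p)) powr (1 / (2 * p)) \<le> (Q * (1/2) ^ (n * (p - 2))) powr (1 / (2 * p))"
        by (intro powr_mono2) auto
      also have "\<dots> = Q powr (1 / (2 * p)) * ((1/2) powr real (n * (p - 2))) powr (1 / (2 * p))"
        using Q0 powr_realpow[of "1/2" "n * (p - 2)"] by (simp add: powr_mult del: of_nat_mult)
      also have "((1/2::real) powr real (n * (p - 2))) powr (1 / (2 * p)) = (1/2) powr ((1/2 - 1/real p) * real n)"
      proof -
        have "real (n * (p - 2)) * (1 / (2 * p)) = (1/2 - 1/real p) * real n"
          using p by (simp add: of_nat_diff field_simps)
        then show ?thesis by (simp add: powr_powr)
      qed
      also have "(\<bar>D n i w\<bar> ^ (2 * p)) powr (1 / (2 * p)) = \<bar>D n i w\<bar>"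
      proof (cases "D n i w = 0")
        case False
        then show ?thesis using p by (simp add: powr_realpow[symmetric] powr_powr)
      qed (use p in auto)
      finally show ?thesis .
    qed
    then show ?thesis by (intro exI[of _ "Q powr (1 / (2 * p))"]) auto
  qed
  have Ym: "Y t \<in> borel_measurable M" if t: "t \<in> {0..T}" for t
  proof -
    have [measurable]: "X (dyadic_pt T n t) \<in> borel_measurable M" for n
      by (rule X[OF dyadic_pt_mem[OF T t]])
    have "(\<lambda>w. lim (\<lambda>n. X (dyadic_pt T n t) w)) \<in> borel_measurable M"
      by (rule borel_measurable_lim_metric) measurable
    then show ?thesis unfolding Y_def[abs_def] by measurable
  qed
  have YX: "AE w in M. Y t w = X t w" if t: "t \<in> {0..T}" for t
  proof -
    have [measurable]: "X (dyadic_pt T n t) \<in> borel_measurable M" "X t \<in> borel_measurable M" for n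
      by (rule X[OF dyadic_pt_mem[OF T t]], rule X[OF t])
    have "AE w in M. summable (\<lambda>n. (X (dyadic_pt T n t) w - X t w)\<^sup>2)"
    proof (rule AE_summable_of_nn_integral_bound)
      fix n
      have "(\<integral>\<^sup>+w. ennreal ((X (dyadic_pt T n t) w - X t w)\<^sup>2) \<partial>M) \<le> ennreal (c 1 * \<bar>dyadic_pt T n t - t\<bar> ^ 1)"
        using moment[OF t dyadic_pt_mem[OF T t, of n], of 1] by simp
      also have "\<dots> \<le> ennreal (c 1 * T * (1/2) ^ n)"
        using mult_left_mono[OF dyadic_pt_dist[OF T, of n t] c[of 1]]
        by (intro ennreal_leI) (simp add: power_one_over)
      finally show "(\<integral>\<^sup>+w. ennreal ((X (dyadic_pt T n t) w - X t w)\<^sup>2) \<partial>M) \<le> ennreal (c 1 * T * (1/2) ^ n)" .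
    qed (use c T in \<open>auto intro!: summable_mult summable_geometric\<close>)
    with AEG show ?thesis
    proof eventually_elim
      fix w assume w: "w \<in> G" "summable (\<lambda>n. (X (dyadic_pt T n t) w - X t w)\<^sup>2)"
      then have "(\<lambda>n. sqrt ((X (dyadic_pt T n t) w - X t w)\<^sup>2)) \<longlonglongrightarrow> sqrt 0"
        by (intro tendsto_real_sqrt summable_LIMSEQ_zero)
      then have "(\<lambda>n. X (dyadic_pt T n t) w - X t w) \<longlonglongrightarrow> 0"
        by (simp add: tendsto_rabs_zero_iff)
      then have "(\<lambda>n. X (dyadic_pt T n t) w) \<longlonglongrightarrow> X t w"
        by (simp add: LIM_zero_iff)
      then show "Y t w = X t w" using w(1) by (simp add: Y_def limI)
    qed
  qed
  have "hoelder_on {0..T} \<gamma> (\<lambda>t. Y t w)" if \<gamma>: "\<gamma> \<in> {0..<1/2}" for w \<gamma>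
  proof (cases "w \<in> G")
    case True
    define p where "p = max 3 (nat \<lceil>1 / (1/2 - \<gamma>)\<rceil>)"
    have p: "2 < p" by (simp add: p_def)
    have "1 / (1/2 - \<gamma>) \<le> real p" by (simp add: p_def) linarith
    then have "1 / real p \<le> 1/2 - \<gamma>"
      using \<gamma> p by (simp add: field_simps)
    then have \<gamma>p: "\<gamma> \<le> 1/2 - 1 / real p" by simp
    have p0: "0 < 1/2 - 1 / real p" using p by (simp add: field_simps)
    obtain K where K: "0 \<le> K" "\<And>n i. i < 2 ^ n \<Longrightarrow> \<bar>D n i w\<bar> \<le> K * (1/2) powr ((1/2 - 1/real p) * real n)"
      using incr[OF True p] by auto
    have "hoelder_on {0..T} (1/2 - 1 / real p) (\<lambda>t. lim (\<lambda>n. X (dyadic_pt T n t) w))"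
      using K(2) unfolding D_def by (intro hoelder_of_dyadic_increments[OF T p0 K(1), of "\<lambda>t. X t w"]) auto
    from hoelder_on_mono[OF this \<gamma>p T] show ?thesis using True by (simp add: Y_def)
  next
    case False
    then show ?thesis by (auto simp: Y_def hoelder_on_def intro!: exI[of _ 0])
  qed
  then show ?thesis
    using Ym YX unfolding modification_on_def by blast
qed

text \<open>A curve that is Hoelder continuous of order \<open>1/2\<close> in \<open>L\<^sup>2(\<mu>)\<close> satisfies the moment conditions of
  Kolmogorov's criterion for all \<open>p\<close> at once, because its increments have Gaussian integrals.\<close>

lemma (in noise) noise_integral_hoelder_modification:
  assumes T: "0 < T" and f: "\<And>t. t \<in> {0..T} \<Longrightarrow> f t \<in> borel_measurable \<mu>"
    and L2: "\<And>t. t \<in> {0..T} \<Longrightarrow> (\<integral>\<^sup>+x. ennreal ((f t x)\<^sup>2) \<partial>\<mu>) < \<infinity>"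
    and C: "0 < C"
    and incr: "\<And>s t. 0 \<le> s \<Longrightarrow> s \<le> t \<Longrightarrow> t \<le> T \<Longrightarrow>
      (\<integral>\<^sup>+x. ennreal ((f t x - f s x)\<^sup>2) \<partial>\<mu>) \<le> ennreal (C * (t - s))"
  shows "\<exists>Y. modification_on {0..T} M (\<lambda>t. noise_integral M \<mu> H (f t)) Y \<and>
    (\<forall>w\<in>space M. \<forall>\<gamma>\<in>{0..<1/2}. hoelder_on {0..T} \<gamma> (\<lambda>t. Y t w))"
proof (rule kolmogorov_modification[OF T, where c="\<lambda>p. normal_moment p * (4 * C) ^ p"])
  let ?X = "\<lambda>t. noise_integral M \<mu> H (f t)"
  have X: "has_noise_integral M \<mu> H (f t) (?X t)" if "t \<in> {0..T}" for t
    by (rule has_noise_integral_noise_integral[OF f[OF that] L2[OF that]])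
  show "?X t \<in> borel_measurable M" if "t \<in> {0..T}" for t
    using X[OF that] by (simp add: has_noise_integral_def)
  show "0 \<le> normal_moment p * (4 * C) ^ p" for p
    using C normal_moment_nonneg by simp
  fix p s t assume st: "s \<in> {0..T}" "t \<in> {0..T}"
  show "(\<integral>\<^sup>+w. ennreal ((?X t w - ?X s w) ^ (2 * p)) \<partial>M) \<le> ennreal (normal_moment p * (4 * C) ^ p * \<bar>t - s\<bar> ^ p)"
  proof (cases "t = s")
    case True
    show ?thesis
    proof (cases "p = 0")
      case p: True
      then show ?thesis using True by (simp add: normal_moment_def emeasure_space_1)
    next
      case False
      then show ?thesis by (simp add: True power_0_left)
    qed
  next
    case False
    have "(\<integral>\<^sup>+x. ennreal ((f t x - f s x)\<^sup>2) \<partial>\<mu>) \<le> ennreal (C * \<bar>t - s\<bar>)"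
    proof (cases "s \<le> t")
      case True
      then show ?thesis using incr[of s t] st by simp
    next
      case False
      then show ?thesis using incr[of t s] st by (simp add: power2_commute)
    qed
    moreover have "0 < C * \<bar>t - s\<bar>" using False C by simp
    ultimately have "(\<integral>\<^sup>+w. ennreal ((?X t w - ?X s w) ^ (2 * p)) \<partial>M)
        \<le> ennreal (normal_moment p * (4 * (C * \<bar>t - s\<bar>)) ^ p)"
      by (rule has_noise_integral_even_moment[OF has_noise_integral_diff[OF X[OF st(2)] X[OF st(1)]]])
    then show ?thesis by (simp add: power_mult_distrib mult_ac)
  qed
qed

section \<open>Time-changed Brownian motion from increasing sets\<close>

text \<open>A process whose values are almost surely partial sums of independent increments has a law that depends
  only on the laws of the increments.\<close>

lemma (in prob_space) distr_partial_sums: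
  fixes D :: "nat \<Rightarrow> 'a \<Rightarrow> real" and X :: "'t \<Rightarrow> 'a \<Rightarrow> real"
  assumes ind: "indep_vars (\<lambda>_. borel) D UNIV"
    and law: "\<And>i. distr M borel (D i) = L i"
    and J: "finite J" and X: "\<And>t. t \<in> J \<Longrightarrow> X t \<in> borel_measurable M"
    and XD: "\<And>t. t \<in> J \<Longrightarrow> AE w in M. X t w = (\<Sum>i\<le>m t. D i w)"
  shows "distr M (Pi\<^sub>M J (\<lambda>_. borel)) (\<lambda>w. \<lambda>t\<in>J. X t w)
    = distr (Pi\<^sub>M UNIV L) (Pi\<^sub>M J (\<lambda>_. borel)) (\<lambda>x. \<lambda>t\<in>J. \<Sum>i\<le>m t. x i)"
proof -
  have D[measurable]: "D i \<in> borel_measurable M" for i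
    using ind by (simp add: indep_vars_def)
  have "distr M (Pi\<^sub>M J (\<lambda>_. borel)) (\<lambda>w. \<lambda>t\<in>J. X t w)
      = distr M (Pi\<^sub>M J (\<lambda>_. borel)) (\<lambda>w. \<lambda>t\<in>J. \<Sum>i\<le>m t. D i w)"
  proof (rule distr_cong_AE)
    have "AE w in M. \<forall>t\<in>J. X t w = (\<Sum>i\<le>m t. D i w)"
      by (intro AE_finite_allI J XD)
    then show "AE w in M. (\<lambda>t\<in>J. X t w) = (\<lambda>t\<in>J. \<Sum>i\<le>m t. D i w)"
      by eventually_elim (auto simp: restrict_def)
    show "(\<lambda>w. \<lambda>t\<in>J. X t w) \<in> M \<rightarrow>\<^sub>M Pi\<^sub>M J (\<lambda>_. borel)"
      using X by (intro measurable_restrict)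
    show "(\<lambda>w. \<lambda>t\<in>J. \<Sum>i\<le>m t. D i w) \<in> M \<rightarrow>\<^sub>M Pi\<^sub>M J (\<lambda>_. borel)"
      by (intro measurable_restrict) measurable
  qed auto
  also have "\<dots> = distr (distr M (Pi\<^sub>M UNIV (\<lambda>_. borel)) (\<lambda>w. \<lambda>i\<in>UNIV. D i w)) (Pi\<^sub>M J (\<lambda>_. borel)) (\<lambda>x. \<lambda>t\<in>J. \<Sum>i\<le>m t. x i)"
    by (subst distr_distr) (auto simp: comp_def intro!: measurable_restrict)
  also have "distr M (Pi\<^sub>M UNIV (\<lambda>_. borel)) (\<lambda>w. \<lambda>i\<in>UNIV. D i w) = Pi\<^sub>M UNIV (\<lambda>i. distr M borel (D i))"
    using ind by (subst (asm) indep_vars_iff_distr_eq_PiM) auto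
  finally show ?thesis unfolding law .
qed

text \<open>Ranks replace a sorted enumeration of the finite set \<open>J\<close> of observation times.\<close>

definition time_rank :: "real set \<Rightarrow> real \<Rightarrow> nat" where
  "time_rank J t = card {u \<in> J. u < t}"

text \<open>For an increasing family \<open>A\<close>, this is the member at the \<open>n\<close>-th smallest time of \<open>J\<close>, starting from the empty set at
  \<open>n = 0\<close> and constant once all times are used up.  Being defined for all \<open>n\<close>, it fits the
  infinite sequences in the independence properties of noise and Brownian motion.\<close>

definition stage :: "real set \<Rightarrow> (real \<Rightarrow> 'b set) \<Rightarrow> nat \<Rightarrow> 'b set" where
  "stage J A n = (\<Union>u\<in>{u \<in> J. time_rank J u < n}. A u)"

lemma time_rank_less: "finite J \<Longrightarrow> s \<in> J \<Longrightarrow> s < t \<Longrightarrow> time_rank J s < time_rank J t"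
  unfolding time_rank_def by (intro psubset_card_mono) auto

lemma stage_0: "stage J A 0 = {}"
  by (simp add: stage_def)

lemma stage_mono: "m \<le> n \<Longrightarrow> stage J A m \<subseteq> stage J A n"
  by (auto simp: stage_def intro: less_le_trans)

lemma stage_time_rank:
  assumes "finite J" "t \<in> J" "\<And>s. s \<in> J \<Longrightarrow> s \<le> t \<Longrightarrow> A s \<subseteq> A t"
  shows "stage J A (Suc (time_rank J t)) = A t"
proof -
  have "u \<le> t" if "u \<in> J" "time_rank J u < Suc (time_rank J t)" for u
    using time_rank_less[OF assms(1,2), of u] that by force
  then show ?thesis using assms(2,3) unfolding stage_def by blast
qed

lemma (in noise) distr_noise_increasing:
  assumes J: "finite J" and A: "\<And>t. t \<in> J \<Longrightarrow> A t \<in> fin_sets \<mu>"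
    and mono: "\<And>s t. s \<in> J \<Longrightarrow> t \<in> J \<Longrightarrow> s \<le> t \<Longrightarrow> A s \<subseteq> A t"
    and X: "\<And>t. t \<in> J \<Longrightarrow> X t \<in> borel_measurable M" "\<And>t. t \<in> J \<Longrightarrow> AE w in M. X t w = H (A t) w"
  shows "distr M (Pi\<^sub>M J (\<lambda>_. borel)) (\<lambda>w. \<lambda>t\<in>J. X t w)
    = distr (Pi\<^sub>M UNIV (\<lambda>i. centered_normal (measure \<mu> (stage J A (Suc i)) - measure \<mu> (stage J A i))))
        (Pi\<^sub>M J (\<lambda>_. borel)) (\<lambda>x. \<lambda>t\<in>J. \<Sum>i\<le>time_rank J t. x i)"
proof -
  let ?S = "stage J A"
  define E where "E i = ?S (Suc i) - ?S i" for i
  have S: "?S n \<in> fin_sets \<mu>" for n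
    unfolding stage_def using J A by (intro fin_sets_UN) auto
  have E: "E i \<in> fin_sets \<mu>" for i
    using S[of i] S[of "Suc i"]
    by (intro fin_sets_subset[OF _ _ S[of "Suc i"]]) (auto simp: E_def fin_sets_def)
  have disj: "disjoint_family E"
    unfolding E_def by (rule disjoint_family_Suc) (rule stage_mono, simp)
  have UN: "(\<Union>i<n. E i) = ?S n" for n
  proof (induction n)
    case (Suc n)
    have "(\<Union>i<Suc n. E i) = (\<Union>i<n. E i) \<union> E n" by (auto simp: less_Suc_eq)
    also have "\<dots> = ?S (Suc n)"
      unfolding Suc unfolding E_def using stage_mono[of n "Suc n" J A] by auto
    finally show ?case .
  qed (simp add: stage_0)
  show ?thesis
  proof (rule distr_partial_sums[where D="\<lambda>i. H (E i)", OF _ _ J X(1)])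
    show "indep_vars (\<lambda>_. borel) (\<lambda>i. H (E i)) UNIV" by (rule noise_indep[OF E disj])
    show "distr M borel (H (E i)) = centered_normal (measure \<mu> (?S (Suc i)) - measure \<mu> (?S i))" for i
      unfolding noise_distr[OF E] unfolding E_def
      using S[of i] S[of "Suc i"] stage_mono[of i "Suc i" J A]
      by (subst measure_Diff) (auto simp: fin_sets_def less_top)
    show "AE w in M. X t w = (\<Sum>i\<le>time_rank J t. H (E i) w)" if t: "t \<in> J" for t
    proof -
      have "AE w in M. H (\<Union>i\<in>{..<Suc (time_rank J t)}. E i) w = (\<Sum>i\<in>{..<Suc (time_rank J t)}. H (E i) w)"
        using E disj by (intro noise_UN) (auto simp: disjoint_family_on_def)
      moreover have "(\<Union>i\<in>{..<Suc (time_rank J t)}. E i) = A t"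
        unfolding UN by (rule stage_time_rank[OF J t]) (rule mono[OF _ t])
      ultimately show ?thesis
        using X(2)[OF t] by (auto simp: lessThan_Suc_atMost elim!: eventually_elim2)
    qed
  qed
qed

lemma distr_brownian_times:
  assumes B: "std_brownian_motion N B" and J: "finite J"
    and \<tau>: "\<tau> 0 = 0" "mono \<tau>" and v: "\<And>t. t \<in> J \<Longrightarrow> v t = \<tau> (Suc (m t))"
  shows "distr N (Pi\<^sub>M J (\<lambda>_. borel)) (\<lambda>w. \<lambda>t\<in>J. B (v t) w)
    = distr (Pi\<^sub>M UNIV (\<lambda>i. centered_normal (\<tau> (Suc i) - \<tau> i))) (Pi\<^sub>M J (\<lambda>_. borel)) (\<lambda>x. \<lambda>t\<in>J. \<Sum>i\<le>m t. x i)"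
proof -
  interpret prob_space N using B by (simp add: std_brownian_motion_def)
  have pos: "0 \<le> \<tau> i" for i using \<tau> monoD[OF \<tau>(2), of 0 i] by simp
  have step: "\<tau> i \<le> \<tau> (Suc i)" for i using \<tau>(2) by (simp add: monoD)
  show ?thesis
  proof (rule distr_partial_sums[where D="\<lambda>i w. B (\<tau> (Suc i)) w - B (\<tau> i) w", OF _ _ J])
    show "indep_vars (\<lambda>_. borel) (\<lambda>i w. B (\<tau> (Suc i)) w - B (\<tau> i) w) UNIV"
      using B \<tau> unfolding std_brownian_motion_def by auto
    show "distr N borel (\<lambda>w. B (\<tau> (Suc i)) w - B (\<tau> i) w) = centered_normal (\<tau> (Suc i) - \<tau> i)" for i
      using B pos step unfolding std_brownian_motion_def by blast
    show "B (v t) \<in> borel_measurable N" if "t \<in> J" for t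
      using B v[OF that] pos unfolding std_brownian_motion_def by auto
    have "AE w in N. B 0 w = 0" using B by (simp add: std_brownian_motion_def)
    then show "AE w in N. B (v t) w = (\<Sum>i\<le>m t. B (\<tau> (Suc i)) w - B (\<tau> i) w)" if t: "t \<in> J" for t
    proof eventually_elim
      fix w assume "B 0 w = 0"
      moreover have "(\<Sum>i<Suc (m t). B (\<tau> (Suc i)) w - B (\<tau> i) w) = B (\<tau> (Suc (m t))) w - B (\<tau> 0) w"
        by (rule sum_lessThan_telescope[of "\<lambda>i. B (\<tau> i) w"])
      ultimately show "B (v t) w = (\<Sum>i\<le>m t. B (\<tau> (Suc i)) w - B (\<tau> i) w)"
        using v[OF t] \<tau>(1) by (simp only: lessThan_Suc_atMost diff_zero)
    qed
  qed
qed

lemma (in noise) same_fdds_brownian: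
  fixes A :: "real \<Rightarrow> 'b set"
  assumes B: "std_brownian_motion N B"
    and A: "\<And>t. 0 \<le> t \<Longrightarrow> A t \<in> fin_sets \<mu>" and mono: "\<And>s t. 0 \<le> s \<Longrightarrow> s \<le> t \<Longrightarrow> A s \<subseteq> A t"
    and X: "\<And>t. 0 \<le> t \<Longrightarrow> X t \<in> borel_measurable M" "\<And>t. 0 \<le> t \<Longrightarrow> AE w in M. X t w = H (A t) w"
  shows "same_fdds {0..} M X N (\<lambda>t. B (measure \<mu> (A t)))"
  unfolding same_fdds_def
proof (intro conjI ballI allI impI)
  show "X t \<in> borel_measurable M" if "t \<in> {0..}" for t using X(1) that by simp
  show "B (measure \<mu> (A t)) \<in> borel_measurable N" for t
    using B by (simp add: std_brownian_motion_def)
next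
  fix J assume J: "finite J \<and> J \<subseteq> {0::real..}"
  let ?\<tau> = "\<lambda>n. measure \<mu> (stage J A n)"
  have S: "stage J A n \<in> fin_sets \<mu>" for n
    unfolding stage_def using J A by (intro fin_sets_UN) auto
  have "distr N (Pi\<^sub>M J (\<lambda>_. borel)) (\<lambda>w. \<lambda>t\<in>J. B (measure \<mu> (A t)) w)
      = distr (Pi\<^sub>M UNIV (\<lambda>i. centered_normal (?\<tau> (Suc i) - ?\<tau> i))) (Pi\<^sub>M J (\<lambda>_. borel))
          (\<lambda>x. \<lambda>t\<in>J. \<Sum>i\<le>time_rank J t. x i)"
  proof (rule distr_brownian_times[OF B])
    show "mono ?\<tau>"
      using S by (intro monoI measure_mono_fmeasurable stage_mono) (auto simp: fin_sets_def fmeasurable_def)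
    show "measure \<mu> (A t) = ?\<tau> (Suc (time_rank J t))" if "t \<in> J" for t
    proof -
      have "stage J A (Suc (time_rank J t)) = A t"
        using J that by (intro stage_time_rank mono) auto
      then show ?thesis by simp
    qed
  qed (use J in \<open>auto simp: stage_0\<close>)
  moreover have "distr M (Pi\<^sub>M J (\<lambda>_. borel)) (\<lambda>w. \<lambda>t\<in>J. X t w)
      = distr (Pi\<^sub>M UNIV (\<lambda>i. centered_normal (?\<tau> (Suc i) - ?\<tau> i))) (Pi\<^sub>M J (\<lambda>_. borel))
          (\<lambda>x. \<lambda>t\<in>J. \<Sum>i\<le>time_rank J t. x i)"
    using J by (intro distr_noise_increasing A mono X) auto
  ultimately show "distr M (Pi\<^sub>M J (\<lambda>_. borel)) (\<lambda>w. \<lambda>t\<in>J. X t w)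
      = distr N (Pi\<^sub>M J (\<lambda>_. borel)) (\<lambda>w. \<lambda>t\<in>J. B (measure \<mu> (A t)) w)" by simp
qed

section \<open>Geometric graphs\<close>

lemma geom_graph_edge_iff:
  "{x, y} \<in> edges (geom_graph X t) \<longleftrightarrow> x \<in> X \<and> y \<in> X \<and> x \<noteq> y \<and> dist x y \<le> t"
  by (auto simp: geom_graph_def doubleton_eq_iff dist_commute)

lemma verts_geom_graph [simp]: "verts (geom_graph X t) = X"
  by (simp add: geom_graph_def)

lemma simple_graph_geom_graph: "finite X \<Longrightarrow> simple_graph (geom_graph X t)"
  by (auto simp: simple_graph_def geom_graph_def)

lemma simple_graph_edgeD: "simple_graph G \<Longrightarrow> {u, v} \<in> edges G \<Longrightarrow> u \<in> verts G \<and> v \<in> verts G"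
  by (fastforce simp: simple_graph_def doubleton_eq_iff)

lemma graph_iso_sym:
  assumes "graph_iso G G'"
  shows "graph_iso G' G"
proof -
  obtain f where f: "bij_betw f (verts G) (verts G')"
    "\<And>x y. x \<in> verts G \<Longrightarrow> y \<in> verts G \<Longrightarrow> {x, y} \<in> edges G \<longleftrightarrow> {f x, f y} \<in> edges G'"
    using assms by (auto simp: graph_iso_def)
  let ?g = "the_inv_into (verts G) f"
  have g: "bij_betw ?g (verts G') (verts G)" by (rule bij_betw_the_inv_into[OF f(1)])
  have "f (?g x) = x" "?g x \<in> verts G" if "x \<in> verts G'" for x
    using f_the_inv_into_f_bij_betw[OF f(1)] that g by (auto simp: bij_betw_def)
  then show ?thesis
    using g f(2) unfolding graph_iso_def by (intro exI[of _ ?g]) auto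
qed

lemma graph_iso_trans:
  assumes "graph_iso G G'" "graph_iso G' G''"
  shows "graph_iso G G''"
proof -
  obtain f where f: "bij_betw f (verts G) (verts G')"
    "\<And>x y. x \<in> verts G \<Longrightarrow> y \<in> verts G \<Longrightarrow> {x, y} \<in> edges G \<longleftrightarrow> {f x, f y} \<in> edges G'"
    using assms(1) by (auto simp: graph_iso_def)
  obtain g where g: "bij_betw g (verts G') (verts G'')"
    "\<And>x y. x \<in> verts G' \<Longrightarrow> y \<in> verts G' \<Longrightarrow> {x, y} \<in> edges G' \<longleftrightarrow> {g x, g y} \<in> edges G''"
    using assms(2) by (auto simp: graph_iso_def)
  have "f x \<in> verts G'" if "x \<in> verts G" for x using f(1) that by (auto simp: bij_betw_def)
  then show ?thesis
    using f(2) g(2) bij_betw_trans[OF f(1) g(1)] unfolding graph_iso_def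
    by (intro exI[of _ "g \<circ> f"]) auto
qed

text \<open>The edges of a simple graph join vertices, so a path can be mapped edge by edge.\<close>

lemma graph_iso_connected:
  assumes "simple_graph G" "graph_iso G G'" "connected_graph G"
  shows "connected_graph G'"
proof -
  obtain f where f: "bij_betw f (verts G) (verts G')"
    "\<And>x y. x \<in> verts G \<Longrightarrow> y \<in> verts G \<Longrightarrow> {x, y} \<in> edges G \<longleftrightarrow> {f x, f y} \<in> edges G'"
    using assms(2) by (auto simp: graph_iso_def)
  have "(f x, f y) \<in> {(u, v). {u, v} \<in> edges G'}\<^sup>*" if "x \<in> verts G" "y \<in> verts G" for x y
  proof -
    have "(x, y) \<in> {(u, v). {u, v} \<in> edges G}\<^sup>*"
      using assms(3) that by (auto simp: connected_graph_def)
    then show ?thesis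
    proof induction
      case (step y z)
      then have "{f y, f z} \<in> edges G'"
        using simple_graph_edgeD[OF assms(1)] f(2) by blast
      with step.IH show ?case by (auto intro: rtrancl_into_rtrancl)
    qed simp
  qed
  moreover have "verts G' = f ` verts G" using f(1) by (auto simp: bij_betw_def)
  ultimately show ?thesis
    using assms(3) unfolding connected_graph_def by auto
qed

lemma graph_iso_card:
  assumes "simple_graph G" "simple_graph G'" "graph_iso G G'"
  shows "card (verts G) = card (verts G')" "card (edges G) = card (edges G')"
proof -
  obtain f where f: "bij_betw f (verts G) (verts G')"
    "\<And>x y. x \<in> verts G \<Longrightarrow> y \<in> verts G \<Longrightarrow> {x, y} \<in> edges G \<longleftrightarrow> {f x, f y} \<in> edges G'"
    using assms(3) by (auto simp: graph_iso_def)
  show "card (verts G) = card (verts G')" using f(1) by (rule bij_betw_same_card)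
  have "inj_on (image f) (edges G)"
    using inj_on_image_Pow[of f "verts G"] f(1) assms(1)
    by (auto simp: bij_betw_def simple_graph_def elim!: inj_on_subset)
  moreover have "image f ` edges G = edges G'"
  proof (intro equalityI subsetI)
    fix e assume "e \<in> image f ` edges G"
    then obtain x y where "e = f ` {x, y}" "{x, y} \<in> edges G" "x \<in> verts G" "y \<in> verts G"
      using assms(1) unfolding simple_graph_def by auto
    then show "e \<in> edges G'" using f(2) by auto
  next
    fix e assume e: "e \<in> edges G'"
    then obtain x' y' where x': "e = {x', y'}" "x' \<in> verts G'" "y' \<in> verts G'"
      using assms(2) unfolding simple_graph_def by auto
    then have "x' \<in> f ` verts G" "y' \<in> f ` verts G"
      using f(1) by (auto simp: bij_betw_def)
    then obtain x y where "x' = f x" "y' = f y" "x \<in> verts G" "y \<in> verts G"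
      by blast
    then have "{x, y} \<in> edges G" "e = f ` {x, y}" using f(2) x' e by auto
    then show "e \<in> image f ` edges G" by blast
  qed
  ultimately show "card (edges G) = card (edges G')"
    by (metis card_image)
qed

text \<open>Which entries coincide and which lie within distance \<open>t\<close> determines the graph up to
  isomorphism: the map \<open>xs ! i \<mapsto> ys ! i\<close> is then well defined and injective.\<close>

lemma geom_graph_iso_of_pattern:
  assumes len: "length xs = n" "length ys = n"
    and eq: "\<And>i j. i < n \<Longrightarrow> j < n \<Longrightarrow> xs ! i = xs ! j \<longleftrightarrow> ys ! i = ys ! j"
    and adj: "\<And>i j. i < n \<Longrightarrow> j < n \<Longrightarrow> dist (xs ! i) (xs ! j) \<le> t \<longleftrightarrow> dist (ys ! i) (ys ! j) \<le> t"
  shows "graph_iso (geom_graph (set xs) t) (geom_graph (set ys) t)"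
proof -
  define f where "f x = ys ! (SOME i. i < n \<and> xs ! i = x)" for x
  have f: "f (xs ! i) = ys ! i" if "i < n" for i
  proof -
    have "\<exists>l. l < n \<and> xs ! l = xs ! i" using that by blast
    from someI_ex[OF this] show ?thesis using eq that unfolding f_def by blast
  qed
  have X: "x \<in> set xs \<longleftrightarrow> (\<exists>i<n. x = xs ! i)" for x
    using len(1) by (auto simp: in_set_conv_nth)
  have Y: "set ys = {ys ! i |i. i < n}"
    using len(2) by (auto simp: set_conv_nth)
  have "bij_betw f (set xs) (set ys)"
    unfolding bij_betw_def
  proof
    show "inj_on f (set xs)" by (rule inj_onI) (auto simp: X f eq)
    show "f ` set xs = set ys" unfolding Y by (force simp: X f image_iff)
  qed
  moreover have "{x, y} \<in> edges (geom_graph (set xs) t) \<longleftrightarrow> {f x, f y} \<in> edges (geom_graph (set ys) t)"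
    if xy: "x \<in> set xs" "y \<in> set xs" for x y
  proof -
    obtain i j where ij: "i < n" "x = xs ! i" "j < n" "y = xs ! j" using xy X by blast
    then show ?thesis using len by (simp add: geom_graph_edge_iff f eq adj)
  qed
  ultimately show ?thesis unfolding graph_iso_def by auto
qed

text \<open>The edge relation consists of at most \<open>(card X)\<^sup>2\<close> pairs, and connected vertices are joined by
  a path with no more steps than that, each of length at most \<open>t\<close>.\<close>

lemma geom_graph_dist_le:
  fixes X :: "'a::metric_space set"
  assumes "connected_graph (geom_graph X t)" "finite X" "x \<in> X" "y \<in> X" "0 \<le> t"
  shows "dist x y \<le> real ((card X)\<^sup>2) * t"
proof -
  let ?R = "{(u, v). {u, v} \<in> edges (geom_graph X t)}"
  have sub: "?R \<subseteq> X \<times> X" by (auto simp: geom_graph_edge_iff)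
  then have fin: "finite ?R" using assms(2) by (auto intro: finite_subset)
  have card: "card ?R \<le> (card X)\<^sup>2"
    using card_mono[OF _ sub] assms(2) by (simp add: card_cartesian_product power2_eq_square)
  have path: "dist x y \<le> real n * t" if "(x, y) \<in> ?R ^^ n" for n x y
    using that
  proof (induction n arbitrary: y)
    case (Suc n)
    then obtain z where z: "(x, z) \<in> ?R ^^ n" "(z, y) \<in> ?R" by auto
    then have "dist z y \<le> t" by (auto simp: geom_graph_edge_iff)
    then show ?case
      using Suc.IH[OF z(1)] dist_triangle[of x y z] by (simp add: algebra_simps)
  qed simp
  have "(x, y) \<in> ?R\<^sup>*" using assms by (auto simp: connected_graph_def)
  then obtain n where n: "n \<le> card ?R" "(x, y) \<in> ?R ^^ n"
    using rtrancl_finite_eq_relpow[OF fin] by auto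
  have "dist x y \<le> real n * t" by (rule path[OF n(2)])
  also have "\<dots> \<le> real ((card X)\<^sup>2) * t"
    using n(1) card assms(5) by (intro mult_right_mono of_nat_mono) auto
  finally show ?thesis .
qed

lemma geom_graph_not_connected:
  assumes "2 \<le> card X" "t \<le> 0"
  shows "\<not> connected_graph (geom_graph X t)"
proof
  assume c: "connected_graph (geom_graph X t)"
  obtain x y where xy: "x \<in> X" "y \<in> X" "x \<noteq> y"
    using assms(1) by (metis card_le_Suc0_iff_eq card.infinite not_less_eq_eq numeral_2_eq_2 zero_le
        le_zero_eq nat.distinct(1))
  have "{(u, v). {u, v} \<in> edges (geom_graph X t)} = {}"
  proof (rule equals0I)
    fix p assume "p \<in> {(u, v). {u, v} \<in> edges (geom_graph X t)}"
    then have "fst p \<noteq> snd p" "dist (fst p) (snd p) \<le> t" by (auto simp: geom_graph_edge_iff)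
    then show False using assms(2) zero_less_dist_iff[of "fst p" "snd p"] by linarith
  qed
  moreover have "(x, y) \<in> {(u, v). {u, v} \<in> edges (geom_graph X t)}\<^sup>*"
    using c xy by (auto simp: connected_graph_def)
  ultimately show False using xy(3) by simp
qed

lemma geom_graph_eq_of_no_dist:
  assumes "s \<le> t" "\<And>x y. x \<in> X \<Longrightarrow> y \<in> X \<Longrightarrow> x \<noteq> y \<Longrightarrow> \<not> (s < dist x y \<and> dist x y \<le> t)"
  shows "geom_graph X s = geom_graph X t"
proof -
  have "dist x y \<le> s \<longleftrightarrow> dist x y \<le> t" if "x \<in> X" "y \<in> X" "x \<noteq> y" for x y
    using assms(2)[OF that] assms(1) by auto
  then have "{{x, y} |x y. x \<in> X \<and> y \<in> X \<and> x \<noteq> y \<and> dist x y \<le> s}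
      = {{x, y} |x y. x \<in> X \<and> y \<in> X \<and> x \<noteq> y \<and> dist x y \<le> t}"
    by (intro Collect_cong) (simp cong: conj_cong)
  then show ?thesis by (simp add: geom_graph_def)
qed

text \<open>The functions \<open>h_ind\<close>, \<open>h_minus\<close> and \<open>h_plus\<close> all have this form, which allows one treatment of the three.\<close>

definition graph_ind :: "('a::metric_space ugraph \<Rightarrow> bool) \<Rightarrow> real \<Rightarrow> 'a list \<Rightarrow> real" where
  "graph_ind P t xs = of_bool (P (geom_graph (set xs) t))"

locale graph_property =
  fixes P :: "'a::euclidean_space ugraph \<Rightarrow> bool" and k :: nat
  assumes k: "2 \<le> k"
    and iso: "\<And>G G'. simple_graph G \<Longrightarrow> simple_graph G' \<Longrightarrow> graph_iso G G' \<Longrightarrow> P G \<Longrightarrow> P G'"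
    and connected: "\<And>G. simple_graph G \<Longrightarrow> P G \<Longrightarrow> connected_graph G"
    and card_verts: "\<And>G. simple_graph G \<Longrightarrow> P G \<Longrightarrow> card (verts G) = k"
begin

lemma graph_ind_nonpos: "t \<le> 0 \<Longrightarrow> graph_ind P t xs = 0"
  using geom_graph_not_connected[of "set xs" t] k simple_graph_geom_graph[of "set xs" t]
    connected[of "geom_graph (set xs) t"] card_verts[of "geom_graph (set xs) t"]
  by (auto simp: graph_ind_def)

lemma graph_ind_dist_le:
  assumes "graph_ind P t xs \<noteq> 0" "t \<le> T" "x \<in> set xs" "y \<in> set xs"
  shows "dist x y \<le> real (k\<^sup>2) * T"
proof -
  have t: "0 < t" using graph_ind_nonpos[of t xs] assms(1) by force
  have P: "P (geom_graph (set xs) t)" using assms(1) by (simp add: graph_ind_def)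
  have s: "simple_graph (geom_graph (set xs) t)" by (rule simple_graph_geom_graph) simp
  have "dist x y \<le> real ((card (set xs))\<^sup>2) * t"
    using connected[OF s P] assms t by (intro geom_graph_dist_le) auto
  also have "card (set xs) = k" using card_verts[OF s P] by simp
  finally show ?thesis using assms(2) by (meson mult_left_mono of_nat_0_le_iff order_trans)
qed

text \<open>The graph changes between the thresholds \<open>s\<close> and \<open>t\<close> only through a pair at distance in \<open>(s, t]\<close>.  The graph having
  the property at one of the two thresholds is connected, which bounds its vertices because one of them is the origin.\<close>

lemma graph_ind_diff_le:
  assumes "s \<le> t" "t \<le> T" "0 \<in> set xs"
  shows "\<bar>graph_ind P t xs - graph_ind P s xs\<bar>
    \<le> of_bool ((\<forall>x\<in>set xs. norm x \<le> real (k\<^sup>2) * T) \<and>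
         (\<exists>x\<in>set xs. \<exists>y\<in>set xs. x \<noteq> y \<and> s < dist x y \<and> dist x y \<le> t))"
proof (cases "graph_ind P t xs = graph_ind P s xs")
  case False
  then have "graph_ind P t xs \<noteq> 0 \<or> graph_ind P s xs \<noteq> 0" by auto
  then have "dist x 0 \<le> real (k\<^sup>2) * T" if "x \<in> set xs" for x
    using graph_ind_dist_le[of t xs T x 0] graph_ind_dist_le[of s xs T x 0] assms that by auto
  moreover have "\<exists>x\<in>set xs. \<exists>y\<in>set xs. x \<noteq> y \<and> s < dist x y \<and> dist x y \<le> t"
  proof (rule ccontr)
    assume "\<not> ?thesis"
    then have "geom_graph (set xs) s = geom_graph (set xs) t"
      by (intro geom_graph_eq_of_no_dist[OF assms(1)]) auto
    with False show False by (simp add: graph_ind_def)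
  qed
  ultimately show ?thesis by (auto simp: graph_ind_def)
qed simp

text \<open>The indicator depends only on the finite pattern \<open>(E, Q)\<close> of adjacencies and coincidences; coincidence is
  adjacency at threshold \<open>0\<close>.  The event is the finite union of the events of having one of
  the admissible patterns, each given by finitely many inequalities between distances.\<close>

lemma graph_ind_measurable:
  fixes xs :: "'b \<Rightarrow> 'a list"
  assumes len: "\<And>w. length (xs w) = n"
    and [measurable]: "\<And>i. i < n \<Longrightarrow> (\<lambda>w. xs w ! i) \<in> borel_measurable N"
  shows "(\<lambda>w. graph_ind P t (xs w)) \<in> borel_measurable N"
proof -
  define E where "E w = {(i, j) \<in> {..<n} \<times> {..<n}. dist (xs w ! i) (xs w ! j) \<le> t}" for w
  define Q where "Q w = {(i, j) \<in> {..<n} \<times> {..<n}. dist (xs w ! i) (xs w ! j) \<le> 0}" for w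
  define S where "S = (\<lambda>w. (E w, Q w)) ` {w. P (geom_graph (set (xs w)) t)}"
  have "S \<subseteq> Pow ({..<n} \<times> {..<n}) \<times> Pow ({..<n} \<times> {..<n})"
    by (auto simp: S_def E_def Q_def)
  then have S: "finite S" by (rule finite_subset) simp
  have "P (geom_graph (set (xs w)) t) \<longleftrightarrow> (E w, Q w) \<in> S" for w
  proof
    assume "(E w, Q w) \<in> S"
    then obtain v where v: "P (geom_graph (set (xs v)) t)" "E w = E v" "Q w = Q v"
      by (auto simp: S_def)
    have adj: "dist (xs v ! i) (xs v ! j) \<le> t \<longleftrightarrow> dist (xs w ! i) (xs w ! j) \<le> t"
      and eq: "xs v ! i = xs v ! j \<longleftrightarrow> xs w ! i = xs w ! j" if "i < n" "j < n" for i j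
    proof -
      have "(i, j) \<in> E v \<longleftrightarrow> (i, j) \<in> E w" "(i, j) \<in> Q v \<longleftrightarrow> (i, j) \<in> Q w" using v by auto
      then show "dist (xs v ! i) (xs v ! j) \<le> t \<longleftrightarrow> dist (xs w ! i) (xs w ! j) \<le> t"
        "xs v ! i = xs v ! j \<longleftrightarrow> xs w ! i = xs w ! j"
        using that by (auto simp: E_def Q_def)
    qed
    have "graph_iso (geom_graph (set (xs v)) t) (geom_graph (set (xs w)) t)"
      by (rule geom_graph_iso_of_pattern[OF len len]) (simp_all add: adj eq)
    then show "P (geom_graph (set (xs w)) t)"
      using iso v(1) simple_graph_geom_graph by (metis List.finite_set)
  qed (auto simp: S_def)
  then have "{w \<in> space N. P (geom_graph (set (xs w)) t)} = (\<Union>p\<in>S. {w \<in> space N. E w = fst p \<and> Q w = snd p})"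
    by auto
  also have "\<dots> = (\<Union>p\<in>S. {w \<in> space N. \<forall>q\<in>{..<n} \<times> {..<n}.
      (q \<in> fst p \<longleftrightarrow> dist (xs w ! fst q) (xs w ! snd q) \<le> t) \<and>
      (q \<in> snd p \<longleftrightarrow> dist (xs w ! fst q) (xs w ! snd q) \<le> 0)})"
  proof (intro SUP_cong refl Collect_cong conj_cong)
    fix p w assume "p \<in> S"
    then have "fst p \<subseteq> {..<n} \<times> {..<n}" "snd p \<subseteq> {..<n} \<times> {..<n}"
      by (auto simp: S_def E_def Q_def)
    then show "E w = fst p \<and> Q w = snd p \<longleftrightarrow> (\<forall>q\<in>{..<n} \<times> {..<n}.
      (q \<in> fst p \<longleftrightarrow> dist (xs w ! fst q) (xs w ! snd q) \<le> t) \<and>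
      (q \<in> snd p \<longleftrightarrow> dist (xs w ! fst q) (xs w ! snd q) \<le> 0))"
      unfolding E_def Q_def set_eq_iff by fastforce
  qed
  also have "\<dots> \<in> sets N"
  proof (intro sets.finite_UN S)
    fix p assume "p \<in> S"
    have "Measurable.pred N (\<lambda>w. \<forall>q\<in>{..<n} \<times> {..<n}.
      (q \<in> fst p \<longleftrightarrow> dist (xs w ! fst q) (xs w ! snd q) \<le> t) \<and>
      (q \<in> snd p \<longleftrightarrow> dist (xs w ! fst q) (xs w ! snd q) \<le> 0))"
    proof (rule pred_intros_finite(3))
      fix q assume "q \<in> {..<n} \<times> {..<n}"
      then have [measurable]: "(\<lambda>w. xs w ! fst q) \<in> borel_measurable N" "(\<lambda>w. xs w ! snd q) \<in> borel_measurable N"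
        using assms(2) by auto
      show "Measurable.pred N (\<lambda>w. (q \<in> fst p \<longleftrightarrow> dist (xs w ! fst q) (xs w ! snd q) \<le> t) \<and>
        (q \<in> snd p \<longleftrightarrow> dist (xs w ! fst q) (xs w ! snd q) \<le> 0))"
        by measurable
    qed simp
    then show "{w \<in> space N. \<forall>q\<in>{..<n} \<times> {..<n}.
      (q \<in> fst p \<longleftrightarrow> dist (xs w ! fst q) (xs w ! snd q) \<le> t) \<and>
      (q \<in> snd p \<longleftrightarrow> dist (xs w ! fst q) (xs w ! snd q) \<le> 0)} \<in> sets N"
      by (simp add: pred_def)
  qed
  finally have [measurable]: "Measurable.pred N (\<lambda>w. P (geom_graph (set (xs w)) t))"
    by (simp add: pred_def)
  show ?thesis unfolding graph_ind_def by measurable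
qed

end

lemma h_ind_eq_graph_ind: "h_ind \<Gamma> = graph_ind (\<lambda>G. graph_iso G \<Gamma>)"
  by (simp add: h_ind_def graph_ind_def fun_eq_iff)

text \<open>The property that \<open>h_minus\<close> indicates, and the alternative to being a copy of \<open>\<Gamma>\<close> in \<open>h_plus\<close>.\<close>

definition denser :: "'v ugraph \<Rightarrow> 'a ugraph \<Rightarrow> bool" where
  "denser \<Gamma> G \<longleftrightarrow> connected_graph G \<and> card (verts G) = card (verts \<Gamma>) \<and> card (edges \<Gamma>) < card (edges G)"

lemma h_minus_eq_graph_ind: "h_minus \<Gamma> = graph_ind (denser \<Gamma>)"
  by (simp add: h_minus_def graph_ind_def denser_def fun_eq_iff)

text \<open>The sum of the two indicators is again an indicator since isomorphic graphs have equally many edges.\<close>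

lemma h_plus_eq_graph_ind:
  assumes "simple_graph \<Gamma>"
  shows "(h_plus \<Gamma> :: real \<Rightarrow> 'a::metric_space list \<Rightarrow> real) = graph_ind (\<lambda>G. graph_iso G \<Gamma> \<or> denser \<Gamma> G)"
proof (intro ext)
  fix t and xs :: "'a list"
  have "\<not> (graph_iso (geom_graph (set xs) t) \<Gamma> \<and> denser \<Gamma> (geom_graph (set xs) t))"
    using graph_iso_card(2)[OF simple_graph_geom_graph[OF finite_set[of xs], of t] assms]
    by (auto simp: denser_def)
  then show "h_plus \<Gamma> t xs = graph_ind (\<lambda>G. graph_iso G \<Gamma> \<or> denser \<Gamma> G) t xs"
    unfolding h_plus_def h_ind_eq_graph_ind h_minus_eq_graph_ind by (auto simp: graph_ind_def)
qed

lemma graph_property_iso: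
  assumes "2 \<le> card (verts \<Gamma>)" "simple_graph \<Gamma>" "connected_graph \<Gamma>"
  shows "graph_property (\<lambda>G :: 'a::euclidean_space ugraph. graph_iso G \<Gamma>) (card (verts \<Gamma>))"
proof
  fix G :: "'a ugraph" assume G: "simple_graph G" "graph_iso G \<Gamma>"
  show "connected_graph G" by (rule graph_iso_connected[OF assms(2) graph_iso_sym[OF G(2)] assms(3)])
  show "card (verts G) = card (verts \<Gamma>)" by (rule graph_iso_card(1)[OF G(1) assms(2) G(2)])
qed (use assms(1) in \<open>auto intro: graph_iso_trans graph_iso_sym\<close>)

lemma graph_property_denser:
  assumes "2 \<le> card (verts \<Gamma>)"
  shows "graph_property (denser \<Gamma> :: 'a::euclidean_space ugraph \<Rightarrow> bool) (card (verts \<Gamma>))"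
proof
  fix G G' :: "'a ugraph" assume "simple_graph G" "simple_graph G'" "graph_iso G G'" "denser \<Gamma> G"
  then show "denser \<Gamma> G'"
    using graph_iso_card[of G G'] graph_iso_connected[of G G'] by (auto simp: denser_def)
qed (use assms in \<open>auto simp: denser_def\<close>)

lemma graph_property_disj:
  assumes "graph_property P k" "graph_property Q k"
  shows "graph_property (\<lambda>G. P G \<or> Q G) k"
  using assms unfolding graph_property_def by blast

lemma geom_graph_edges_mono:
  assumes "finite X" "s \<le> t"
  shows "edges (geom_graph X s) \<subseteq> edges (geom_graph X t)" "finite (edges (geom_graph X t))"
proof -
  show "edges (geom_graph X s) \<subseteq> edges (geom_graph X t)"
    using assms(2) by (fastforce simp: geom_graph_def)
  have "edges (geom_graph X t) \<subseteq> Pow X" by (auto simp: geom_graph_def)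
  then show "finite (edges (geom_graph X t))" using assms(1) by (auto intro: finite_subset)
qed

lemma connected_graph_mono:
  assumes "connected_graph G" "verts G = verts G'" "edges G \<subseteq> edges G'"
  shows "connected_graph G'"
proof -
  have "{(u, v). {u, v} \<in> edges G}\<^sup>* \<subseteq> {(u, v). {u, v} \<in> edges G'}\<^sup>*"
    using assms(3) by (intro rtrancl_mono) auto
  then show ?thesis using assms(1,2) unfolding connected_graph_def by blast
qed

lemma denser_mono:
  assumes "denser \<Gamma> (geom_graph X s)" "finite X" "s \<le> t"
  shows "denser \<Gamma> (geom_graph X t)"
  using assms(1) connected_graph_mono[of "geom_graph X s" "geom_graph X t"]
    geom_graph_edges_mono[OF assms(2,3)] card_mono[OF geom_graph_edges_mono(2,1)[OF assms(2,3)]]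
  by (auto simp: denser_def)

text \<open>A copy of \<open>\<Gamma>\<close> can be lost only by gaining an edge, and then the graph, still connected, has become denser
  than \<open>\<Gamma>\<close>.\<close>

lemma iso_or_denser_mono:
  assumes \<Gamma>: "simple_graph \<Gamma>" "connected_graph \<Gamma>"
    and G: "graph_iso (geom_graph X s) \<Gamma> \<or> denser \<Gamma> (geom_graph X s)" and X: "finite X" and st: "s \<le> t"
  shows "graph_iso (geom_graph X t) \<Gamma> \<or> denser \<Gamma> (geom_graph X t)"
proof (cases "edges (geom_graph X s) = edges (geom_graph X t)")
  case True
  then have "geom_graph X s = geom_graph X t" by (simp add: geom_graph_def)
  then show ?thesis using G by simp
next
  case False
  show ?thesis using G
  proof
    assume iso: "graph_iso (geom_graph X s) \<Gamma>"
    note s = simple_graph_geom_graph[OF X, of s]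
    have "card (edges (geom_graph X s)) < card (edges (geom_graph X t))"
      using False geom_graph_edges_mono[OF X st] by (intro psubset_card_mono) auto
    moreover have "connected_graph (geom_graph X s)"
      by (rule graph_iso_connected[OF \<Gamma>(1) graph_iso_sym[OF iso] \<Gamma>(2)])
    then have "connected_graph (geom_graph X t)"
      by (rule connected_graph_mono) (use geom_graph_edges_mono[OF X st] in auto)
    ultimately show ?thesis
      using graph_iso_card[OF s \<Gamma>(1) iso] by (simp add: denser_def)
  qed (use denser_mono X st in blast)
qed

section \<open>Volume of configurations with a prescribed distance\<close>

lemma power_diff_le_mult:
  fixes s t T :: real
  assumes "0 \<le> s" "s \<le> t" "t \<le> T"
  shows "t ^ n - s ^ n \<le> real n * T ^ (n - 1) * (t - s)"
proof -
  have "(\<Sum>i<n. s ^ (n - Suc i) * t ^ i) \<le> (\<Sum>i<n. T ^ (n - 1))"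
  proof (intro sum_mono)
    fix i assume i: "i \<in> {..<n}"
    have "s ^ (n - Suc i) * t ^ i \<le> T ^ (n - Suc i) * T ^ i"
      using assms by (intro mult_mono power_mono) auto
    also have "\<dots> = T ^ (n - 1)" using i by (simp add: power_add[symmetric])
    finally show "s ^ (n - Suc i) * t ^ i \<le> T ^ (n - 1)" .
  qed
  then have "(t - s) * (\<Sum>i<n. s ^ (n - Suc i) * t ^ i) \<le> (t - s) * (real n * T ^ (n - 1))"
    using assms by (intro mult_left_mono) auto
  moreover have "t ^ n - s ^ n = (t - s) * (\<Sum>i<n. s ^ (n - Suc i) * t ^ i)"
    by (rule power_diff_sumr2)
  ultimately show ?thesis by (simp add: mult_ac)
qed

text \<open>A Lipschitz constant on \<open>[0, T]\<close> of the volume of a ball as a function of its radius.\<close>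

definition shell_const :: "'a::euclidean_space itself \<Rightarrow> real \<Rightarrow> real" where
  "shell_const _ T = unit_ball_vol DIM('a) * (real DIM('a) * T ^ (DIM('a) - 1))"

lemma emeasure_shell_le:
  fixes p :: "'a::euclidean_space"
  assumes "0 \<le> s" "s \<le> t" "t \<le> T"
  shows "emeasure lborel {x. s < dist p x \<and> dist p x \<le> t} \<le> ennreal (shell_const TYPE('a) T * (t - s))"
proof -
  have eq: "{x. s < dist p x \<and> dist p x \<le> t} = cball p t - cball p s" by auto
  have "emeasure lborel (cball p t - cball p s) = emeasure lborel (cball p t) - emeasure lborel (cball p s)"
    using assms by (intro emeasure_Diff) (auto simp: emeasure_cball)
  also have "\<dots> = ennreal (unit_ball_vol DIM('a) * t ^ DIM('a) - unit_ball_vol DIM('a) * s ^ DIM('a))"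
    using assms by (simp add: emeasure_cball ennreal_minus)
  also have "unit_ball_vol DIM('a) * t ^ DIM('a) - unit_ball_vol DIM('a) * s ^ DIM('a)
      = unit_ball_vol DIM('a) * (t ^ DIM('a) - s ^ DIM('a))"
    by (simp add: algebra_simps)
  also have "\<dots> \<le> unit_ball_vol DIM('a) * (real DIM('a) * T ^ (DIM('a) - 1) * (t - s))"
    using assms by (intro mult_left_mono power_diff_le_mult) auto
  finally show ?thesis by (simp add: eq shell_const_def mult.assoc ennreal_leI)
qed

lemma sigma_finite_PiM_lborel:
  "finite I \<Longrightarrow> sigma_finite_measure (Pi\<^sub>M I (\<lambda>_. lborel :: 'a::euclidean_space measure))"
  by (rule product_sigma_finite.sigma_finite) (simp add: product_sigma_finite_def lborel.sigma_finite_measure_axioms)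

definition config_box :: "'i set \<Rightarrow> real \<Rightarrow> ('i \<Rightarrow> 'a::euclidean_space) set" where
  "config_box I R = {z \<in> space (Pi\<^sub>M I (\<lambda>_. lborel)). \<forall>j\<in>I. norm (z j) \<le> R}"

lemma config_box_eq_PiE: "config_box I R = Pi\<^sub>E I (\<lambda>_. cball 0 R)"
  by (auto simp: config_box_def space_PiM PiE_iff extensional_def)

lemma config_box_sets [measurable]:
  "finite I \<Longrightarrow> config_box I R \<in> sets (Pi\<^sub>M I (\<lambda>_. lborel :: 'a::euclidean_space measure))"
  unfolding config_box_eq_PiE by (rule sets_PiM_I_finite) auto

lemma emeasure_config_box:
  assumes "finite I" "0 \<le> R"
  shows "emeasure (Pi\<^sub>M I (\<lambda>_. lborel)) (config_box I R :: ('i \<Rightarrow> 'a::euclidean_space) set)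
    = ennreal ((unit_ball_vol DIM('a) * R ^ DIM('a)) ^ card I)"
proof -
  interpret product_sigma_finite "\<lambda>_::'i. lborel :: 'a measure"
    by (simp add: product_sigma_finite_def lborel.sigma_finite_measure_axioms)
  show ?thesis
    unfolding config_box_eq_PiE
    by (subst emeasure_PiM) (use assms in \<open>auto simp: emeasure_cball ennreal_power\<close>)
qed

definition shell_config ::
    "'i set \<Rightarrow> real \<Rightarrow> real \<Rightarrow> real \<Rightarrow> 'i \<Rightarrow> (('i \<Rightarrow> 'a) \<Rightarrow> 'a) \<Rightarrow> ('i \<Rightarrow> 'a::euclidean_space) set" where
  "shell_config I R s t i p = {z \<in> space (Pi\<^sub>M I (\<lambda>_. lborel)).
     (\<forall>j\<in>I. norm (z j) \<le> R) \<and> s < dist (p z) (z i) \<and> dist (p z) (z i) \<le> t}"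

lemma shell_config_sets:
  assumes I: "finite I" "i \<in> I" and [measurable]: "p \<in> borel_measurable (Pi\<^sub>M I (\<lambda>_. lborel))"
  shows "shell_config I R s t i p \<in> sets (Pi\<^sub>M I (\<lambda>_. lborel :: 'a::euclidean_space measure))"
proof -
  have [measurable]: "(\<lambda>z. z i) \<in> borel_measurable (Pi\<^sub>M I (\<lambda>_. lborel :: 'a measure))"
    using measurable_component_singleton[OF I(2), of "\<lambda>_. lborel :: 'a measure"] by simp
  have "shell_config I R s t i p = config_box I R \<inter>
      {z \<in> space (Pi\<^sub>M I (\<lambda>_. lborel)). s < dist (p z) (z i) \<and> dist (p z) (z i) \<le> t}"
    by (auto simp: shell_config_def config_box_def)
  also have "\<dots> \<in> sets (Pi\<^sub>M I (\<lambda>_. lborel))"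
  proof (rule sets.Int)
    show "config_box I R \<in> sets (Pi\<^sub>M I (\<lambda>_. lborel :: 'a measure))"
      by (rule config_box_sets[OF I(1)])
    show "{z \<in> space (Pi\<^sub>M I (\<lambda>_. lborel)). s < dist (p z) (z i) \<and> dist (p z) (z i) \<le> t}
        \<in> sets (Pi\<^sub>M I (\<lambda>_. lborel :: 'a measure))"
      by measurable
  qed
  finally show ?thesis .
qed

text \<open>Integrate over the coordinate \<open>i\<close> first: with the others fixed, the point \<open>p z\<close> is fixed too, and \<open>z i\<close>
  is confined to a shell around it.  The other coordinates contribute the volume of their balls.\<close>

lemma emeasure_shell_config_le:
  fixes p :: "('i \<Rightarrow> 'a::euclidean_space) \<Rightarrow> 'a"
  assumes I: "finite I" "i \<in> I" and p: "p \<in> borel_measurable (Pi\<^sub>M I (\<lambda>_. lborel))"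
    and indep: "\<And>z x. p (z(i := x)) = p z"
    and st: "0 \<le> s" "s \<le> t" "t \<le> T" and R: "0 \<le> R"
  shows "emeasure (Pi\<^sub>M I (\<lambda>_. lborel)) (shell_config I R s t i p)
    \<le> ennreal ((unit_ball_vol DIM('a) * R ^ DIM('a)) ^ (card I - 1) * (shell_const TYPE('a) T * (t - s)))"
proof -
  interpret product_sigma_finite "\<lambda>_::'i. lborel :: 'a measure"
    by (simp add: product_sigma_finite_def lborel.sigma_finite_measure_axioms)
  define J where "J = I - {i}"
  have J: "finite J" "i \<notin> J" "I = insert i J" using I by (auto simp: J_def)
  let ?S = "shell_config I R s t i p"
  let ?sh = "ennreal (shell_const TYPE('a) T * (t - s))"
  have S: "?S \<in> sets (Pi\<^sub>M I (\<lambda>_. lborel))" by (rule shell_config_sets[OF I p])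
  have "emeasure (Pi\<^sub>M I (\<lambda>_. lborel)) ?S = (\<integral>\<^sup>+z. indicator ?S z \<partial>Pi\<^sub>M I (\<lambda>_. lborel))"
    using S by simp
  also have "\<dots> = (\<integral>\<^sup>+z. (\<integral>\<^sup>+x. indicator ?S (z(i := x)) \<partial>lborel) \<partial>Pi\<^sub>M J (\<lambda>_. lborel))"
    unfolding J(3) by (rule product_nn_integral_insert[OF J(1,2)]) (use S J(3) in auto)
  also have "\<dots> \<le> (\<integral>\<^sup>+z. ?sh * indicator (config_box J R) z \<partial>Pi\<^sub>M J (\<lambda>_. lborel :: 'a measure))"
  proof (rule nn_integral_mono)
    fix z assume z: "z \<in> space (Pi\<^sub>M J (\<lambda>_. lborel :: 'a measure))"
    show "(\<integral>\<^sup>+x. indicator ?S (z(i := x)) \<partial>lborel) \<le> ?sh * indicator (config_box J R) z"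
    proof (cases "z \<in> config_box J R")
      case True
      have "(\<integral>\<^sup>+x. indicator ?S (z(i := x)) \<partial>lborel)
          \<le> (\<integral>\<^sup>+x. indicator {x. s < dist (p z) x \<and> dist (p z) x \<le> t} x \<partial>lborel)"
        by (intro nn_integral_mono) (auto simp: shell_config_def indep indicator_def)
      also have "\<dots> = emeasure lborel {x. s < dist (p z) x \<and> dist (p z) x \<le> t}"
        by (rule nn_integral_indicator) measurable
      also have "\<dots> \<le> ?sh" by (rule emeasure_shell_le[OF st])
      finally show ?thesis using True by simp
    next
      case False
      then obtain j where j: "j \<in> J" "\<not> norm (z j) \<le> R"
        using z by (auto simp: config_box_def)
      then have "j \<in> I" "(z(i := x)) j = z j" for x using J by auto
      with j(2) have "z(i := x) \<notin> ?S" for x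
        unfolding shell_config_def by (metis (mono_tags, lifting) mem_Collect_eq)
      then show ?thesis by simp
    qed
  qed
  also have "\<dots> = ?sh * ennreal ((unit_ball_vol DIM('a) * R ^ DIM('a)) ^ card J)"
    by (subst nn_integral_cmult_indicator[OF config_box_sets[OF J(1)]]) (simp only: emeasure_config_box[OF J(1) R])
  also have "\<dots> = ennreal ((unit_ball_vol DIM('a) * R ^ DIM('a)) ^ (card I - 1) * (shell_const TYPE('a) T * (t - s)))"
    using st R I by (simp add: ennreal_mult'[symmetric] J_def shell_const_def mult_ac)
  finally show ?thesis .
qed

definition close_config ::
    "'i set \<Rightarrow> 'a set \<Rightarrow> real \<Rightarrow> real \<Rightarrow> real \<Rightarrow> ('i \<Rightarrow> 'a::euclidean_space) set" where
  "close_config I Q R s t =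
     (\<Union>i\<in>I. (\<Union>q\<in>Q. shell_config I R s t i (\<lambda>_. q)) \<union> (\<Union>j\<in>I - {i}. shell_config I R s t i (\<lambda>z. z j)))"

lemma close_config_sets:
  assumes "finite I" "finite Q"
  shows "close_config I Q R s t \<in> sets (Pi\<^sub>M I (\<lambda>_. lborel :: 'a::euclidean_space measure))"
  unfolding close_config_def
proof (intro sets.finite_UN sets.Un assms finite_Diff shell_config_sets)
  fix i j assume "j \<in> I - {i}"
  then show "(\<lambda>z. z j) \<in> borel_measurable (Pi\<^sub>M I (\<lambda>_. lborel :: 'a measure))"
    using measurable_component_singleton[of j I "\<lambda>_. lborel :: 'a measure"] by simp
qed auto

definition close_const :: "'a::euclidean_space itself \<Rightarrow> nat \<Rightarrow> nat \<Rightarrow> real \<Rightarrow> real \<Rightarrow> real" where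
  "close_const a n m R T = real (n * (m + n)) * ((unit_ball_vol DIM('a) * R ^ DIM('a)) ^ (n - 1) * shell_const a T)"

lemma close_const_nonneg: "0 \<le> R \<Longrightarrow> 0 \<le> T \<Longrightarrow> 0 \<le> close_const TYPE('a::euclidean_space) n m R T"
  by (simp add: close_const_def shell_const_def)

lemma emeasure_close_config_le:
  fixes Q :: "'a::euclidean_space set"
  assumes I: "finite I" and Q: "finite Q" "card Q \<le> m"
    and st: "0 \<le> s" "s \<le> t" "t \<le> T" and R: "0 \<le> R"
  shows "emeasure (Pi\<^sub>M I (\<lambda>_. lborel)) (close_config I Q R s t) \<le> ennreal (close_const TYPE('a) (card I) m R T * (t - s))"
proof -
  let ?M = "Pi\<^sub>M I (\<lambda>_. lborel :: 'a measure)"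
  let ?b = "(unit_ball_vol DIM('a) * R ^ DIM('a)) ^ (card I - 1) * (shell_const TYPE('a) T * (t - s))"
  have b: "0 \<le> ?b" using st R by (simp add: shell_const_def)
  have comp: "(\<lambda>z. z j) \<in> borel_measurable ?M" if "j \<in> I" for j
    using measurable_component_singleton[OF that, of "\<lambda>_. lborel :: 'a measure"] by simp
  have 1: "emeasure ?M (\<Union>q\<in>Q. shell_config I R s t i (\<lambda>_. q)) \<le> ennreal (real m * ?b)" if i: "i \<in> I" for i
  proof -
    have "emeasure ?M (\<Union>q\<in>Q. shell_config I R s t i (\<lambda>_. q)) \<le> (\<Sum>q\<in>Q. emeasure ?M (shell_config I R s t i (\<lambda>_. q)))"
      using Q(1) shell_config_sets[OF I i borel_measurable_const] by (intro emeasure_subadditive_finite) auto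
    also have "\<dots> \<le> (\<Sum>q\<in>Q. ennreal ?b)"
      by (intro sum_mono emeasure_shell_config_le[OF I i _ _ st R]) auto
    also have "\<dots> = ennreal (real (card Q) * ?b)"
      using b by (subst sum_ennreal) auto
    also have "\<dots> \<le> ennreal (real m * ?b)"
      using Q(2) b by (intro ennreal_leI mult_right_mono) auto
    finally show ?thesis .
  qed
  have 2: "emeasure ?M (\<Union>j\<in>I - {i}. shell_config I R s t i (\<lambda>z. z j)) \<le> ennreal (real (card I) * ?b)" if i: "i \<in> I" for i
  proof -
    have "emeasure ?M (\<Union>j\<in>I - {i}. shell_config I R s t i (\<lambda>z. z j))
        \<le> (\<Sum>j\<in>I - {i}. emeasure ?M (shell_config I R s t i (\<lambda>z. z j)))"
      using I shell_config_sets[OF I i comp] by (intro emeasure_subadditive_finite) auto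
    also have "\<dots> \<le> (\<Sum>j\<in>I - {i}. ennreal ?b)"
      by (intro sum_mono emeasure_shell_config_le[OF I i _ _ st R] comp) auto
    also have "\<dots> = ennreal (real (card (I - {i})) * ?b)"
      using b by (subst sum_ennreal) auto
    also have "\<dots> \<le> ennreal (real (card I) * ?b)"
      using I b by (intro ennreal_leI mult_right_mono of_nat_mono card_mono) auto
    finally show ?thesis .
  qed
  let ?A = "\<lambda>i. \<Union>q\<in>Q. shell_config I R s t i (\<lambda>_. q)" and ?B = "\<lambda>i. \<Union>j\<in>I - {i}. shell_config I R s t i (\<lambda>z. z j)"
  have sets: "?A i \<in> sets ?M" "?B i \<in> sets ?M" if "i \<in> I" for i
    using I Q(1) that comp by (auto intro!: sets.finite_UN shell_config_sets)
  have "emeasure ?M (close_config I Q R s t) \<le> (\<Sum>i\<in>I. emeasure ?M (?A i \<union> ?B i))"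
    unfolding close_config_def using sets by (intro emeasure_subadditive_finite I) auto
  also have "\<dots> \<le> (\<Sum>i\<in>I. ennreal (real (m + card I) * ?b))"
  proof (rule sum_mono)
    fix i assume i: "i \<in> I"
    have "emeasure ?M (?A i \<union> ?B i) \<le> emeasure ?M (?A i) + emeasure ?M (?B i)"
      using sets[OF i] by (rule emeasure_subadditive)
    also have "\<dots> \<le> ennreal (real m * ?b) + ennreal (real (card I) * ?b)"
      by (intro add_mono 1 2 i)
    also have "\<dots> = ennreal (real (m + card I) * ?b)"
      using b by (subst ennreal_plus[symmetric]) (auto simp: distrib_right)
    finally show "emeasure ?M (?A i \<union> ?B i) \<le> ennreal (real (m + card I) * ?b)" .
  qed
  also have "\<dots> = ennreal (real (card I) * (real (m + card I) * ?b))"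
    using b by (subst sum_ennreal) auto
  finally show ?thesis by (simp add: close_const_def mult_ac)
qed

section \<open>The curve of integrands\<close>

lemma D_const_nonneg: "0 \<le> D_const TYPE('d::finite) k l"
  by (simp add: D_const_def sphere_area_def)

text \<open>The variables \<open>y\<close> of the noise and the variables \<open>z\<close> that are integrated out are kept in the separate product spaces
  \<open>Y\<close> and \<open>Z\<close>, and \<open>pts y z\<close> is the list of all \<open>k\<close> points.  On bounded sets the exponential tilt in
  \<open>mu\<close> is bounded whatever \<open>e\<close> and \<open>r\<close> are, so they stay arbitrary here.\<close>

locale limit_integrand = graph_property P k
  for P :: "(real^'d::finite) ugraph \<Rightarrow> bool" and k :: nat +
  fixes e :: "real^'d" and r :: real and l :: nat
  assumes l: "1 \<le> l" "l \<le> k"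
begin

abbreviation Y :: "(nat \<Rightarrow> real^'d) measure" where "Y \<equiv> Pi\<^sub>M {1..l-1} (\<lambda>_. lborel)"
abbreviation Z :: "(nat \<Rightarrow> real^'d) measure" where "Z \<equiv> Pi\<^sub>M {1..k-l} (\<lambda>_. lborel)"
abbreviation base :: "(real \<times> (nat \<Rightarrow> real^'d)) measure" where
  "base \<equiv> restrict_space lborel {0..} \<Otimes>\<^sub>M Y"
abbreviation f :: "real \<Rightarrow> real \<times> (nat \<Rightarrow> real^'d) \<Rightarrow> real" where
  "f t \<equiv> W_integrand e r k (graph_ind P) l t"

definition pts :: "(nat \<Rightarrow> real^'d) \<Rightarrow> (nat \<Rightarrow> real^'d) \<Rightarrow> (real^'d) list" where
  "pts y z = 0 # map y [1..<l] @ map z [1..<k-l+1]"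

definition weight :: "real \<Rightarrow> (nat \<Rightarrow> real^'d) \<Rightarrow> real" where
  "weight \<rho> z = exp (- (\<Sum>i=1..k-l. \<rho> + r * (e \<bullet> z i))) * of_bool (\<forall>i\<in>{1..k-l}. 0 \<le> \<rho> + r * (e \<bullet> z i))"

lemma f_eq: "f t (\<rho>, y) = (\<integral>z. weight \<rho> z * graph_ind P t (pts y z) \<partial>Z)"
  by (simp add: W_integrand_def weight_def pts_def)

lemma set_pts: "set (pts y z) = insert 0 (y ` {1..l-1} \<union> z ` {1..k-l})"
proof -
  have "{1..<l} = {1..l-1}" "{1..<k-l+1} = {1..k-l}" using l by auto
  then show ?thesis
    by (simp only: pts_def list.set set_append set_map set_upt)
qed

lemma pts_measurable:
  assumes y: "\<And>i. i \<in> {1..l-1} \<Longrightarrow> (\<lambda>w. y w i) \<in> borel_measurable N"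
    and z: "\<And>i. i \<in> {1..k-l} \<Longrightarrow> (\<lambda>w. z w i) \<in> borel_measurable N"
  shows "(\<lambda>w. graph_ind P t (pts (y w) (z w))) \<in> borel_measurable N"
proof (rule graph_ind_measurable[where n=k])
  show "length (pts (y w) (z w)) = k" for w using l by (simp add: pts_def) linarith
  fix i assume i: "i < k"
  consider "i = 0" | "0 < i" "i < l" | "l \<le> i" by linarith
  then show "(\<lambda>w. pts (y w) (z w) ! i) \<in> borel_measurable N"
  proof cases
    case 2
    then have "i - 1 < l - 1" by linarith
    with 2 have "pts (y w) (z w) ! i = y w i" for w
      by (simp add: pts_def nth_Cons' nth_append)
    then show ?thesis using y[of i] 2 by simp
  next
    case 3
    have "pts (y w) (z w) ! i = z w (1 + (i - l))" for w
    proof -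
      have "pts (y w) (z w) ! i = ((0 # map (y w) [1..<l]) @ map (z w) [1..<k-l+1]) ! i"
        by (simp add: pts_def)
      also have "\<dots> = map (z w) [1..<k-l+1] ! (i - l)"
        using 3 l by (simp add: nth_append del: append_Cons)
      also have "\<dots> = z w (1 + (i - l))"
        using 3 i by (intro nth_map_upt) simp
      finally show ?thesis .
    qed
    then show ?thesis using z[of "1 + (i - l)"] 3 i by simp
  qed (simp add: pts_def)
qed

lemma weight_bounds: "0 \<le> weight \<rho> z" "weight \<rho> z \<le> 1"
  by (auto simp: weight_def intro!: sum_nonneg)

lemma component_measurable:
  "i \<in> I \<Longrightarrow> (\<lambda>z. z i) \<in> borel_measurable (Pi\<^sub>M I (\<lambda>_. lborel :: (real^'d) measure))"
  using measurable_component_singleton[of i I "\<lambda>_. lborel :: (real^'d) measure"] by simp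

lemma weight_measurable:
  assumes [measurable]: "\<rho> \<in> borel_measurable N"
    and z: "\<And>i. i \<in> {1..k-l} \<Longrightarrow> (\<lambda>w. z w i) \<in> borel_measurable N"
  shows "(\<lambda>w. weight (\<rho> w) (z w)) \<in> borel_measurable N"
proof -
  have "(\<lambda>w. \<Sum>i=1..k-l. \<rho> w + r * (e \<bullet> z w i)) \<in> borel_measurable N"
    using z by (intro borel_measurable_sum borel_measurable_add borel_measurable_times borel_measurable_inner) auto
  moreover have "Measurable.pred N (\<lambda>w. \<forall>i\<in>{1..k-l}. 0 \<le> \<rho> w + r * (e \<bullet> z w i))"
  proof (rule pred_intros_finite(3))
    fix i assume "i \<in> {1..k-l}"
    from z[OF this] show "Measurable.pred N (\<lambda>w. 0 \<le> \<rho> w + r * (e \<bullet> z w i))" by measurable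
  qed simp
  ultimately show ?thesis unfolding weight_def by measurable
qed

lemma fst_measurable_base [measurable]: "fst \<in> borel_measurable base"
proof -
  have "(\<lambda>x. x) \<in> borel_measurable (restrict_space lborel {0::real..})"
    by (simp add: measurable_restrict_space1)
  from measurable_compose[OF measurable_fst this] show ?thesis by simp
qed

lemma joint_measurable:
  "(\<lambda>(p, z). weight (fst p) z * graph_ind P t (pts (snd p) z)) \<in> borel_measurable (base \<Otimes>\<^sub>M Z)"
proof -
  have 1: "(\<lambda>w. fst (fst w)) \<in> borel_measurable (base \<Otimes>\<^sub>M Z)"
    by (rule measurable_compose[OF measurable_fst fst_measurable_base])
  have 2: "(\<lambda>w. snd (fst w) i) \<in> borel_measurable (base \<Otimes>\<^sub>M Z)" if "i \<in> {1..l-1}" for i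
    by (rule measurable_compose[OF measurable_fst], rule measurable_compose[OF measurable_snd])
      (rule component_measurable[OF that])
  have 3: "(\<lambda>w. snd w i) \<in> borel_measurable (base \<Otimes>\<^sub>M Z)" if "i \<in> {1..k-l}" for i
    by (rule measurable_compose[OF measurable_snd]) (rule component_measurable[OF that])
  show ?thesis
    unfolding case_prod_beta
    by (intro borel_measurable_times weight_measurable pts_measurable 1 2 3)
qed

lemma f_measurable_base: "f t \<in> borel_measurable base"
proof -
  interpret Z: sigma_finite_measure Z by (rule sigma_finite_PiM_lborel) simp
  have "(\<lambda>p. \<integral>z. weight (fst p) z * graph_ind P t (pts (snd p) z) \<partial>Z) \<in> borel_measurable base"
    using joint_measurable[of t] by (intro Z.borel_measurable_lebesgue_integral) simp
  also have "(\<lambda>p. \<integral>z. weight (fst p) z * graph_ind P t (pts (snd p) z) \<partial>Z) = f t"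
    by (auto simp: f_eq fun_eq_iff)
  finally show ?thesis .
qed

lemma f_measurable: "f t \<in> borel_measurable (mu e r k l)"
  using f_measurable_base[of t] by (simp add: mu_def)

lemma f_nonpos: "t \<le> 0 \<Longrightarrow> f t p = 0"
  by (cases p) (simp add: f_eq graph_ind_nonpos)

text \<open>Points forming a connected graph with the origin at a threshold up to \<open>T\<close> lie in the ball of this radius.\<close>

definition radius :: "real \<Rightarrow> real" where "radius T = real (k\<^sup>2) * T"

definition vol :: "real \<Rightarrow> real" where
  "vol T = unit_ball_vol (real DIM(real^'d)) * radius T ^ DIM(real^'d)"

lemma vol_nonneg: "0 \<le> T \<Longrightarrow> 0 \<le> vol T"
  by (simp add: vol_def radius_def)

lemma radius_nonneg: "0 \<le> T \<Longrightarrow> 0 \<le> radius T"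
  by (simp add: radius_def)

lemma integrand_integrable:
  assumes T: "t \<le> T" "0 \<le> T"
  shows "integrable Z (\<lambda>z. weight \<rho> z * graph_ind P t (pts y z))"
proof (rule Bochner_Integration.integrable_bound)
  have fin: "finite {1..k-l}" by simp
  have "emeasure Z (config_box {1..k-l} (radius T)) < \<infinity>"
    unfolding emeasure_config_box[OF fin radius_nonneg[OF T(2)]] by simp
  then show "integrable Z (indicator (config_box {1..k-l} (radius T)) :: _ \<Rightarrow> real)"
    using config_box_sets[OF fin] by (simp add: integrable_indicator_iff)
  show "(\<lambda>z. weight \<rho> z * graph_ind P t (pts y z)) \<in> borel_measurable Z"
    by (intro borel_measurable_times weight_measurable pts_measurable component_measurable) auto
  show "AE z in Z. norm (weight \<rho> z * graph_ind P t (pts y z)) \<le> norm (indicator (config_box {1..k-l} (radius T)) z :: real)"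
  proof (rule AE_I2)
    fix z assume z: "z \<in> space Z"
    show "norm (weight \<rho> z * graph_ind P t (pts y z)) \<le> norm (indicator (config_box {1..k-l} (radius T)) z :: real)"
    proof (cases "graph_ind P t (pts y z) = 0")
      case False
      then have "norm x \<le> radius T" if "x \<in> set (pts y z)" for x
        using graph_ind_dist_le[OF False T(1), of x 0] that by (simp add: radius_def set_pts)
      then have "z \<in> config_box {1..k-l} (radius T)"
        using z by (auto simp: config_box_def set_pts)
      then show ?thesis using weight_bounds[of \<rho> z] by (auto simp: graph_ind_def)
    qed simp
  qed
qed

text \<open>The pair is charged to a \<open>z\<close>-coordinate whenever one of its points is such a coordinate,
  and to a \<open>y\<close>-coordinate otherwise.  So for a fixed \<open>y\<close> outside an exceptional set that does not involve \<open>z\<close>, a close pair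
  is always paid for by the integration over \<open>z\<close>.\<close>

lemma close_pair_cases:
  assumes z: "z \<in> space Z" and y: "y \<in> space Y" and s: "0 \<le> s"
    and norm: "\<And>x. x \<in> set (pts y z) \<Longrightarrow> norm x \<le> R"
    and pair: "x \<in> set (pts y z)" "x' \<in> set (pts y z)" "s < dist x x'" "dist x x' \<le> t"
  shows "y \<in> close_config {1..l-1} {0} R s t \<or>
    z \<in> close_config {1..k-l} (insert 0 (y ` {1..l-1})) R s t"
proof -
  have ny: "norm (y i) \<le> R" if "i \<in> {1..l-1}" for i using norm that by (auto simp: set_pts)
  have nz: "norm (z i) \<le> R" if "i \<in> {1..k-l}" for i using norm that by (auto simp: set_pts)
  have neq: "x \<noteq> x'" using pair(3) s by auto
  have zcase: "z \<in> close_config {1..k-l} (insert 0 (y ` {1..l-1})) R s t"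
    if a: "i \<in> {1..k-l}" "u \<in> set (pts y z)" "u \<noteq> z i" "s < dist u (z i)" "dist u (z i) \<le> t" for i u
  proof -
    consider "u \<in> insert 0 (y ` {1..l-1})" | j where "j \<in> {1..k-l} - {i}" "u = z j"
      using a(2,3) unfolding set_pts by blast
    then show ?thesis
    proof cases
      case 1
      then have "z \<in> shell_config {1..k-l} R s t i (\<lambda>_. u)"
        using z nz a by (auto simp: shell_config_def)
      then show ?thesis unfolding close_config_def using a(1) 1 by blast
    next
      case 2
      then have "z \<in> shell_config {1..k-l} R s t i (\<lambda>z. z j)"
        using z nz a by (auto simp: shell_config_def)
      then show ?thesis unfolding close_config_def using a(1) 2(1) by blast
    qed
  qed
  have ycase: "y \<in> close_config {1..l-1} {0} R s t"
    if a: "i \<in> {1..l-1}" "u \<in> insert 0 (y ` {1..l-1})" "u \<noteq> y i" "s < dist u (y i)" "dist u (y i) \<le> t" for i u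
  proof -
    consider "u = 0" | j where "j \<in> {1..l-1} - {i}" "u = y j"
      using a(2,3) by blast
    then show ?thesis
    proof cases
      case 1
      then have "y \<in> shell_config {1..l-1} R s t i (\<lambda>_. 0)"
        using y ny a by (auto simp: shell_config_def)
      then show ?thesis unfolding close_config_def using a(1) by blast
    next
      case 2
      then have "y \<in> shell_config {1..l-1} R s t i (\<lambda>z. z j)"
        using y ny a by (auto simp: shell_config_def)
      then show ?thesis unfolding close_config_def using a(1) 2(1) by blast
    qed
  qed
  consider i where "i \<in> {1..k-l}" "x' = z i" | i where "i \<in> {1..k-l}" "x = z i"
    | i where "x \<in> insert 0 (y ` {1..l-1})" "i \<in> {1..l-1}" "x' = y i"
    | i where "x' \<in> insert 0 (y ` {1..l-1})" "i \<in> {1..l-1}" "x = y i"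
    using pair(1,2) neq by (auto simp: set_pts)
  then show ?thesis
  proof cases
    case 1
    then show ?thesis using zcase[of i x] pair neq by auto
  next
    case 2
    then show ?thesis using zcase[of i x'] pair neq by (auto simp: dist_commute)
  next
    case 3
    then show ?thesis using ycase[of i x] pair neq by auto
  next
    case 4
    then show ?thesis using ycase[of i x'] pair neq by (auto simp: dist_commute)
  qed
qed

text \<open>How much the integrand at \<open>y\<close> can change between \<open>s\<close> and \<open>t\<close>: an amount of order \<open>t - s\<close> in general,
  and merely a bounded amount on the set of those \<open>y\<close> that contain a close pair themselves.  That set has measure of order \<open>t - s\<close>.\<close>

definition close_bound :: "real \<Rightarrow> real \<Rightarrow> real \<Rightarrow> (nat \<Rightarrow> real^'d) \<Rightarrow> ennreal" where
  "close_bound T s t y = indicator (config_box {1..l-1} (radius T)) y * ennreal (close_const TYPE(real^'d) (k-l) l (radius T) T * (t - s))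
     + indicator (close_config {1..l-1} {0} (radius T) s t) y * ennreal (vol T ^ (k-l))"

text \<open>Two bounds on the same increment, to be multiplied: the second one, uniform in \<open>s\<close> and \<open>t\<close>, reduces
  the square of the increment to its first power, for which the first one is of the right order.\<close>

lemma f_diff_le:
  assumes y: "y \<in> space Y" and st: "0 \<le> s" "s \<le> t" "t \<le> T"
  shows "ennreal \<bar>f t (\<rho>, y) - f s (\<rho>, y)\<bar> \<le> close_bound T s t y"
    and "ennreal \<bar>f t (\<rho>, y) - f s (\<rho>, y)\<bar> \<le> indicator (config_box {1..l-1} (radius T)) y * ennreal (vol T ^ (k-l))"
proof -
  let ?BY = "config_box {1..l-1} (radius T) :: (nat \<Rightarrow> real^'d) set"
  let ?BZ = "config_box {1..k-l} (radius T) :: (nat \<Rightarrow> real^'d) set"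
  let ?CY = "close_config {1..l-1} {0} (radius T) s t :: (nat \<Rightarrow> real^'d) set"
  let ?CZ = "close_config {1..k-l} (insert 0 (y ` {1..l-1})) (radius T) s t :: (nat \<Rightarrow> real^'d) set"
  have T: "0 \<le> T" "s \<le> T" using st by auto
  have R: "0 \<le> radius T" by (rule radius_nonneg[OF T(1)])
  define S where "S = {z \<in> space Z. (\<forall>x\<in>set (pts y z). norm x \<le> radius T) \<and>
    (\<exists>x\<in>set (pts y z). \<exists>x'\<in>set (pts y z). x \<noteq> x' \<and> s < dist x x' \<and> dist x x' \<le> t)}"
  have int: "integrable Z (\<lambda>z. weight \<rho> z * graph_ind P t (pts y z))"
    "integrable Z (\<lambda>z. weight \<rho> z * graph_ind P s (pts y z))"
    by (rule integrand_integrable[OF st(3) T(1)], rule integrand_integrable[OF T(2,1)])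
  have "f t (\<rho>, y) - f s (\<rho>, y) = (\<integral>z. weight \<rho> z * graph_ind P t (pts y z) - weight \<rho> z * graph_ind P s (pts y z) \<partial>Z)"
    unfolding f_eq using int by (rule Bochner_Integration.integral_diff[symmetric])
  then have "ennreal \<bar>f t (\<rho>, y) - f s (\<rho>, y)\<bar>
      \<le> (\<integral>\<^sup>+z. ennreal (norm (weight \<rho> z * graph_ind P t (pts y z) - weight \<rho> z * graph_ind P s (pts y z))) \<partial>Z)"
    using integral_norm_bound_ennreal[OF Bochner_Integration.integrable_diff[OF int]] by simp
  also have "\<dots> \<le> (\<integral>\<^sup>+z. indicator S z \<partial>Z)"
  proof (rule nn_integral_mono)
    fix z assume z: "z \<in> space Z"
    have "\<bar>weight \<rho> z * graph_ind P t (pts y z) - weight \<rho> z * graph_ind P s (pts y z)\<bar>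
        = weight \<rho> z * \<bar>graph_ind P t (pts y z) - graph_ind P s (pts y z)\<bar>"
      using weight_bounds[of \<rho> z] by (simp add: right_diff_distrib[symmetric] abs_mult)
    also have "\<dots> \<le> \<bar>graph_ind P t (pts y z) - graph_ind P s (pts y z)\<bar>"
      using weight_bounds[of \<rho> z] by (intro mult_left_le_one_le) auto
    also have "\<dots> \<le> indicator S z"
      using graph_ind_diff_le[OF st(2,3), of "pts y z"] z
      unfolding S_def radius_def indicator_def by (simp add: set_pts[of y z])
    finally show "ennreal (norm (weight \<rho> z * graph_ind P t (pts y z) - weight \<rho> z * graph_ind P s (pts y z)))
        \<le> indicator S z"
      by (simp add: ennreal_indicator[symmetric] ennreal_leI)
  qed
  finally have le_S: "ennreal \<bar>f t (\<rho>, y) - f s (\<rho>, y)\<bar> \<le> (\<integral>\<^sup>+z. indicator S z \<partial>Z)" .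
  have fin: "finite {1..k-l}" "finite (insert 0 (y ` {1..l-1}))" by auto
  have BZ: "?BZ \<in> sets Z" by (rule config_box_sets) simp
  have CZ: "?CZ \<in> sets Z" by (rule close_config_sets[OF fin])
  have SB: "S \<subseteq> ?BZ" by (auto simp: S_def config_box_def set_pts)
  have Sempty: "S = {}" if "y \<notin> ?BY"
    using that y by (auto simp: S_def config_box_def set_pts)
  have eB: "(\<integral>\<^sup>+z. indicator ?BZ z \<partial>Z) = ennreal (vol T ^ (k-l))"
    using BZ by (simp add: emeasure_config_box[OF _ R] vol_def)
  have le_B: "(\<integral>\<^sup>+z. indicator S z \<partial>Z) \<le> ennreal (vol T ^ (k-l))"
    using SB unfolding eB[symmetric] by (intro nn_integral_mono) (auto simp: indicator_def)
  show "ennreal \<bar>f t (\<rho>, y) - f s (\<rho>, y)\<bar> \<le> indicator ?BY y * ennreal (vol T ^ (k-l))"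
    using order_trans[OF le_S le_B] le_S Sempty by (cases "y \<in> ?BY") auto
  show "ennreal \<bar>f t (\<rho>, y) - f s (\<rho>, y)\<bar> \<le> close_bound T s t y"
  proof (cases "y \<in> ?BY")
    case False
    then show ?thesis using le_S Sempty by simp
  next
    case yB: True
    show ?thesis
    proof (cases "y \<in> ?CY")
      case True
      then have "ennreal (vol T ^ (k-l)) \<le> close_bound T s t y"
        by (simp add: close_bound_def)
      with order_trans[OF le_S le_B] show ?thesis by (rule order_trans)
    next
      case False
      have "S \<subseteq> ?CZ"
      proof
        fix z assume "z \<in> S"
        then obtain x x' where "z \<in> space Z" "\<And>x. x \<in> set (pts y z) \<Longrightarrow> norm x \<le> radius T"
          "x \<in> set (pts y z)" "x' \<in> set (pts y z)" "s < dist x x'" "dist x x' \<le> t"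
          unfolding S_def by blast
        from close_pair_cases[OF this(1) y st(1) this(2-6)] False show "z \<in> ?CZ" by blast
      qed
      then have "(\<integral>\<^sup>+z. indicator S z \<partial>Z) \<le> (\<integral>\<^sup>+z. indicator ?CZ z \<partial>Z)"
        by (intro nn_integral_mono) (auto simp: indicator_def)
      also have "\<dots> = emeasure Z ?CZ" using CZ by simp
      also have "\<dots> \<le> ennreal (close_const TYPE(real^'d) (card {1..k-l}) l (radius T) T * (t - s))"
      proof (rule emeasure_close_config_le[OF fin _ st R])
        have "card (insert 0 (y ` {1..l-1})) \<le> Suc (card (y ` {1..l-1}))"
          by (rule card_insert_le_m1) auto
        also have "\<dots> \<le> Suc (l - 1)" using card_image_le[of "{1..l-1}" y] by simp
        also have "\<dots> = l" using l by simp
        finally show "card (insert 0 (y ` {1..l-1})) \<le> l" .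
      qed
      also have "\<dots> = close_bound T s t y" using yB False by (simp add: close_bound_def)
      finally show ?thesis using le_S by (rule order_trans[rotated])
    qed
  qed
qed

text \<open>A bound for the density in \<open>y\<close>, times the uniform bound on the increment, times the integral of \<open>close_bound\<close> per unit
  of \<open>t - s\<close>.\<close>

definition incr_const :: "real \<Rightarrow> real" where
  "incr_const T = D_const TYPE('d) k l * exp (\<bar>r\<bar> * norm e * real (l - 1) * radius T) * vol T ^ (k-l) *
     (close_const TYPE(real^'d) (k-l) l (radius T) T * vol T ^ (l-1)
      + vol T ^ (k-l) * close_const TYPE(real^'d) (l-1) 1 (radius T) T)"

lemma incr_const_nonneg: "0 \<le> T \<Longrightarrow> 0 \<le> incr_const T"
  unfolding incr_const_def
  by (intro mult_nonneg_nonneg add_nonneg_nonneg close_const_nonneg D_const_nonneg zero_le_power vol_nonneg radius_nonneg) auto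

text \<open>Over bounded \<open>y\<close> the exponential tilt is bounded, and \<open>e\<^bsup>-l\<rho>\<^esup> \<le> e\<^bsup>-\<rho>\<^esup>\<close> leaves a density in
  \<open>\<rho>\<close> of total mass \<open>1\<close>.\<close>

lemma density_le:
  assumes "y \<in> config_box {1..l-1} (radius T)" "0 \<le> \<rho>" "0 \<le> T"
  shows "D_const TYPE('d) k l * exp (- real l * \<rho> - r * (\<Sum>i=1..l-1. e \<bullet> y i)) * of_bool b
    \<le> D_const TYPE('d) k l * exp (\<bar>r\<bar> * norm e * real (l - 1) * radius T) * exp (- \<rho>)"
proof -
  have "\<bar>\<Sum>i=1..l-1. e \<bullet> y i\<bar> \<le> (\<Sum>i=1..l-1. norm e * radius T)"
  proof (rule order_trans[OF sum_abs sum_mono])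
    fix i assume "i \<in> {1..l-1}"
    then have "norm (y i) \<le> radius T" using assms(1) by (auto simp: config_box_def)
    then show "\<bar>e \<bullet> y i\<bar> \<le> norm e * radius T"
      using Cauchy_Schwarz_ineq2[of e "y i"] mult_left_mono[of "norm (y i)" "radius T" "norm e"] by simp
  qed
  then have "\<bar>r * (\<Sum>i=1..l-1. e \<bullet> y i)\<bar> \<le> \<bar>r\<bar> * (real (l - 1) * (norm e * radius T))"
    unfolding abs_mult by (intro mult_left_mono) auto
  then have "- (r * (\<Sum>i=1..l-1. e \<bullet> y i)) \<le> \<bar>r\<bar> * norm e * real (l - 1) * radius T"
    by (simp add: mult_ac abs_le_iff)
  moreover have "1 * \<rho> \<le> real l * \<rho>" using l assms(2) by (intro mult_right_mono) auto
  ultimately have "exp (- real l * \<rho> - r * (\<Sum>i=1..l-1. e \<bullet> y i))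
      \<le> exp (\<bar>r\<bar> * norm e * real (l - 1) * radius T + - \<rho>)"
    by (subst exp_le_cancel_iff) linarith
  then have "exp (- real l * \<rho> - r * (\<Sum>i=1..l-1. e \<bullet> y i)) * of_bool b
      \<le> exp (\<bar>r\<bar> * norm e * real (l - 1) * radius T) * exp (- \<rho>)"
    unfolding exp_add by (cases b) simp_all
  then show ?thesis
    using mult_left_mono[OF _ D_const_nonneg[where 'd='d, of k l]] by (simp add: mult.assoc)
qed

text \<open>The measure and the increment are bounded by products of a function of \<open>\<rho>\<close> and a function of \<open>y\<close>, so the integral
  splits; the \<open>y\<close>-part is of order \<open>t - s\<close> by the shell estimate.  Taking \<open>s = 0\<close>, where the integrand vanishes, this
  also shows that the integrands are square integrable.\<close>

lemma f_increment_L2: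
  assumes st: "0 \<le> s" "s \<le> t" "t \<le> T"
  shows "(\<integral>\<^sup>+p. ennreal ((f t p - f s p)\<^sup>2) \<partial>mu e r k l) \<le> ennreal (incr_const T * (t - s))"
proof -
  interpret Y: sigma_finite_measure Y by (rule sigma_finite_PiM_lborel) simp
  have T: "0 \<le> T" using st by simp
  have R: "0 \<le> radius T" by (rule radius_nonneg[OF T])
  let ?BY = "config_box {1..l-1} (radius T) :: (nat \<Rightarrow> real^'d) set"
  let ?CY = "close_config {1..l-1} {0} (radius T) s t :: (nat \<Rightarrow> real^'d) set"
  define DE where "DE = D_const TYPE('d) k l * exp (\<bar>r\<bar> * norm e * real (l - 1) * radius T)"
  let ?cz = "close_const TYPE(real^'d) (k-l) l (radius T) T"
  let ?cy = "close_const TYPE(real^'d) (l-1) 1 (radius T) T"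
  have DE: "0 \<le> DE" unfolding DE_def by (intro mult_nonneg_nonneg D_const_nonneg) simp
  have fin: "finite {1..l-1}" by simp
  have BY[measurable]: "?BY \<in> sets Y" by (rule config_box_sets) simp
  have CY[measurable]: "?CY \<in> sets Y" by (rule close_config_sets) auto
  have cb[measurable]: "close_bound T s t \<in> borel_measurable Y" unfolding close_bound_def by measurable
  have dens: "(\<lambda>(\<rho>, y). ennreal (D_const TYPE('d) k l * exp (- real l * \<rho> - r * (\<Sum>i=1..l-1. e \<bullet> y i)) *
        of_bool (\<forall>i\<in>{1..l-1}. 0 \<le> \<rho> + r * (e \<bullet> y i)))) \<in> borel_measurable base"
  proof -
    have 2: "(\<lambda>w. snd w i) \<in> borel_measurable base" if "i \<in> {1..l-1}" for i
      by (rule measurable_compose[OF measurable_snd]) (rule component_measurable[OF that])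
    have 3[measurable]: "(\<lambda>w. \<Sum>i=1..l-1. e \<bullet> snd w i) \<in> borel_measurable base"
      using 2 by (intro borel_measurable_sum borel_measurable_inner) auto
    have 4[measurable]: "Measurable.pred base (\<lambda>w. \<forall>i\<in>{1..l-1}. 0 \<le> fst w + r * (e \<bullet> snd w i))"
    proof (rule pred_intros_finite(3))
      fix i assume "i \<in> {1..l-1}"
      from 2[OF this] show "Measurable.pred base (\<lambda>w. 0 \<le> fst w + r * (e \<bullet> snd w i))" by measurable
    qed simp
    show ?thesis unfolding case_prod_beta by measurable
  qed
  have fst_m: "(\<lambda>p. ennreal (exp (- fst p))) \<in> borel_measurable base"
    by measurable
  have cz: "0 \<le> ?cz" and cy: "0 \<le> ?cy" by (rule close_const_nonneg[OF R T])+
  have "(\<integral>\<^sup>+y. close_bound T s t y \<partial>Y)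
      = emeasure Y ?BY * ennreal (?cz * (t - s)) + emeasure Y ?CY * ennreal (vol T ^ (k-l))"
  proof -
    have 1: "(\<lambda>y. indicator ?BY y * ennreal (?cz * (t - s))) \<in> borel_measurable Y"
      "(\<lambda>y. indicator ?CY y * ennreal (vol T ^ (k-l))) \<in> borel_measurable Y"
      by measurable
    show ?thesis
      unfolding close_bound_def nn_integral_add[OF 1]
        nn_integral_multc[OF borel_measurable_indicator[OF BY]]
        nn_integral_multc[OF borel_measurable_indicator[OF CY]]
        nn_integral_indicator[OF BY] nn_integral_indicator[OF CY] ..
  qed
  also have "\<dots> \<le> ennreal (vol T ^ (l-1)) * ennreal (?cz * (t - s)) + ennreal (?cy * (t - s)) * ennreal (vol T ^ (k-l))"
  proof (intro add_mono mult_right_mono)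
    show "emeasure Y ?BY \<le> ennreal (vol T ^ (l-1))"
      unfolding emeasure_config_box[OF fin R] vol_def by simp
    show "emeasure Y ?CY \<le> ennreal (?cy * (t - s))"
      using emeasure_close_config_le[OF fin, of "{0}" 1 s t T "radius T"] st R by simp
  qed auto
  also have "\<dots> = ennreal (?cz * vol T ^ (l-1) * (t - s)) + ennreal (vol T ^ (k-l) * ?cy * (t - s))"
    using st vol_nonneg[OF T] cz cy by (simp add: ennreal_mult mult_ac)
  also have "\<dots> = ennreal ((?cz * vol T ^ (l-1) + vol T ^ (k-l) * ?cy) * (t - s))"
    unfolding distrib_right using st vol_nonneg[OF T] cz cy by (intro ennreal_plus[symmetric]) auto
  finally have close_bound_le: "(\<integral>\<^sup>+y. close_bound T s t y \<partial>Y)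
      \<le> ennreal ((?cz * vol T ^ (l-1) + vol T ^ (k-l) * ?cy) * (t - s))" .
  have "(\<integral>\<^sup>+p. ennreal ((f t p - f s p)\<^sup>2) \<partial>mu e r k l)
      = (\<integral>\<^sup>+p. (case p of (\<rho>, y) \<Rightarrow> ennreal (D_const TYPE('d) k l * exp (- real l * \<rho> - r * (\<Sum>i=1..l-1. e \<bullet> y i)) *
        of_bool (\<forall>i\<in>{1..l-1}. 0 \<le> \<rho> + r * (e \<bullet> y i)))) * ennreal ((f t p - f s p)\<^sup>2) \<partial>base)"
    unfolding mu_def using f_measurable_base[of t] f_measurable_base[of s]
    by (intro nn_integral_density dens) auto
  also have "\<dots> \<le> (\<integral>\<^sup>+p. ennreal (exp (- fst p)) * (ennreal (DE * vol T ^ (k-l)) * close_bound T s t (snd p)) \<partial>base)"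
  proof (rule nn_integral_mono)
    fix p assume p: "p \<in> space base"
    obtain \<rho> y where [simp]: "p = (\<rho>, y)" by (cases p)
    have \<rho>: "0 \<le> \<rho>" and y: "y \<in> space Y"
      using p by (auto simp: space_pair_measure space_restrict_space)
    note f1 = f_diff_le(1)[OF y st, of \<rho>] and f2 = f_diff_le(2)[OF y st, of \<rho>]
    show "(case p of (\<rho>, y) \<Rightarrow> ennreal (D_const TYPE('d) k l * exp (- real l * \<rho> - r * (\<Sum>i=1..l-1. e \<bullet> y i)) *
        of_bool (\<forall>i\<in>{1..l-1}. 0 \<le> \<rho> + r * (e \<bullet> y i)))) * ennreal ((f t p - f s p)\<^sup>2)
      \<le> ennreal (exp (- fst p)) * (ennreal (DE * vol T ^ (k-l)) * close_bound T s t (snd p))"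
    proof (cases "y \<in> ?BY")
      case False
      then have "f t p - f s p = 0" using f2 by simp
      then show ?thesis by simp
    next
      case True
      have "ennreal ((f t p - f s p)\<^sup>2) = ennreal \<bar>f t p - f s p\<bar> * ennreal \<bar>f t p - f s p\<bar>"
        by (simp add: ennreal_mult[symmetric] power2_eq_square)
      also have "\<dots> \<le> ennreal (vol T ^ (k-l)) * close_bound T s t y"
        using f1 f2 True by (intro mult_mono) auto
      finally have sq: "ennreal ((f t p - f s p)\<^sup>2) \<le> ennreal (vol T ^ (k-l)) * close_bound T s t y" .
      have "ennreal (D_const TYPE('d) k l * exp (- real l * \<rho> - r * (\<Sum>i=1..l-1. e \<bullet> y i)) *
          of_bool (\<forall>i\<in>{1..l-1}. 0 \<le> \<rho> + r * (e \<bullet> y i))) * ennreal ((f t p - f s p)\<^sup>2)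
        \<le> ennreal (DE * exp (- \<rho>)) * (ennreal (vol T ^ (k-l)) * close_bound T s t y)"
        unfolding DE_def by (intro mult_mono sq ennreal_leI density_le[OF True \<rho> T]) auto
      also have "\<dots> = ennreal (exp (- \<rho>)) * (ennreal (DE * vol T ^ (k-l)) * close_bound T s t y)"
        using DE vol_nonneg[OF T] by (simp add: ennreal_mult mult_ac)
      finally show ?thesis by simp
    qed
  qed
  also have "\<dots> = (\<integral>\<^sup>+\<rho>. (\<integral>\<^sup>+y. ennreal (exp (- \<rho>)) * (ennreal (DE * vol T ^ (k-l)) * close_bound T s t y) \<partial>Y) \<partial>restrict_space lborel {0..})"
  proof -
    have m: "(\<lambda>p. ennreal (exp (- fst p)) * (ennreal (DE * vol T ^ (k-l)) * close_bound T s t (snd p))) \<in> borel_measurable base"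
      by (intro borel_measurable_times_ennreal fst_m measurable_compose[OF measurable_snd cb] measurable_const) auto
    show ?thesis unfolding Y.nn_integral_fst[OF m, symmetric] by simp
  qed
  also have "\<dots> = (\<integral>\<^sup>+\<rho>. ennreal (exp (- \<rho>)) \<partial>restrict_space lborel {0..}) * (ennreal (DE * vol T ^ (k-l)) * (\<integral>\<^sup>+y. close_bound T s t y \<partial>Y))"
  proof -
    have 1: "(\<lambda>y. ennreal (DE * vol T ^ (k-l)) * close_bound T s t y) \<in> borel_measurable Y"
      by measurable
    have 2: "(\<lambda>\<rho>. ennreal (exp (- \<rho>))) \<in> borel_measurable (restrict_space lborel {0::real..})"
      by (simp add: measurable_restrict_space1)
    show ?thesis
      unfolding nn_integral_cmult[OF 1] nn_integral_cmult[OF cb] nn_integral_multc[OF 2] ..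
  qed
  also have "(\<integral>\<^sup>+\<rho>. ennreal (exp (- \<rho>)) \<partial>restrict_space lborel {0::real..}) = 1"
    using nn_intergal_power_times_exp_Ici[of 0] by (simp add: nn_integral_restrict_space)
  also have "1 * (ennreal (DE * vol T ^ (k-l)) * (\<integral>\<^sup>+y. close_bound T s t y \<partial>Y))
      \<le> ennreal (DE * vol T ^ (k-l)) * ennreal ((?cz * vol T ^ (l-1) + vol T ^ (k-l) * ?cy) * (t - s))"
    unfolding mult_1 by (intro mult_left_mono close_bound_le) simp
  also have "\<dots> = ennreal (DE * vol T ^ (k-l) * ((?cz * vol T ^ (l-1) + vol T ^ (k-l) * ?cy) * (t - s)))"
    using DE vol_nonneg[OF T] by (intro ennreal_mult'[symmetric]) simp
  finally show ?thesis
    unfolding incr_const_def DE_def[symmetric] by (simp only: mult.assoc)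
qed

end

section \<open>The limiting processes\<close>

context limit_integrand
begin

lemma f_L2: "0 \<le> t \<Longrightarrow> (\<integral>\<^sup>+p. ennreal ((f t p)\<^sup>2) \<partial>mu e r k l) < \<infinity>"
  using f_increment_L2[of 0 t t] by (simp add: f_nonpos le_less_trans)

lemma W_process_hoelder_modification:
  assumes "noise M (mu e r k l) (H l)" "0 < T"
  shows "\<exists>Y. modification_on {0..T} M (W_process M H e r k (graph_ind P) l) Y \<and>
    (\<forall>w\<in>space M. \<forall>\<gamma>\<in>{0..<1/2}. hoelder_on {0..T} \<gamma> (\<lambda>t. Y t w))"
proof -
  interpret noise M "mu e r k l" "H l" by fact
  \<comment> \<open>The summand \<open>1\<close> makes the constant positive, as the moment estimate requires.\<close>
  have C: "0 < incr_const T + 1" using incr_const_nonneg[of T] assms(2) by simp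
  have "(\<integral>\<^sup>+p. ennreal ((f t p - f s p)\<^sup>2) \<partial>mu e r k l) \<le> ennreal ((incr_const T + 1) * (t - s))"
    if "0 \<le> s" "s \<le> t" "t \<le> T" for s t
    by (rule order_trans[OF f_increment_L2[OF that]]) (use that in \<open>auto intro!: ennreal_leI mult_right_mono\<close>)
  then show ?thesis
    unfolding W_process_def[abs_def]
    using noise_integral_hoelder_modification[OF assms(2) _ _ C, of f] f_measurable f_L2 by auto
qed

end

text \<open>The case \<open>l = k\<close> with a property that survives an increase of the threshold.\<close>

locale top_integrand = limit_integrand P k e r k
  for P :: "(real^'d::finite) ugraph \<Rightarrow> bool" and k e r +
  assumes mono: "\<And>X s t. finite X \<Longrightarrow> s \<le> t \<Longrightarrow> P (geom_graph X s) \<Longrightarrow> P (geom_graph X t)"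
begin

definition region :: "real \<Rightarrow> (real \<times> (nat \<Rightarrow> real^'d)) set" where
  "region t = {p \<in> space (mu e r k k). P (geom_graph (set (0 # map (snd p) [1..<k])) t)}"

lemma f_eq_indicator: "p \<in> space (mu e r k k) \<Longrightarrow> f t p = indicator (region t) p"
  using W_integrand_top[of e r k "graph_ind P" t "fst p" "snd p"]
  by (simp add: region_def graph_ind_def indicator_def)

lemma region_fin_sets: "region t \<in> fin_sets (mu e r k k)"
proof -
  have sets: "region t \<in> sets (mu e r k k)"
  proof -
    have "region t \<subseteq> space (mu e r k k)" by (auto simp: region_def)
    then have "region t = {p \<in> space (mu e r k k). f t p = 1}"
      using f_eq_indicator[of _ t] by (auto simp: indicator_eq_1_iff)
    also have "\<dots> \<in> sets (mu e r k k)" using f_measurable[of t] by measurable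
    finally show ?thesis .
  qed
  have "emeasure (mu e r k k) (region t) = (\<integral>\<^sup>+p. indicator (region t) p \<partial>mu e r k k)"
    using sets by simp
  also have "\<dots> = (\<integral>\<^sup>+p. ennreal ((f t p)\<^sup>2) \<partial>mu e r k k)"
    by (intro nn_integral_cong) (auto simp: f_eq_indicator indicator_def)
  also have "\<dots> < \<infinity>"
  proof (cases "0 \<le> t")
    case True
    then show ?thesis by (rule f_L2)
  next
    case False
    then show ?thesis by (simp add: f_nonpos)
  qed
  finally show ?thesis using sets by (simp add: fin_sets_def)
qed

lemma region_mono: "s \<le> t \<Longrightarrow> region s \<subseteq> region t"
  unfolding region_def using mono[of "set (0 # map (snd p) [1..<k])" s t for p] by blast

lemma integral_eq_measure_region:
  "(\<integral>(\<rho>, y). graph_ind P t (0 # map y [1..<k]) \<partial>mu e r k k) = measure (mu e r k k) (region t)"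
proof -
  have "(\<integral>(\<rho>, y). graph_ind P t (0 # map y [1..<k]) \<partial>mu e r k k) = (\<integral>p. indicator (region t) p \<partial>mu e r k k)"
    by (intro Bochner_Integration.integral_cong) (auto simp: region_def graph_ind_def indicator_def)
  also have "\<dots> = measure (mu e r k k) (region t)"
    using region_fin_sets[of t] sets.sets_into_space by (simp add: fin_sets_def Int_absorb2)
  finally show ?thesis .
qed

lemma W_process_same_fdds_brownian:
  assumes "noise M (mu e r k k) (H k)" and B: "std_brownian_motion N B"
  shows "same_fdds {0..} M (W_process M H e r k (graph_ind P) k)
    N (\<lambda>t. B (\<integral>(\<rho>, y). graph_ind P t (0 # map y [1..<k]) \<partial>mu e r k k))"
  unfolding integral_eq_measure_region
proof -
  interpret noise M "mu e r k k" "H k" by fact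
  have W: "has_noise_integral M (mu e r k k) (H k) (f t) (W_process M H e r k (graph_ind P) k t)" if "0 \<le> t" for t
    unfolding W_process_def by (rule has_noise_integral_noise_integral[OF f_measurable f_L2[OF that]])
  show "same_fdds {0..} M (W_process M H e r k (graph_ind P) k) N (\<lambda>t. B (measure (mu e r k k) (region t)))"
  proof (rule same_fdds_brownian[OF B region_fin_sets region_mono])
    fix t :: real assume t: "0 \<le> t"
    show "W_process M H e r k (graph_ind P) k t \<in> borel_measurable M"
      using W[OF t] by (simp add: has_noise_integral_def)
    have "has_noise_integral M (mu e r k k) (H k) (f t) (H k (region t))"
      using has_noise_integral_indicator[OF region_fin_sets[of t]] f_eq_indicator[of _ t]
      by (subst has_noise_integral_cong) auto
    from has_noise_integral_unique[OF W[OF t] this]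
    show "AE w in M. W_process M H e r k (graph_ind P) k t w = H k (region t) w" .
  qed
qed

end

theorem proposition5p2:
  fixes \<Gamma> :: "'v ugraph"
    and k j :: nat
    and \<psi> \<psi>' \<psi>'' a :: "real \<Rightarrow> real"
    and c :: ereal
    and r :: real
    and i\<^sub>1 :: "'d::finite"
    and e\<^sub>1 :: "real^'d"
    and M :: "'w measure"
    and H :: "nat \<Rightarrow> (real \<times> (nat \<Rightarrow> real^'d)) set \<Rightarrow> 'w \<Rightarrow> real"
  assumes "k \<ge> 2"
    and "simple_graph \<Gamma>" "connected_graph \<Gamma>" "card (verts \<Gamma>) = k" "card (edges \<Gamma>) = j"
    and "\<And>z. z \<ge> 0 \<Longrightarrow> (\<psi> has_real_derivative \<psi>' z) (at z within {0..})"
    and "\<And>z. z \<ge> 0 \<Longrightarrow> (\<psi>' has_real_derivative \<psi>'' z) (at z within {0..})"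
    and "continuous_on {0..} \<psi>''"
    and "\<And>z. z > 0 \<Longrightarrow> \<psi>' z > 0"
    and "filterlim \<psi> at_top at_top"
    and "((\<lambda>z. deriv (\<lambda>u. 1 / \<psi>' u) z) \<longlongrightarrow> 0) at_top"
    and "\<And>z. z > 0 \<Longrightarrow> a z = 1 / \<psi>' z"
    and "c > 0" and "((\<lambda>z. ereal (a z)) \<longlongrightarrow> c) at_top"
    and "r = (if c = \<infinity> then 0 else 1 / real_of_ereal c)"
    and "e\<^sub>1 = axis i\<^sub>1 1"
    and "prob_space M"
    and "\<And>l. l \<in> {1..k} \<Longrightarrow> gaussian_noise M (mu e\<^sub>1 r k l) (H l)"
    and "prob_space.indep_sets M (\<lambda>l. noise_events M (mu e\<^sub>1 r k l) (H l)) {1..k}"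
  shows "(\<forall>(N::'b measure) B. std_brownian_motion N B \<longrightarrow>
           same_fdds {0..} M (W_process M H e\<^sub>1 r k (h_plus \<Gamma>) k)
             N (\<lambda>t. B (\<integral>(\<rho>, y). h_plus \<Gamma> t (0 # map y [1..<k]) \<partial>(mu e\<^sub>1 r k k))) \<and>
           same_fdds {0..} M (W_process M H e\<^sub>1 r k (h_minus \<Gamma>) k)
             N (\<lambda>t. B (\<integral>(\<rho>, y). h_minus \<Gamma> t (0 # map y [1..<k]) \<partial>(mu e\<^sub>1 r k k)))) \<and>
         (\<forall>l\<in>{1..k}. \<forall>T>0. \<exists>Y.
           modification_on {0..T} M (W_process M H e\<^sub>1 r k (h_ind \<Gamma>) l) Y \<and>
           (\<forall>w\<in>space M. \<forall>\<gamma>\<in>{0..<1/2}. hoelder_on {0..T} \<gamma> (\<lambda>t. Y t w)))"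
proof -
  note \<Gamma> = \<open>simple_graph \<Gamma>\<close> \<open>connected_graph \<Gamma>\<close>
  have noise: "noise M (mu e\<^sub>1 r k l) (H l)" if "l \<in> {1..k}" for l
    using assms(17) assms(18)[OF that] by (simp add: noise_def noise_axioms_def)
  have iso: "graph_property (\<lambda>G :: (real^'d) ugraph. graph_iso G \<Gamma>) k"
    and denser: "graph_property (denser \<Gamma> :: (real^'d) ugraph \<Rightarrow> bool) k"
    using graph_property_iso[OF _ \<Gamma>] graph_property_denser[of \<Gamma>] assms(1,4) by auto
  have plus: "top_integrand (\<lambda>G :: (real^'d) ugraph. graph_iso G \<Gamma> \<or> denser \<Gamma> G) k"
  proof (intro top_integrand.intro limit_integrand.intro graph_property_disj iso denser
      limit_integrand_axioms.intro top_integrand_axioms.intro)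
    show "graph_iso (geom_graph X t) \<Gamma> \<or> denser \<Gamma> (geom_graph X t)"
      if "finite X" "s \<le> t" "graph_iso (geom_graph X s) \<Gamma> \<or> denser \<Gamma> (geom_graph X s)" for X :: "(real^'d) set" and s t
      using iso_or_denser_mono[OF \<Gamma> that(3,1,2)] .
  qed (use assms(1) in auto)
  have minus: "top_integrand (denser \<Gamma> :: (real^'d) ugraph \<Rightarrow> bool) k"
  proof (intro top_integrand.intro limit_integrand.intro denser
      limit_integrand_axioms.intro top_integrand_axioms.intro)
    show "denser \<Gamma> (geom_graph X t)"
      if "finite X" "s \<le> t" "denser \<Gamma> (geom_graph X s)" for X :: "(real^'d) set" and s t
      using denser_mono[OF that(3,1,2)] .
  qed (use assms(1) in auto)
  have k: "k \<in> {1..k}" using assms(1) by simp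
  show ?thesis
  proof (intro conjI allI impI ballI)
    fix N :: "'b measure" and B assume B: "std_brownian_motion N B"
    show "same_fdds {0..} M (W_process M H e\<^sub>1 r k (h_plus \<Gamma>) k)
             N (\<lambda>t. B (\<integral>(\<rho>, y). h_plus \<Gamma> t (0 # map y [1..<k]) \<partial>(mu e\<^sub>1 r k k)))"
      unfolding h_plus_eq_graph_ind[OF \<Gamma>(1)]
      by (rule top_integrand.W_process_same_fdds_brownian[where H=H, OF plus noise[OF k] B])
    show "same_fdds {0..} M (W_process M H e\<^sub>1 r k (h_minus \<Gamma>) k)
             N (\<lambda>t. B (\<integral>(\<rho>, y). h_minus \<Gamma> t (0 # map y [1..<k]) \<partial>(mu e\<^sub>1 r k k)))"
      unfolding h_minus_eq_graph_ind
      by (rule top_integrand.W_process_same_fdds_brownian[where H=H, OF minus noise[OF k] B])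
  next
    fix l and T :: real assume l: "l \<in> {1..k}" and T: "0 < T"
    have "limit_integrand (\<lambda>G :: (real^'d) ugraph. graph_iso G \<Gamma>) k l"
      using l by (intro limit_integrand.intro iso limit_integrand_axioms.intro) auto
    from limit_integrand.W_process_hoelder_modification[where H=H, OF this noise[OF l] T]
    show "\<exists>Y. modification_on {0..T} M (W_process M H e\<^sub>1 r k (h_ind \<Gamma>) l) Y \<and>
           (\<forall>w\<in>space M. \<forall>\<gamma>\<in>{0..<1/2}. hoelder_on {0..T} \<gamma> (\<lambda>t. Y t w))"
      unfolding h_ind_eq_graph_ind .
  qed
qed

end
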